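(* Let $c_0>0$, $l>0$ and let $\sigma\in\mathscr{P}(\mathbb{R}^2)$ be such that $\mathrm{spt}(\sigma)\subset B_l^+$. Assume that $\theta_0(z)-z\theta_0'(z)>0$ for all $z\in(0,H)$ and that $\theta_0$ is Lipschitz continuous on $[0,H]$. (i) $\mathcal{K}[\sigma]$ admits a unique minimizer $\varrho_0$ over $\mathcal{R}_0$. Furthermore, if $(P_0,\Psi_0)\in\mathcal{U}_0$ is a maximizer of $\mathcal{J}[\sigma]$ on $\mathcal{U}$, then $\mathcal{T}[P_0]$ pushes $\mu_{\varrho_0}$ forward onto $\sigma$, so that $\mathcal{K}[\sigma](\varrho_0)=\mathcal{J}[\sigma](P_0,\Psi_0)+\mathbf{m}_2[\sigma]$, and $\varrho_0$ is monotone nondecreasing on $[0,H]$ and satisfies $$2(1-2r_0^2\varrho_0(z))\,P_0(\varrho_0(z),z,\theta_0(z))=r_0^2\Omega^2\quad\text{on }\{\varrho_0>0\}.$$ If, additionally, $\sigma$ is absolutely continuous with respect to Lebesgue measure, then $\mathcal{S}[\Psi_0]$ pushes $\sigma$ forward onto $\mu_{\varrho_0}$ and $$\mathcal{S}[\Psi_0]\circ\mathcal{T}[P_0]=\mathrm{id}\quad\mu_{\varrho_0}\text{-a.e.},\qquad \mathcal{T}[P_0]\circ\mathcal{S}[\Psi_0]=\mathrm{id}\quad\sigma\text{-a.e.}$$ (ii) Assume that $\sigma$ is absolutely continuous with respect to Lebesgue measure $\mathcal{L}^2$, that $\frac{d\sigma}{d\mathcal{L}^2}>c_0$ $\mathcal{L}^2$-a.e.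 on $B_l^+$ and that $\mathrm{spt}(\sigma)=\overline{B_l^+}$. If $(P_0,\Psi_0),(P_1,\Psi_1)\in\mathcal{U}_0$ are such that $(P_0,\Psi_0)$ is a maximizer of $\mathcal{J}[\sigma]$ and $\mathcal{J}[\sigma](P_0,\Psi_0)=\mathcal{J}[\sigma](P_1,\Psi_1)$, then $P_1=P_0$ on $\mathcal{W}\times\mathcal{I}_0$ and $\Psi_1=\Psi_0$ on $B_l^+$. (iii) Assume that $\inf_{0\le z\le H}\{\theta_0(z)-z\theta_0'(z)\}>0$ and that $(P_0,\Psi_0)\in\mathcal{U}_0$ is a maximizer of $\mathcal{J}[\sigma]$ such that $\partial_zP_0\ge b_0$ $\mathcal{L}^3$-a.e. for some $b_0>0$. For any $z_1,z_2\in[0,H]$ such that $\varrho_0(z_1),\varrho_0(z_2)>0$, there exists $C>0$ such that $$|z_2-z_1|\le C|\varrho_0(z_2)-\varrho_0(z_1)|.$$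
   Context: Constants $r_0,H,\Omega>0$ are fixed. $\mathcal{W}=[0,1/(2r_0^2))\times[0,H]$; points are written $\mathbf p=(s,z)\in\mathcal{W}$ and $\mathbf q=(\Upsilon,Z)\in\mathbb{R}^2$. $f_0(s)=\frac{r_0^2\Omega^2}{2(1-2r_0^2s)}$ for $s\in[0,1/(2r_0^2))$. $\mathcal{R}$ is the set of Borel functions $\varrho:[0,H]\to[0,1/(2r_0^2))$; for $\varrho\in\mathcal{R}$, $D_\varrho=\{(s,z):0\le s\le\varrho(z),\ z\in[0,H]\}$ and $\mu_\varrho$ is the Borel measure on $\mathbb{R}^2$ with Lebesgue density $(2f_0(s)/\Omega^2)^2\chi_{D_\varrho}(s,z)$. $\mathcal{R}_0$ is the set of $\varrho\in\mathcal{R}$ for which $\mu_\varrho$ is a probability measure. Functions $\varrho$ that agree $\mathcal{L}^1$-a.e. are identified (they give the same $\mu_\varrho$), so the uniqueness and the pointwise properties (monotonicity, boundary relation) of $\varrho_0$ are understood for a suitable representative. $B_a$ is the ball in $\mathbb{R}^2$ of center $(0,0)$ and radius $a$, $B_a^+=B_a\cap((0,\infty)\times(0,\infty))$. $\mathscr{P}(\mathbb{R}^2)$ is the set of Borel probability measures on $\mathbb{R}^2$; $\mathrm{spt}$ denotes support. $\mathcal{I}_0\subset\mathbb{R}_+$ is an open bounded interval with $0\notin\overline{\mathcal{I}_0}$; $\theta_0:[0,H]\to\mathcal{I}_0$ is smooth on $(0,H)$; $\phi(z)=z/\theta_0(z)$; $\mathbf f(s,z)=(s,z/\theta_0(z))$.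 The cost is $c(\mathbf p,m,\mathbf q)=s\Upsilon+\frac{zZ}{m}$. $\mathcal{U}$ is the set of $(P,\Psi)\in C(\overline{\mathcal{W}}\times\overline{\mathcal{I}_0})\times C(\overline{B_l})$ with $P(\mathbf p,m)+\Psi(\mathbf q)\ge c(\mathbf p,m,\mathbf q)$ for all $(\mathbf p,m,\mathbf q)\in\mathcal{W}\times\mathcal{I}_0\times B_l^+$. $\mathcal{U}_0\subset\mathcal{U}$ is the set of pairs with $P(\mathbf p,m)=\sup_{\mathbf q\in\overline{B_l^+}}\{c(\mathbf p,m,\mathbf q)-\Psi(\mathbf q)\}$ for $(\mathbf p,m)\in\mathcal{W}\times\mathcal{I}_0$ and $\Psi(\mathbf q)=\sup_{(\mathbf p,m)\in\mathcal{W}\times\mathcal{I}_0}\{c(\mathbf p,m,\mathbf q)-P(\mathbf p,m)\}$ for $\mathbf q\in B_l$. For $\varrho\in[0,1/(2r_0^2))$, $z\in[0,H]$: $\mathscr{S}_{\theta_0}[P](\varrho,z)=\int_0^\varrho\big(f_0(s)-P(s,z,\theta_0(z))\big)(2f_0(s)/\Omega^2)^2\,ds$. Dual functional: $\mathcal{J}[\sigma](P,\Psi)=-\int_{\mathbb{R}^2}\Psi\,d\sigma+\mathscr{H}(P)$ with $\mathscr{H}(P)=\inf_{\varrho\in\mathcal{R}}\int_0^H\mathscr{S}_{\theta_0}[P](\varrho(z),z)\,dz$. Primal functional: for $\varrho\in\mathcal{R}_0$, $\mathcal{K}[\sigma](\varrho)=\frac12W_2^2(\sigma,\mathbf f\#\mu_\varrho)+\int_{\mathbb{R}^2}\Big(f_0(s)-\frac12\big(s^2+\frac{z^2}{\theta_0^2(z)}\big)\Big)\mu_\varrho(d\mathbf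 p)$, and $\mathcal{K}[\sigma](\varrho)=+\infty$ for $\varrho\in\mathcal{R}\setminus\mathcal{R}_0$, where $W_2$ is the $2$-Wasserstein distance. $\mathbf{m}_2[\sigma]=\frac12\int_{\mathbb{R}^2}|\mathbf q|^2\,\sigma(d\mathbf q)$. At points where the derivatives exist (almost everywhere), $\mathcal{T}[P](\mathbf p)=\big(\partial_sP(\mathbf p,\theta_0(z)),\ \theta_0(z)\,\partial_zP(\mathbf p,\theta_0(z))\big)$ and $\mathcal{S}[\Psi](\mathbf q)=\big(\partial_\Upsilon\Psi(\mathbf q),\ \phi^{-1}(\partial_Z\Psi(\mathbf q))\big)$. *)

theory Defs
  imports "HOL-Probability.Probability"
begin

subsection \<open>Measures, integrals, transport\<close>

definition spt :: "'a::topological_space measure \<Rightarrow> 'a set" where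
  "spt M = {x. \<forall>U. open U \<and> x \<in> U \<longrightarrow> emeasure M U \<noteq> 0}"

definition borel_prob :: "(real \<times> real) measure set" where
  "borel_prob = {M. sets M = sets borel \<and> prob_space M}"

text \<open>The integral of \<open>f\<close> over \<open>A\<close> with values in the extended reals, so that a function whose
  positive part has infinite integral gets the value \<open>\<infinity>\<close>, whereas the Bochner integral would
  assign it the value \<open>0\<close>. In all uses below the negative part has finite integral.\<close>

definition ext_integral :: "'a measure \<Rightarrow> 'a set \<Rightarrow> ('a \<Rightarrow> real) \<Rightarrow> ereal" where
  "ext_integral M A f =
     enn2ereal (\<integral>\<^sup>+x\<in>A. ennreal (f x) \<partial>M) - enn2ereal (\<integral>\<^sup>+x\<in>A. ennreal (- f x) \<partial>M)"

definition couplings ::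
  "(real \<times> real) measure \<Rightarrow> (real \<times> real) measure \<Rightarrow> ((real \<times> real) \<times> (real \<times> real)) measure set" where
  "couplings M N =
     {G. sets G = sets borel \<and> distr G borel fst = M \<and> distr G borel snd = N}"

text \<open>The square of the 2-Wasserstein distance. The distance on \<open>real \<times> real\<close> is the Euclidean one.\<close>

definition wasserstein2_sq :: "(real \<times> real) measure \<Rightarrow> (real \<times> real) measure \<Rightarrow> ennreal" where
  "wasserstein2_sq M N = (INF G \<in> couplings M N. \<integral>\<^sup>+(x, y). ennreal ((dist x y)\<^sup>2) \<partial>G)"

definition second_moment :: "(real \<times> real) measure \<Rightarrow> ereal" where
  "second_moment M = ereal (1/2) * enn2ereal (\<integral>\<^sup>+q. ennreal ((norm q)\<^sup>2) \<partial>M)"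

text \<open>The maps to be pushed forward below are only determined almost everywhere (they are built
  from partial derivatives), hence the Borel version \<open>T'\<close>.\<close>

definition pushes_forward ::
  "((real \<times> real) \<Rightarrow> (real \<times> real)) \<Rightarrow> (real \<times> real) measure \<Rightarrow> (real \<times> real) measure \<Rightarrow> bool" where
  "pushes_forward T M N \<longleftrightarrow>
     (\<exists>T' \<in> borel_measurable M. (AE x in M. T x = T' x) \<and> distr M borel T' = N)"

definition smooth_on :: "real set \<Rightarrow> (real \<Rightarrow> real) \<Rightarrow> bool" where
  "smooth_on S f \<longleftrightarrow> (\<forall>n. \<forall>x\<in>S. (deriv ^^ n) f differentiable (at x))"

definition Bplus :: "real \<Rightarrow> (real \<times> real) set" where
  "Bplus a = ball (0, 0) a \<inter> ({0<..} \<times> {0<..})"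


subsection \<open>Domains and the measures of the free boundary problem\<close>

definition W_set :: "real \<Rightarrow> real \<Rightarrow> (real \<times> real) set" where
  "W_set r\<^sub>0 H = {0..<1 / (2 * r\<^sub>0\<^sup>2)} \<times> {0..H}"

definition f0 :: "real \<Rightarrow> real \<Rightarrow> real \<Rightarrow> real" where
  "f0 r\<^sub>0 \<Omega> s = r\<^sub>0\<^sup>2 * \<Omega>\<^sup>2 / (2 * (1 - 2 * r\<^sub>0\<^sup>2 * s))"

definition R_set :: "real \<Rightarrow> real \<Rightarrow> (real \<Rightarrow> real) set" where
  "R_set r\<^sub>0 H =
     {\<rho>. \<rho> \<in> borel_measurable (restrict_space borel {0..H}) \<and>
         (\<forall>z\<in>{0..H}. \<rho> z \<in> {0..<1 / (2 * r\<^sub>0\<^sup>2)})}"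

definition D_set :: "real \<Rightarrow> (real \<Rightarrow> real) \<Rightarrow> (real \<times> real) set" where
  "D_set H \<rho> = {(s, z). 0 \<le> s \<and> s \<le> \<rho> z \<and> z \<in> {0..H}}"

definition mu :: "real \<Rightarrow> real \<Rightarrow> real \<Rightarrow> (real \<Rightarrow> real) \<Rightarrow> (real \<times> real) measure" where
  "mu r\<^sub>0 H \<Omega> \<rho> =
     density lborel (\<lambda>p. ennreal ((2 * f0 r\<^sub>0 \<Omega> (fst p) / \<Omega>\<^sup>2)\<^sup>2) * indicator (D_set H \<rho>) p)"

definition R0_set :: "real \<Rightarrow> real \<Rightarrow> real \<Rightarrow> (real \<Rightarrow> real) set" where
  "R0_set r\<^sub>0 H \<Omega> = {\<rho> \<in> R_set r\<^sub>0 H. prob_space (mu r\<^sub>0 H \<Omega> \<rho>)}"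


subsection \<open>Primal problem\<close>

text \<open>\<open>\<theta>\<^sub>0\<close> is a total function of which only the values on \<open>{0..H}\<close> matter; the value \<open>0\<close> of
  \<open>f_map\<close> outside keeps it Borel. All measures \<open>mu r\<^sub>0 H \<Omega> \<rho>\<close> are concentrated on \<open>W_set r\<^sub>0 H\<close>.\<close>

definition f_map :: "real \<Rightarrow> (real \<Rightarrow> real) \<Rightarrow> real \<times> real \<Rightarrow> real \<times> real" where
  "f_map H \<theta>\<^sub>0 p = (if snd p \<in> {0..H} then (fst p, snd p / \<theta>\<^sub>0 (snd p)) else 0)"

definition K_fun ::
  "real \<Rightarrow> real \<Rightarrow> real \<Rightarrow> (real \<Rightarrow> real) \<Rightarrow> (real \<times> real) measure \<Rightarrow> (real \<Rightarrow> real) \<Rightarrow> ereal" where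
  "K_fun r\<^sub>0 H \<Omega> \<theta>\<^sub>0 \<sigma> \<rho> =
     (if \<rho> \<in> R0_set r\<^sub>0 H \<Omega> then
        ereal (1/2) * enn2ereal (wasserstein2_sq \<sigma> (distr (mu r\<^sub>0 H \<Omega> \<rho>) borel (f_map H \<theta>\<^sub>0)))
        + ext_integral (mu r\<^sub>0 H \<Omega> \<rho>) (W_set r\<^sub>0 H)
            (\<lambda>(s, z). f0 r\<^sub>0 \<Omega> s - (s\<^sup>2 + z\<^sup>2 / (\<theta>\<^sub>0 z)\<^sup>2) / 2)
      else \<infinity>)"

definition K_minimizer ::
  "real \<Rightarrow> real \<Rightarrow> real \<Rightarrow> (real \<Rightarrow> real) \<Rightarrow> (real \<times> real) measure \<Rightarrow> (real \<Rightarrow> real) \<Rightarrow> bool" where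
  "K_minimizer r\<^sub>0 H \<Omega> \<theta>\<^sub>0 \<sigma> \<rho> \<longleftrightarrow>
     \<rho> \<in> R0_set r\<^sub>0 H \<Omega> \<and>
     (\<forall>\<rho>' \<in> R0_set r\<^sub>0 H \<Omega>. K_fun r\<^sub>0 H \<Omega> \<theta>\<^sub>0 \<sigma> \<rho> \<le> K_fun r\<^sub>0 H \<Omega> \<theta>\<^sub>0 \<sigma> \<rho>')"


subsection \<open>Dual problem\<close>

definition cost :: "real \<times> real \<Rightarrow> real \<Rightarrow> real \<times> real \<Rightarrow> real" where
  "cost p m q = fst p * fst q + snd p * snd q / m"

type_synonym potential = "(real \<times> real) \<times> real \<Rightarrow> real"

text \<open>Elements of \<open>C(X)\<close> are represented by total functions that are continuous on \<open>X\<close>. Everything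
  below depends only on their values on \<open>X\<close>, up to null sets where derivatives are involved.\<close>

definition U_set ::
  "real \<Rightarrow> real \<Rightarrow> real set \<Rightarrow> real \<Rightarrow> (potential \<times> (real \<times> real \<Rightarrow> real)) set" where
  "U_set r\<^sub>0 H I\<^sub>0 l =
     {(P, \<Psi>).
        continuous_on (closure (W_set r\<^sub>0 H) \<times> closure I\<^sub>0) P \<and>
        continuous_on (closure (ball (0, 0) l)) \<Psi> \<and>
        (\<forall>p \<in> W_set r\<^sub>0 H. \<forall>m \<in> I\<^sub>0. \<forall>q \<in> Bplus l. P (p, m) + \<Psi> q \<ge> cost p m q)}"

text \<open>The suprema are taken over nonempty sets that are bounded above, by continuity of \<open>P\<close> and
  \<open>\<Psi>\<close> on compact sets, so the supremum of the conditionally complete reals is the right one.\<close>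

definition U0_set ::
  "real \<Rightarrow> real \<Rightarrow> real set \<Rightarrow> real \<Rightarrow> (potential \<times> (real \<times> real \<Rightarrow> real)) set" where
  "U0_set r\<^sub>0 H I\<^sub>0 l =
     {(P, \<Psi>) \<in> U_set r\<^sub>0 H I\<^sub>0 l.
        (\<forall>p \<in> W_set r\<^sub>0 H. \<forall>m \<in> I\<^sub>0.
           P (p, m) = (SUP q \<in> closure (Bplus l). cost p m q - \<Psi> q)) \<and>
        (\<forall>q \<in> ball (0, 0) l.
           \<Psi> q = (SUP (p, m) \<in> W_set r\<^sub>0 H \<times> I\<^sub>0. cost p m q - P (p, m)))}"

definition S_fun ::
  "real \<Rightarrow> real \<Rightarrow> (real \<Rightarrow> real) \<Rightarrow> potential \<Rightarrow> real \<Rightarrow> real \<Rightarrow> real" where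
  "S_fun r\<^sub>0 \<Omega> \<theta>\<^sub>0 P r z =
     (LINT s:{0..r}|lborel. (f0 r\<^sub>0 \<Omega> s - P ((s, z), \<theta>\<^sub>0 z)) * (2 * f0 r\<^sub>0 \<Omega> s / \<Omega>\<^sup>2)\<^sup>2)"

definition H_fun :: "real \<Rightarrow> real \<Rightarrow> real \<Rightarrow> (real \<Rightarrow> real) \<Rightarrow> potential \<Rightarrow> ereal" where
  "H_fun r\<^sub>0 H \<Omega> \<theta>\<^sub>0 P =
     (INF \<rho> \<in> R_set r\<^sub>0 H. ext_integral lborel {0..H} (\<lambda>z. S_fun r\<^sub>0 \<Omega> \<theta>\<^sub>0 P (\<rho> z) z))"

text \<open>\<open>\<Psi>\<close> is meaningful on the closed ball of radius \<open>l\<close> only, and \<open>J_fun\<close> is used for measures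
  \<open>\<sigma>\<close> that are concentrated there.\<close>

definition J_fun ::
  "real \<Rightarrow> real \<Rightarrow> real \<Rightarrow> (real \<Rightarrow> real) \<Rightarrow> real \<Rightarrow> (real \<times> real) measure
   \<Rightarrow> potential \<Rightarrow> (real \<times> real \<Rightarrow> real) \<Rightarrow> ereal" where
  "J_fun r\<^sub>0 H \<Omega> \<theta>\<^sub>0 l \<sigma> P \<Psi> =
     - ereal (LINT q:closure (ball (0, 0) l)|\<sigma>. \<Psi> q) + H_fun r\<^sub>0 H \<Omega> \<theta>\<^sub>0 P"

definition J_maximizer ::
  "real \<Rightarrow> real \<Rightarrow> real \<Rightarrow> (real \<Rightarrow> real) \<Rightarrow> real set \<Rightarrow> real \<Rightarrow> (real \<times> real) measure
   \<Rightarrow> potential \<Rightarrow> (real \<times> real \<Rightarrow> real) \<Rightarrow> bool" where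
  "J_maximizer r\<^sub>0 H \<Omega> \<theta>\<^sub>0 I\<^sub>0 l \<sigma> P \<Psi> \<longleftrightarrow>
     (P, \<Psi>) \<in> U_set r\<^sub>0 H I\<^sub>0 l \<and>
     (\<forall>(P', \<Psi>') \<in> U_set r\<^sub>0 H I\<^sub>0 l. J_fun r\<^sub>0 H \<Omega> \<theta>\<^sub>0 l \<sigma> P' \<Psi>' \<le> J_fun r\<^sub>0 H \<Omega> \<theta>\<^sub>0 l \<sigma> P \<Psi>)"


subsection \<open>The transport maps\<close>

text \<open>The partial derivatives of \<open>P\<close> are taken with respect to the slots \<open>s\<close> and \<open>z\<close> of
  \<open>P ((s, z), m)\<close>, at fixed \<open>m\<close>; in \<open>T_map\<close> they are then evaluated at \<open>m = \<theta>\<^sub>0 z\<close>.\<close>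

definition ds :: "potential \<Rightarrow> potential" where
  "ds P = (\<lambda>((s, z), m). deriv (\<lambda>t. P ((t, z), m)) s)"

definition dz :: "potential \<Rightarrow> potential" where
  "dz P = (\<lambda>((s, z), m). deriv (\<lambda>t. P ((s, t), m)) z)"

definition T_map :: "(real \<Rightarrow> real) \<Rightarrow> potential \<Rightarrow> real \<times> real \<Rightarrow> real \<times> real" where
  "T_map \<theta>\<^sub>0 P p = (ds P (p, \<theta>\<^sub>0 (snd p)), \<theta>\<^sub>0 (snd p) * dz P (p, \<theta>\<^sub>0 (snd p)))"

definition phi :: "(real \<Rightarrow> real) \<Rightarrow> real \<Rightarrow> real" where
  "phi \<theta>\<^sub>0 z = z / \<theta>\<^sub>0 z"

definition S_map ::
  "real \<Rightarrow> (real \<Rightarrow> real) \<Rightarrow> (real \<times> real \<Rightarrow> real) \<Rightarrow> real \<times> real \<Rightarrow> real \<times> real" where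
  "S_map H \<theta>\<^sub>0 \<Psi> q =
     (deriv (\<lambda>t. \<Psi> (t, snd q)) (fst q),
      the_inv_into {0..H} (phi \<theta>\<^sub>0) (deriv (\<lambda>t. \<Psi> (fst q, t)) (snd q)))"

end

theory Submission
  imports Defs "HOL-Complex_Analysis.Great_Picard"
begin

text \<open>
  Fix \<open>\<Psi>\<close> and let \<open>p\<close> be its Legendre transform over the closed quarter disc \<open>Q\<close>. For a pair in
  \<open>U0_set\<close> the potential is \<open>P ((s, z), m) = p (s, z / m)\<close>, a convex function of the point \<open>(s, y)\<close>
  with \<open>y = z / m\<close>; only the slopes \<open>y = phi \<theta>\<^sub>0 z\<close> enter the functionals. Since \<open>phi \<theta>\<^sub>0\<close> is strictly
  increasing, the problem becomes one about columns: the column with slope \<open>y\<close> is filled up to a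
  height \<open>r\<close> that minimizes the integral of \<open>f0 - p (\<cdot>, y)\<close> over \<open>{0..r}\<close> against the density of \<open>mu\<close>,
  and the dual functional of \<open>\<Psi>\<close> is the integral over \<open>z\<close> of these minimal energies minus the integral
  of \<open>\<Psi>\<close> against \<open>\<sigma>\<close>.

  The integrand \<open>f0 - p\<close> is a difference of convex functions of \<open>s\<close>, so a column may have several
  optimal heights. They are nevertheless ordered: \<open>p\<close> increases with \<open>y\<close>, and exchanging the heights of
  two columns shows that if the optimal heights of two slopes overlap, then \<open>p\<close> does not depend on \<open>y\<close>
  there (\<open>minimizers_overlap\<close>), hence by convexity nor for any smaller slope. Up to countably many
  slopes this happens wherever a column is ambiguous (\<open>gap_const\<close>), so between the lowest and the highest
  optimal profile the gradient of \<open>p\<close> has vertical component zero.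

  Let \<open>\<Psi>\<close> maximize the dual functional. Perturbing it by a nonnegative function in both directions and
  using the envelope theorem (\<open>first_variation\<close>) shows that the gradient of \<open>p\<close> pushes the measure of
  the lowest profile to something below \<open>\<sigma>\<close> and that of the highest profile to something above \<open>\<sigma>\<close>, on
  open sets. Away from vertical component zero both images agree, and \<open>\<sigma>\<close> does not charge vertical
  component zero; so the lowest profile is transported exactly to \<open>\<sigma>\<close> (\<open>optimal_transport\<close>).

  Everything else follows from this. The transport coupling closes the duality gap (\<open>weak_duality\<close>,
  \<open>strong_duality\<close>), and equality in the duality makes any other minimizer optimal in almost every
  column, hence above the lowest profile, hence equal to it because both have mass one
  (\<open>duality_equality\<close>). A dual maximizer exists by the theorem of Arzela and Ascoli, since double
  Legendre transforms are equi-Lipschitz and the functional is coercive (\<open>dual_optimal_exists\<close>). The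
  boundary relation is the first-order condition in a column. Points in contact are gradients of each
  other, which inverts the transport when \<open>\<sigma>\<close> is absolutely continuous (\<open>S_map_transport\<close>). Two dual
  maximizers have common contact points over all of \<open>Q\<close> when \<open>\<sigma>\<close> has full support; telescoping along
  segments they differ by a constant, and the boundary relation makes the constant zero
  (\<open>dual_optimal_unique\<close>). Finally, a lower bound on the vertical derivative of \<open>P\<close> makes \<open>p\<close> strictly
  increasing in \<open>y\<close>, so two columns cannot satisfy the boundary relation at the same positive height
  (\<open>column_strict\<close>).
\<close>

section \<open>Convex functions and their subgradients along lines\<close>

definition subgrads :: "('a::real_inner \<Rightarrow> real) \<Rightarrow> 'a \<Rightarrow> 'a set" where
  "subgrads F x = {g. \<forall>y. F x + g \<bullet> (y - x) \<le> F y}"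

text \<open>The limit runs along the steps \<open>1 / Suc n\<close> only, which makes the directional derivative a Borel
  function as a limit of a sequence.\<close>

definition dir_deriv :: "'a::real_normed_vector \<Rightarrow> ('a \<Rightarrow> real) \<Rightarrow> 'a \<Rightarrow> real" where
  "dir_deriv e F x = lim (\<lambda>n. (F (x + (1 / Suc n) *\<^sub>R e) - F x) * real (Suc n))"

text \<open>For a convex function this says that the left and right derivatives along \<open>e\<close> agree; only
  countable quantifiers occur, so that the set of such points is Borel.\<close>

definition dir_smooth :: "'a::real_normed_vector \<Rightarrow> ('a \<Rightarrow> real) \<Rightarrow> 'a \<Rightarrow> bool" where
  "dir_smooth e F x \<longleftrightarrow> (\<forall>k. \<exists>n. (F (x + (1 / Suc n) *\<^sub>R e) + F (x - (1 / Suc n) *\<^sub>R e) - 2 * F x) * real (Suc n)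
     < 1 / Suc k)"

lemma selection_mono:
  fixes f G :: "real \<Rightarrow> real"
  assumes sub: "\<And>x y. f x + G x * (y - x) \<le> f y"
  shows "mono G"
proof (rule monoI)
  fix x y :: real assume "x \<le> y"
  have "(G x - G y) * (y - x) \<le> 0" using sub[of x y] sub[of y x] by (simp add: algebra_simps)
  then show "G x \<le> G y" using \<open>x \<le> y\<close> by (cases "x = y") (auto simp: mult_le_0_iff)
qed

lemma selection_quotient_bounds:
  fixes f G :: "real \<Rightarrow> real"
  assumes sub: "\<And>x y. f x + G x * (y - x) \<le> f y"
  shows "h > 0 \<Longrightarrow> G t \<le> (f (t + h) - f t) / h" "h > 0 \<Longrightarrow> (f (t + h) - f t) / h \<le> G (t + h)"
    "h < 0 \<Longrightarrow> (f (t + h) - f t) / h \<le> G t" "h < 0 \<Longrightarrow> G (t + h) \<le> (f (t + h) - f t) / h"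
  using sub[of t "t + h"] sub[of "t + h" t] by (auto simp: field_simps)

text \<open>The difference quotient lies between the values of the subgradient selection at the two endpoints,
  so continuity of the selection gives the derivative.\<close>

lemma selection_deriv_isCont:
  fixes f G :: "real \<Rightarrow> real"
  assumes sub: "\<And>x y. f x + G x * (y - x) \<le> f y" and c: "isCont G t"
  shows "(f has_real_derivative G t) (at t)"
  unfolding DERIV_def
proof (rule LIM_I)
  fix r :: real assume "r > 0"
  then obtain d where d: "d > 0" "\<And>s. \<bar>s - t\<bar> < d \<Longrightarrow> \<bar>G s - G t\<bar> < r"
    using c unfolding continuous_at_eps_delta dist_real_def by metis
  show "\<exists>s>0. \<forall>h. h \<noteq> 0 \<and> norm (h - 0) < s \<longrightarrow> norm ((f (t + h) - f t) / h - G t) < r"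
  proof (intro exI[of _ d] conjI allI impI)
    fix h :: real assume h: "h \<noteq> 0 \<and> norm (h - 0) < d"
    then have "\<bar>G (t + h) - G t\<bar> < r" using d(2)[of "t+h"] by auto
    then show "norm ((f (t + h) - f t) / h - G t) < r"
      using h selection_quotient_bounds[OF sub, of h t] by (cases "h > 0") auto
  qed (rule d)
qed

lemma selection_chord_mono:
  fixes f G :: "real \<Rightarrow> real"
  assumes sub: "\<And>x y. f x + G x * (y - x) \<le> f y" and h: "0 < h" "h \<le> k"
  shows "(f (t + h) - f t) / h \<le> (f (t + k) - f t) / k"
    "(f t - f (t - k)) / k \<le> (f t - f (t - h)) / h"
proof -
  define q where "q = (f (t + h) - f t) / h"
  have "q \<le> G (t + h)" using selection_quotient_bounds(2)[OF sub h(1)] by (simp add: q_def)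
  then have "q * (k - h) \<le> G (t + h) * (k - h)" using h by (intro mult_right_mono) auto
  moreover have "q * h = f (t + h) - f t" using h by (simp add: q_def)
  ultimately have "q * k \<le> f (t + k) - f t" using sub[of "t + h" "t + k"] by (simp add: algebra_simps)
  then show "(f (t + h) - f t) / h \<le> (f (t + k) - f t) / k" using h by (simp add: q_def field_simps)
next
  define q where "q = (f t - f (t - h)) / h"
  have "G (t - h) \<le> q"
    using selection_quotient_bounds(4)[OF sub, of "-h" t] h(1) by (simp add: q_def field_simps)
  then have "G (t - h) * (k - h) \<le> q * (k - h)" using h by (intro mult_right_mono) auto
  moreover have "q * h = f t - f (t - h)" using h by (simp add: q_def)
  ultimately have "f t - f (t - k) \<le> q * k" using sub[of "t - h" "t - k"] by (simp add: algebra_simps)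
  then show "(f t - f (t - k)) / k \<le> (f t - f (t - h)) / h" using h by (simp add: q_def field_simps)
qed

text \<open>Chord slopes are monotone in the step, so all difference quotients with step at most \<open>1 / Suc n\<close>
  lie between the left and the right slope at that step, an interval whose length is the second
  difference quotient.\<close>

lemma selection_deriv_criterion:
  fixes f G :: "real \<Rightarrow> real"
  assumes sub: "\<And>x y. f x + G x * (y - x) \<le> f y"
    and c: "\<And>k. \<exists>n. (f (t + 1 / Suc n) + f (t - 1 / Suc n) - 2 * f t) * real (Suc n) < 1 / Suc k"
  shows "(f has_real_derivative G t) (at t)"
  unfolding DERIV_def
proof (rule LIM_I)
  fix r :: real assume "r > 0"
  then obtain k :: nat where k: "1 / Suc k < r" using nat_approx_posE by blast
  obtain n where n: "(f (t + 1 / Suc n) + f (t - 1 / Suc n) - 2 * f t) * real (Suc n) < 1 / Suc k" using c by blast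
  define d where "d = 1 / real (Suc n)"
  have d: "d > 0" by (simp add: d_def)
  have n': "(f (t + d) - f t) / d - (f t - f (t - d)) / d < r"
  proof -
    have "(f (t + d) - f t) / d - (f t - f (t - d)) / d = (f (t + d) + f (t - d) - 2 * f t) / d"
      using d by (simp add: field_simps)
    also have "\<dots> = (f (t + d) + f (t - d) - 2 * f t) * real (Suc n)" by (simp add: d_def)
    finally show ?thesis using n k by (simp add: d_def)
  qed
  show "\<exists>s>0. \<forall>h. h \<noteq> 0 \<and> norm (h - 0) < s \<longrightarrow> norm ((f (t + h) - f t) / h - G t) < r"
  proof (intro exI[of _ d] conjI allI impI)
    fix h :: real assume h: "h \<noteq> 0 \<and> norm (h - 0) < d"
    have a: "G t \<le> (f (t + d) - f t) / d" "(f t - f (t - d)) / d \<le> G t"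
      using selection_quotient_bounds(1)[OF sub, of d t] selection_quotient_bounds(3)[OF sub, of "-d" t] d
      by (auto simp: field_simps)
    show "norm ((f (t + h) - f t) / h - G t) < r"
    proof (cases "h > 0")
      case True
      then show ?thesis using a n' selection_quotient_bounds(1)[OF sub, of h t]
          selection_chord_mono(1)[OF sub, of h d t] h by auto
    next
      case False
      then have "h < 0" using h by auto
      moreover have "(f (t + h) - f t) / h = (f t - f (t - (-h))) / (-h)" using h by (simp add: field_simps)
      ultimately show ?thesis using a n' selection_quotient_bounds(3)[OF sub, of h t]
          selection_chord_mono(2)[OF sub, of "-h" d t] h by auto
    qed
  qed (rule d)
qed

lemma deriv_sequentially:
  fixes f :: "real \<Rightarrow> real"
  assumes "(f has_real_derivative D) (at t)"
  shows "(\<lambda>n. (f (t + 1 / Suc n) - f t) * real (Suc n)) \<longlonglongrightarrow> D"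
    "(\<lambda>n. (f t - f (t - 1 / Suc n)) * real (Suc n)) \<longlonglongrightarrow> D"
proof -
  have D: "(\<lambda>h. (f (t + h) - f t) / h) \<midarrow>0\<rightarrow> D" using assms by (simp add: DERIV_def)
  have "filterlim (\<lambda>n. 1 / real (Suc n)) (at 0) sequentially"
    using LIMSEQ_Suc[OF lim_1_over_n[where 'a=real]] by (simp add: filterlim_at)
  from filterlim_compose[OF D this]
  show "(\<lambda>n. (f (t + 1 / Suc n) - f t) * real (Suc n)) \<longlonglongrightarrow> D" by (simp add: field_simps)
  have "filterlim (\<lambda>n. - (1 / real (Suc n))) (at 0) sequentially"
    using tendsto_minus[OF LIMSEQ_Suc[OF lim_1_over_n[where 'a=real]]]
    by (simp add: filterlim_at)
  from filterlim_compose[OF D this]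
  show "(\<lambda>n. (f t - f (t - 1 / Suc n)) * real (Suc n)) \<longlonglongrightarrow> D" by (simp add: field_simps)
qed

lemma subgrads_line:
  assumes "g \<in> subgrads F (x + s *\<^sub>R e)"
  shows "F (x + s *\<^sub>R e) + (g \<bullet> e) * (t - s) \<le> F (x + t *\<^sub>R e)"
proof -
  have eq: "(x + t *\<^sub>R e) - (x + s *\<^sub>R e) = (t - s) *\<^sub>R e" by (simp add: algebra_simps)
  have "F (x + s *\<^sub>R e) + g \<bullet> ((x + t *\<^sub>R e) - (x + s *\<^sub>R e)) \<le> F (x + t *\<^sub>R e)"
    using assms unfolding subgrads_def by blast
  then show ?thesis unfolding eq by (simp add: mult.commute)
qed

lemma dir_smooth_imp_has_derivative:
  assumes sub: "\<And>x. subgrads F x \<noteq> {}" and fl: "dir_smooth e F x" and g: "g \<in> subgrads F x"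
  shows "((\<lambda>t. F (x + t *\<^sub>R e)) has_real_derivative g \<bullet> e) (at 0)"
proof -
  define sel where "sel t = (if t = 0 then g else SOME g. g \<in> subgrads F (x + t *\<^sub>R e))" for t :: real
  have sel: "sel t \<in> subgrads F (x + t *\<^sub>R e)" for t
    using g sub[of "x + t *\<^sub>R e"] by (auto simp: sel_def some_in_eq)
  have "F (x + s *\<^sub>R e) + (sel s \<bullet> e) * (t - s) \<le> F (x + t *\<^sub>R e)" for s t
    by (rule subgrads_line[OF sel])
  from selection_deriv_criterion[of "\<lambda>t. F (x + t *\<^sub>R e)" "\<lambda>t. sel t \<bullet> e" 0, OF this]
  show ?thesis using fl by (simp add: dir_smooth_def sel_def)
qed

lemma deriv_imp_dir_smooth:
  assumes "((\<lambda>t. F (x + t *\<^sub>R e)) has_real_derivative D) (at 0)"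
  shows "dir_smooth e F x" "dir_deriv e F x = D"
proof -
  note D = deriv_sequentially[OF assms, simplified]
  show "dir_deriv e F x = D" unfolding dir_deriv_def using D(1) by (intro limI) simp
  have "(\<lambda>n. (F (x + (1 / Suc n) *\<^sub>R e) + F (x - (1 / Suc n) *\<^sub>R e) - 2 * F x) * real (Suc n)) \<longlonglongrightarrow> 0"
    using tendsto_diff[OF D] by (simp add: algebra_simps)
  note lim = this
  show "dir_smooth e F x"
    unfolding dir_smooth_def
  proof
    fix k :: nat
    have "1 / real (Suc k) > 0" by simp
    from eventually_happens'[OF sequentially_bot order_tendstoD(2)[OF lim this]]
    show "\<exists>n. (F (x + (1 / Suc n) *\<^sub>R e) + F (x - (1 / Suc n) *\<^sub>R e) - 2 * F x) * real (Suc n)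
      < 1 / Suc k" .
  qed
qed

lemma dir_smooth_subgrad:
  assumes "\<And>x. subgrads F x \<noteq> {}" "dir_smooth e F x" "g \<in> subgrads F x"
  shows "dir_deriv e F x = g \<bullet> e"
  using deriv_imp_dir_smooth(2)[OF dir_smooth_imp_has_derivative[OF assms]] .

text \<open>Along a line a subgradient selection is monotone, hence continuous up to countably many points.\<close>

lemma countable_not_dir_smooth:
  assumes sub: "\<And>x. subgrads F x \<noteq> {}"
  shows "countable {t. \<not> dir_smooth e F (x + t *\<^sub>R e)}"
proof -
  define sel where "sel t = (SOME g. g \<in> subgrads F (x + t *\<^sub>R e))" for t :: real
  have sel: "sel t \<in> subgrads F (x + t *\<^sub>R e)" for t
    using sub[of "x + t *\<^sub>R e"] by (auto simp: sel_def some_in_eq)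
  have s: "F (x + s *\<^sub>R e) + (sel s \<bullet> e) * (t - s) \<le> F (x + t *\<^sub>R e)" for s t
    by (rule subgrads_line[OF sel])
  have "dir_smooth e F (x + t *\<^sub>R e)" if "isCont (\<lambda>t. sel t \<bullet> e) t" for t
  proof -
    have "((\<lambda>u. F (x + u *\<^sub>R e)) has_real_derivative sel t \<bullet> e) (at (0 + t))"
      using selection_deriv_isCont[of "\<lambda>t. F (x + t *\<^sub>R e)", OF s that] by simp
    then have "((\<lambda>u. F (x + t *\<^sub>R e + u *\<^sub>R e)) has_real_derivative sel t \<bullet> e) (at 0)"
      unfolding DERIV_shift by (simp add: algebra_simps)
    then show ?thesis by (rule deriv_imp_dir_smooth)
  qed
  then have "{t. \<not> dir_smooth e F (x + t *\<^sub>R e)} \<subseteq> {t. \<not> isCont (\<lambda>t. sel t \<bullet> e) t}" by blast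
  moreover have "countable {t. \<not> isCont (\<lambda>t. sel t \<bullet> e) t}"
    using mono_ctble_discont[OF selection_mono[of "\<lambda>t. F (x + t *\<^sub>R e)", OF s]] by simp
  ultimately show ?thesis by (rule countable_subset)
qed

section \<open>The Legendre transform over a compact set\<close>

text \<open>The convex conjugate with the supremum restricted to \<open>Q\<close>; for compact \<open>Q\<close> it is finite and
  Lipschitz on the whole space.\<close>

definition legendre :: "'a::euclidean_space set \<Rightarrow> ('a \<Rightarrow> real) \<Rightarrow> 'a \<Rightarrow> real" where
  "legendre Q \<psi> x = (SUP q\<in>Q. x \<bullet> q - \<psi> q)"

lemma legendre_bdd:
  assumes "compact Q" "continuous_on Q \<psi>"
  shows "bdd_above ((\<lambda>q. x \<bullet> q - \<psi> q) ` Q)"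
  by (intro bounded_imp_bdd_above compact_imp_bounded compact_continuous_image continuous_intros assms)

lemma legendre_ge:
  assumes "compact Q" "continuous_on Q \<psi>" "q \<in> Q"
  shows "x \<bullet> q - \<psi> q \<le> legendre Q \<psi> x"
  unfolding legendre_def by (rule cSUP_upper[OF assms(3) legendre_bdd[OF assms(1,2)]])

lemma legendre_least:
  assumes "Q \<noteq> {}" "\<And>q. q \<in> Q \<Longrightarrow> x \<bullet> q - \<psi> q \<le> c"
  shows "legendre Q \<psi> x \<le> c"
  unfolding legendre_def by (rule cSUP_least[OF assms])

lemma legendre_attained:
  assumes "compact Q" "continuous_on Q \<psi>" "Q \<noteq> {}"
  obtains q where "q \<in> Q" "legendre Q \<psi> x = x \<bullet> q - \<psi> q"
proof -
  have "continuous_on Q (\<lambda>q. x \<bullet> q - \<psi> q)" by (intro continuous_intros assms)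
  from continuous_attains_sup[OF assms(1,3) this]
  obtain q where q: "q \<in> Q" "\<forall>y\<in>Q. x \<bullet> y - \<psi> y \<le> x \<bullet> q - \<psi> q" by blast
  have "legendre Q \<psi> x = x \<bullet> q - \<psi> q"
    using q by (intro antisym legendre_least assms legendre_ge) auto
  with q(1) that show thesis by blast
qed

text \<open>A point that attains the supremum is a subgradient; this is why optimal couplings live on graphs
  of gradients.\<close>

lemma contact_subgrad:
  assumes "compact Q" "continuous_on Q \<psi>" "q \<in> Q" "legendre Q \<psi> x = x \<bullet> q - \<psi> q"
  shows "q \<in> subgrads (legendre Q \<psi>) x"
  unfolding subgrads_def
proof (intro CollectI allI)
  fix y
  have "q \<bullet> (y - x) = y \<bullet> q - x \<bullet> q" by (simp add: inner_diff_right inner_commute)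
  then show "legendre Q \<psi> x + q \<bullet> (y - x) \<le> legendre Q \<psi> y"
    using legendre_ge[OF assms(1-3), of y] assms(4) by simp
qed

lemma legendre_subgrads_nonempty:
  assumes "compact Q" "continuous_on Q \<psi>" "Q \<noteq> {}"
  shows "subgrads (legendre Q \<psi>) x \<noteq> {}"
  using legendre_attained[OF assms, of x] contact_subgrad[OF assms(1,2), of _ x] by blast

lemma legendre_lipschitz:
  assumes "compact Q" "continuous_on Q \<psi>" "Q \<noteq> {}" "\<And>q. q \<in> Q \<Longrightarrow> norm q \<le> L"
  shows "\<bar>legendre Q \<psi> x - legendre Q \<psi> y\<bar> \<le> L * norm (x - y)"
proof -
  have "legendre Q \<psi> x \<le> legendre Q \<psi> y + L * norm (x - y)" for x y
  proof (rule legendre_least[OF assms(3)])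
    fix q assume q: "q \<in> Q"
    have "x \<bullet> q - y \<bullet> q = (x - y) \<bullet> q" by (simp add: inner_diff_left)
    also have "\<dots> \<le> norm (x - y) * norm q" by (rule norm_cauchy_schwarz)
    also have "\<dots> \<le> L * norm (x - y)" using assms(4)[OF q] by (simp add: mult.commute[of "norm (x - y)"] mult_right_mono)
    finally show "x \<bullet> q - \<psi> q \<le> legendre Q \<psi> y + L * norm (x - y)"
      using legendre_ge[OF assms(1,2) q, of y] by simp
  qed
  from this[of x y] this[of y x] show ?thesis by (simp add: norm_minus_commute)
qed

lemma legendre_continuous:
  assumes "compact Q" "continuous_on Q \<psi>" "Q \<noteq> {}"
  shows "continuous_on A (legendre Q \<psi>)"
proof -
  obtain L where L: "\<And>q. q \<in> Q \<Longrightarrow> norm q \<le> L"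
    using compact_imp_bounded[OF assms(1)] by (auto simp: bounded_iff)
  obtain q where "q \<in> Q" using assms(3) by blast
  then have "L \<ge> 0" using L norm_ge_zero order_trans by blast
  have "L-lipschitz_on A (legendre Q \<psi>)"
    using legendre_lipschitz[OF assms L] \<open>L \<ge> 0\<close> by (auto simp: lipschitz_on_def dist_norm)
  then show ?thesis by (rule lipschitz_on_continuous_on)
qed

lemma legendre_antimono:
  assumes "compact Q" "continuous_on Q \<psi>" "Q \<noteq> {}" "\<And>q. q \<in> Q \<Longrightarrow> \<psi> q \<le> \<psi>' q + e"
  shows "legendre Q \<psi>' x \<le> legendre Q \<psi> x + e"
proof (rule legendre_least[OF assms(3)])
  fix q assume "q \<in> Q"
  then show "x \<bullet> q - \<psi>' q \<le> legendre Q \<psi> x + e"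
    using legendre_ge[OF assms(1,2), of q x] assms(4)[of q] by linarith
qed

lemma legendre_mono_arg:
  assumes "compact Q" "continuous_on Q \<psi>" "Q \<noteq> {}" "\<And>q. q \<in> Q \<Longrightarrow> x \<bullet> q \<le> y \<bullet> q"
  shows "legendre Q \<psi> x \<le> legendre Q \<psi> y"
proof (rule legendre_least[OF assms(3)])
  fix q assume "q \<in> Q"
  then show "x \<bullet> q - \<psi> q \<le> legendre Q \<psi> y"
    using legendre_ge[OF assms(1,2), of q y] assms(4)[of q] by linarith
qed

lemma legendre_perturb_bound:
  assumes "compact Q" "continuous_on Q \<psi>" "continuous_on Q \<xi>" "Q \<noteq> {}"
    and B: "\<And>q. q \<in> Q \<Longrightarrow> \<bar>\<xi> q\<bar> \<le> B" and e: "e \<ge> 0"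
  shows "\<bar>legendre Q \<psi> x - legendre Q (\<lambda>q. \<psi> q + e * \<xi> q) x\<bar> \<le> e * B"
proof -
  have c: "continuous_on Q (\<lambda>q. \<psi> q + e * \<xi> q)" by (intro continuous_intros assms)
  have b: "\<bar>e * \<xi> q\<bar> \<le> e * B" if "q \<in> Q" for q
    using B[OF that] e by (auto simp: abs_mult intro: mult_left_mono)
  have "legendre Q \<psi> x \<le> legendre Q (\<lambda>q. \<psi> q + e * \<xi> q) x + e * B"
    by (rule legendre_antimono[OF assms(1) c assms(4)]) (use b in force)
  moreover have "legendre Q (\<lambda>q. \<psi> q + e * \<xi> q) x \<le> legendre Q \<psi> x + e * B"
    by (rule legendre_antimono[OF assms(1,2,4)]) (use b in force)
  ultimately show ?thesis by linarith
qed

text \<open>Envelope theorem: to first order, the transform only feels the perturbation at the unique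
  maximizer.\<close>

lemma legendre_perturb:
  assumes Q: "compact Q" and \<psi>: "continuous_on Q \<psi>" and \<xi>: "continuous_on Q \<xi>" and "Q \<noteq> {}"
    and uniq: "\<And>q. q \<in> Q \<Longrightarrow> legendre Q \<psi> x = x \<bullet> q - \<psi> q \<Longrightarrow> q = g"
  shows "(\<lambda>n. (legendre Q \<psi> x - legendre Q (\<lambda>q. \<psi> q + 1 / real (Suc n) * \<xi> q) x) * real (Suc n))
           \<longlonglongrightarrow> \<xi> g"
proof (rule LIMSEQ_I)
  fix e' :: real assume "e' > 0"
  define e where "e = e' / 2"
  have "e > 0" "e < e'" using \<open>e' > 0\<close> by (auto simp: e_def)
  define p where "p = legendre Q \<psi> x"
  define pn where "pn n = legendre Q (\<lambda>q. \<psi> q + 1 / real (Suc n) * \<xi> q) x" for n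
  obtain g' where "g' \<in> Q" "p = x \<bullet> g' - \<psi> g'" unfolding p_def by (rule legendre_attained[OF Q \<psi> assms(4)])
  then have g: "g \<in> Q" "p = x \<bullet> g - \<psi> g" using uniq[of g'] by (auto simp: p_def)
  obtain B where B: "\<And>q. q \<in> Q \<Longrightarrow> \<bar>\<xi> q\<bar> \<le> B"
    using compact_imp_bounded[OF compact_continuous_image[OF \<xi> Q]] by (auto simp: bounded_iff)
  have cn: "continuous_on Q (\<lambda>q. \<psi> q + 1 / real (Suc n) * \<xi> q)" for n by (intro continuous_intros \<psi> \<xi>)
  have up: "(p - pn n) * real (Suc n) \<le> \<xi> g" for n
  proof -
    have "p - 1 / real (Suc n) * \<xi> g \<le> pn n"
      using legendre_ge[OF Q cn g(1), of x n] g(2) by (simp add: pn_def)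
    then show ?thesis by (simp add: field_simps)
  qed
  have pnlow: "p - 1 / real (Suc n) * B \<le> pn n" for n
    using legendre_perturb_bound[OF Q \<psi> \<xi> assms(4) B, of "1 / real (Suc n)" x]
    unfolding p_def pn_def by simp
  \<comment> \<open>On \<open>K\<close> the unperturbed objective stays below its maximum by a fixed gap, so perturbed
    maximizers leave \<open>K\<close> as soon as the perturbation is smaller than that gap.\<close>
  define K where "K = {q \<in> Q. \<xi> q \<le> \<xi> g - e}"
  have "compact K"
  proof -
    have "closed K"
      unfolding K_def using continuous_on_closed_Collect_le[OF \<xi> continuous_on_const compact_imp_closed[OF Q]] .
    from compact_Int_closed[OF Q this] show ?thesis by (simp add: K_def Int_absorb1 subset_iff)
  qed
  obtain M where M: "M < p" "\<And>q. q \<in> K \<Longrightarrow> x \<bullet> q - \<psi> q \<le> M"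
  proof (cases "K = {}")
    case True then show ?thesis using that[of "p - 1"] by auto
  next
    case False
    have "continuous_on K (\<lambda>q. x \<bullet> q - \<psi> q)"
      by (intro continuous_intros continuous_on_subset[OF \<psi>]) (auto simp: K_def)
    from continuous_attains_sup[OF \<open>compact K\<close> False this]
    obtain k where k: "k \<in> K" "\<And>q. q \<in> K \<Longrightarrow> x \<bullet> q - \<psi> q \<le> x \<bullet> k - \<psi> k" by blast
    have "k \<noteq> g" using k(1) \<open>e > 0\<close> by (auto simp: K_def)
    then have "x \<bullet> k - \<psi> k \<noteq> p" using uniq[of k] k(1) by (auto simp: K_def p_def)
    then have "x \<bullet> k - \<psi> k < p" using legendre_ge[OF Q \<psi>, of k x] k(1) by (auto simp: K_def p_def)
    then show ?thesis using that k(2) by blast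
  qed
  have low: "(p - pn n) * real (Suc n) \<ge> \<xi> g - e" if n: "2 * B < (p - M) * real (Suc n)" for n
  proof -
    obtain q where q: "q \<in> Q" "pn n = x \<bullet> q - (\<psi> q + 1 / real (Suc n) * \<xi> q)"
      unfolding pn_def by (rule legendre_attained[OF Q cn assms(4)])
    have "q \<notin> K"
    proof
      assume "q \<in> K"
      then have "pn n \<le> M - 1 / real (Suc n) * \<xi> q" using M(2)[of q] q(2) by simp
      also have "\<dots> \<le> M + 1 / real (Suc n) * B"
      proof -
        have "- \<xi> q \<le> B" using B[OF q(1)] by linarith
        then have "1 / real (Suc n) * (- \<xi> q) \<le> 1 / real (Suc n) * B" by (intro mult_left_mono) auto
        then show ?thesis by simp
      qed
      finally show False using pnlow[of n] n by (simp add: field_simps)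
    qed
    then have "\<xi> g - e \<le> \<xi> q" using q(1) by (simp add: K_def)
    also have "pn n \<le> p - 1 / real (Suc n) * \<xi> q"
      using legendre_ge[OF Q \<psi> q(1), of x] q(2) by (simp add: p_def)
    then have "\<xi> q \<le> (p - pn n) * real (Suc n)" by (simp add: field_simps)
    finally show ?thesis .
  qed
  obtain N :: nat where N: "2 * B / (p - M) < N" using reals_Archimedean2 by blast
  have low': "(p - pn n) * real (Suc n) \<ge> \<xi> g - e" if "n \<ge> N" for n
  proof (rule low)
    have "2 * B / (p - M) < real (Suc n)" using N that by linarith
    then show "2 * B < (p - M) * real (Suc n)" using M(1) by (simp add: field_simps)
  qed
  show "\<exists>no. \<forall>n\<ge>no. norm ((legendre Q \<psi> x - legendre Q (\<lambda>q. \<psi> q + 1 / real (Suc n) * \<xi> q) x) * real (Suc n) - \<xi> g) < e'"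
  proof (intro exI[of _ N] allI impI)
    fix n assume "n \<ge> N"
    from low'[OF this] up[of n] have "norm ((p - pn n) * real (Suc n) - \<xi> g) < e'"
      using \<open>e < e'\<close> \<open>e > 0\<close> unfolding real_norm_def by linarith
    then show "norm ((legendre Q \<psi> x - legendre Q (\<lambda>q. \<psi> q + 1 / real (Suc n) * \<xi> q) x) * real (Suc n) - \<xi> g) < e'"
      unfolding p_def pn_def .
  qed
qed

lemma legendre_line_convex:
  assumes Q: "compact Q" "continuous_on Q \<psi>" "Q \<noteq> {}" and t: "0 \<le> t" "t \<le> 1"
  shows "legendre Q \<psi> ((1 - t) *\<^sub>R x + t *\<^sub>R y) \<le> (1 - t) * legendre Q \<psi> x + t * legendre Q \<psi> y"
proof (rule legendre_least[OF Q(3)])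
  fix q assume q: "q \<in> Q"
  have "((1 - t) *\<^sub>R x + t *\<^sub>R y) \<bullet> q - \<psi> q = (1 - t) * (x \<bullet> q - \<psi> q) + t * (y \<bullet> q - \<psi> q)"
    by (simp add: inner_add_left algebra_simps)
  also have "\<dots> \<le> (1 - t) * legendre Q \<psi> x + t * legendre Q \<psi> y"
    using t by (intro add_mono mult_left_mono legendre_ge[OF Q(1,2) q]) auto
  finally show "((1 - t) *\<^sub>R x + t *\<^sub>R y) \<bullet> q - \<psi> q \<le> (1 - t) * legendre Q \<psi> x + t * legendre Q \<psi> y" .
qed

definition rgrad :: "(real \<times> real \<Rightarrow> real) \<Rightarrow> real \<times> real \<Rightarrow> real \<times> real" where
  "rgrad F x = (dir_deriv (1, 0) F x, dir_deriv (0, 1) F x)"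

definition regular :: "(real \<times> real \<Rightarrow> real) \<Rightarrow> real \<times> real \<Rightarrow> bool" where
  "regular F x \<longleftrightarrow> dir_smooth (1, 0) F x \<and> dir_smooth (0, 1) F x"

lemma subgrad_eq_rgrad:
  assumes "\<And>x. subgrads F x \<noteq> {}" "regular F x" "g \<in> subgrads F x"
  shows "g = rgrad F x"
  using dir_smooth_subgrad[OF assms(1) _ assms(3)] assms(2)
  by (cases g) (auto simp: rgrad_def regular_def inner_prod_def)

lemma measurable_dir_deriv [measurable]:
  fixes F :: "'a::euclidean_space \<Rightarrow> real"
  assumes [measurable]: "F \<in> borel_measurable borel"
  shows "dir_deriv e F \<in> borel_measurable borel"
  unfolding dir_deriv_def by measurable

lemma measurable_rgrad [measurable]:
  assumes [measurable]: "F \<in> borel_measurable borel"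
  shows "rgrad F \<in> borel \<rightarrow>\<^sub>M borel"
proof -
  have "(\<lambda>x. (dir_deriv (1, 0) F x, dir_deriv (0, 1) F x)) \<in> borel \<rightarrow>\<^sub>M borel \<Otimes>\<^sub>M borel" by measurable
  then show ?thesis by (simp add: rgrad_def[abs_def] borel_prod)
qed

lemma measurable_dir_smooth [measurable]:
  fixes F :: "'a::euclidean_space \<Rightarrow> real"
  assumes [measurable]: "F \<in> borel_measurable borel"
  shows "Measurable.pred borel (dir_smooth e F)"
  unfolding dir_smooth_def by measurable

text \<open>The bad set is Borel and has countable sections in each of the two coordinate directions, so
  Fubini applies; injectivity of \<open>\<phi>\<close> carries countability from the slope variable to the
  height variable.\<close>

lemma AE_regular:
  fixes \<phi> :: "real \<Rightarrow> real"
  assumes F: "continuous_on UNIV F" and sub: "\<And>x. subgrads F x \<noteq> {}"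
    and \<phi>[measurable]: "\<phi> \<in> borel_measurable borel" and A[measurable]: "A \<in> sets borel" and inj: "inj_on \<phi> A"
  shows "AE x in lborel. snd x \<in> A \<longrightarrow> regular F (fst x, \<phi> (snd x))"
proof -
  have Fm[measurable]: "F \<in> borel_measurable borel" using F by (rule borel_measurable_continuous_onI)
  have m[measurable]: "(\<lambda>x::real \<times> real. (fst x, \<phi> (snd x))) \<in> borel \<rightarrow>\<^sub>M borel"
  proof -
    have "(\<lambda>x::real \<times> real. (fst x, \<phi> (snd x))) \<in> borel \<Otimes>\<^sub>M borel \<rightarrow>\<^sub>M borel \<Otimes>\<^sub>M borel" by measurable
    then show ?thesis by (simp add: borel_prod)
  qed
  have pm: "Measurable.pred borel (\<lambda>x. snd x \<in> A \<longrightarrow> dir_smooth e F (fst x, \<phi> (snd x)))" for e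
  proof -
    have "(\<lambda>x::real \<times> real. snd x) \<in> borel \<rightarrow>\<^sub>M borel"
      by (intro borel_measurable_continuous_onI continuous_intros)
    then have "Measurable.pred borel (\<lambda>x::real \<times> real. snd x \<in> A)" by measurable
    moreover have "Measurable.pred borel (\<lambda>x. dir_smooth e F (fst x, \<phi> (snd x)))"
      using measurable_compose[OF m measurable_dir_smooth[OF Fm, of e]] by simp
    ultimately show ?thesis by measurable
  qed
  have sm: "{x \<in> space (lborel \<Otimes>\<^sub>M lborel). snd x \<in> A \<longrightarrow> dir_smooth e F (fst x, \<phi> (snd x))}
      \<in> sets (lborel \<Otimes>\<^sub>M lborel)" for e
    unfolding lborel_prod using pm by (simp add: pred_def)
  have c1: "countable {s. \<not> dir_smooth (1, 0) F (s, y)}" for y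
    using countable_not_dir_smooth[OF sub, of "(1, 0)" "(0, y)"] by simp
  have c2: "countable {y. \<not> dir_smooth (0, 1) F (s, y)}" for s
    using countable_not_dir_smooth[OF sub, of "(0, 1)" "(s, 0)"] by simp
  have 1: "AE x in lborel. snd x \<in> A \<longrightarrow> dir_smooth (1, 0) F (fst x, \<phi> (snd x))"
  proof -
    have "AE z in lborel. AE s in lborel. z \<in> A \<longrightarrow> dir_smooth (1, 0) F (s, \<phi> z)"
      by (rule AE_I2, rule AE_I'[OF countable_imp_null_set_lborel[OF c1]]) auto
    then have "AE s in lborel. AE z in lborel. z \<in> A \<longrightarrow> dir_smooth (1, 0) F (s, \<phi> z)"
      using lborel_pair.AE_commute[of "\<lambda>s z. z \<in> A \<longrightarrow> dir_smooth (1, 0) F (s, \<phi> z)", OF sm] by blast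
    then have "AE x in lborel \<Otimes>\<^sub>M lborel. case x of (s, z) \<Rightarrow> z \<in> A \<longrightarrow> dir_smooth (1, 0) F (s, \<phi> z)"
      by (intro lborel_pair.AE_pair_measure) (use sm in \<open>simp_all add: case_prod_beta'\<close>)
    then show ?thesis unfolding lborel_prod by (simp add: case_prod_beta')
  qed
  have 2: "AE x in lborel. snd x \<in> A \<longrightarrow> dir_smooth (0, 1) F (fst x, \<phi> (snd x))"
  proof -
    have c3: "countable {z \<in> A. \<not> dir_smooth (0, 1) F (s, \<phi> z)}" for s
    proof (rule countable_image_inj_on[OF _ inj_on_subset[OF inj]])
      show "countable (\<phi> ` {z \<in> A. \<not> dir_smooth (0, 1) F (s, \<phi> z)})"
        by (rule countable_subset[OF _ c2[of s]]) auto
    qed auto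
    have "AE s in lborel. AE z in lborel. z \<in> A \<longrightarrow> dir_smooth (0, 1) F (s, \<phi> z)"
      by (rule AE_I2, rule AE_I'[OF countable_imp_null_set_lborel[OF c3]]) auto
    then have "AE x in lborel \<Otimes>\<^sub>M lborel. case x of (s, z) \<Rightarrow> z \<in> A \<longrightarrow> dir_smooth (0, 1) F (s, \<phi> z)"
      by (intro lborel_pair.AE_pair_measure) (use sm in \<open>simp_all add: case_prod_beta'\<close>)
    then show ?thesis unfolding lborel_prod by (simp add: case_prod_beta')
  qed
  from 1 2 show ?thesis by eventually_elim (auto simp: regular_def)
qed

section \<open>Filling a single column\<close>

abbreviation pot :: "(real \<times> real \<Rightarrow> real) \<Rightarrow> bool" where "pot p \<equiv> continuous_on UNIV p"

locale params =
  fixes r\<^sub>0 H \<Omega> :: real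
  assumes r0_pos: "r\<^sub>0 > 0" and H_pos: "H > 0" and Om_pos: "\<Omega> > 0"
begin

definition smax :: real where "smax = 1 / (2 * r\<^sub>0\<^sup>2)"

definition weight :: "real \<Rightarrow> real" where "weight s = (2 * f0 r\<^sub>0 \<Omega> s / \<Omega>\<^sup>2)\<^sup>2"

definition mass :: "real \<Rightarrow> real" where "mass r = integral {0..r} weight"

lemma smax_pos: "smax > 0" using r0_pos by (simp add: smax_def)

lemma gap_pos: "s < smax \<Longrightarrow> 1 - 2 * r\<^sub>0\<^sup>2 * s > 0"
  using r0_pos by (simp add: smax_def field_simps)

lemma f0_pos: "s < smax \<Longrightarrow> f0 r\<^sub>0 \<Omega> s > 0"
  unfolding f0_def using r0_pos Om_pos by (intro divide_pos_pos mult_pos_pos gap_pos) auto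

lemma weight_pos: "s < smax \<Longrightarrow> weight s > 0"
  using f0_pos[of s] Om_pos by (simp add: weight_def)

lemma weight_nonneg: "weight s \<ge> 0" by (simp add: weight_def)

lemma weight_eq: "weight s = r\<^sub>0 ^ 4 / (1 - 2 * r\<^sub>0\<^sup>2 * s)\<^sup>2"
proof -
  have "2 * (r\<^sub>0\<^sup>2 * \<Omega>\<^sup>2 / (2 * d)) / \<Omega>\<^sup>2 = r\<^sub>0\<^sup>2 / d" for d
    using Om_pos by (cases "d = 0") (auto simp: field_simps)
  then show ?thesis unfolding weight_def f0_def by (simp add: power_divide del: right_diff_distrib_numeral)
qed

lemma f0_cont: "continuous_on {..<smax} (f0 r\<^sub>0 \<Omega>)"
proof -
  have "2 * (1 - 2 * r\<^sub>0\<^sup>2 * s) \<noteq> 0" if "s < smax" for s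
    using mult_pos_pos[OF _ gap_pos[OF that], of 2] by (metis less_irrefl zero_less_numeral)
  then show ?thesis unfolding f0_def[abs_def] by (intro continuous_intros) auto
qed

lemma weight_cont: "continuous_on {..<smax} weight"
  unfolding weight_def[abs_def] using Om_pos by (intro continuous_intros f0_cont) auto

lemma weight_cont_int: "r < smax \<Longrightarrow> continuous_on {a..r} weight"
  by (rule continuous_on_subset[OF weight_cont]) auto

lemma f0_borel [measurable]: "f0 r\<^sub>0 \<Omega> \<in> borel_measurable borel"
  unfolding f0_def[abs_def] by measurable

lemma weight_borel [measurable]: "weight \<in> borel_measurable borel"
  unfolding weight_def[abs_def] by measurable

lemma f0_mono: "s \<le> t \<Longrightarrow> t < smax \<Longrightarrow> f0 r\<^sub>0 \<Omega> s \<le> f0 r\<^sub>0 \<Omega> t"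
  unfolding f0_def using r0_pos Om_pos
  by (intro divide_left_mono mult_left_mono diff_left_mono mult_pos_pos gap_pos) auto

text \<open>No column whose potential stays below \<open>M\<close> is worth filling beyond such a height. This replaces the
  compactness that the half-open interval of heights lacks.\<close>

lemma f0_unbounded: "\<exists>t. 0 < t \<and> t < smax \<and> (\<forall>s. t \<le> s \<longrightarrow> s < smax \<longrightarrow> f0 r\<^sub>0 \<Omega> s > M)"
proof -
  \<comment> \<open>At the point \<open>t\<close> with \<open>1 - 2 * r\<^sub>0\<^sup>2 * t = 1 / c\<close> the value of \<open>f0\<close> is
    \<open>r\<^sub>0\<^sup>2 * \<Omega>\<^sup>2 * c / 2\<close>.\<close>
  define c where "c = 2 * (\<bar>M\<bar> + 1) / (r\<^sub>0\<^sup>2 * \<Omega>\<^sup>2) + 1"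
  have c: "c > 1" using r0_pos Om_pos by (simp add: c_def)
  define t where "t = smax * (1 - 1 / c)"
  have t: "0 < t" "t < smax" using c smax_pos by (auto simp: t_def field_simps)
  have "1 - 2 * r\<^sub>0\<^sup>2 * t = 1 / c" using r0_pos c by (simp add: t_def smax_def field_simps)
  then have "f0 r\<^sub>0 \<Omega> t = r\<^sub>0\<^sup>2 * \<Omega>\<^sup>2 * c / 2" by (simp add: f0_def)
  also have "\<dots> = (\<bar>M\<bar> + 1) + r\<^sub>0\<^sup>2 * \<Omega>\<^sup>2 / 2" using r0_pos Om_pos by (simp add: c_def field_simps)
  also have "\<dots> > M" using r0_pos Om_pos by (smt (verit) divide_nonneg_nonneg mult_nonneg_nonneg zero_le_power2)
  finally have "f0 r\<^sub>0 \<Omega> t > M" .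
  then show ?thesis using t f0_mono[of t] by (intro exI[of _ t]) force
qed

definition cutoff :: "real \<Rightarrow> real" where
  "cutoff M = (SOME t. 0 < t \<and> t < smax \<and> (\<forall>s. t \<le> s \<longrightarrow> s < smax \<longrightarrow> f0 r\<^sub>0 \<Omega> s > M))"

lemma cutoff: "0 < cutoff M" "cutoff M < smax" "cutoff M \<le> s \<Longrightarrow> s < smax \<Longrightarrow> f0 r\<^sub>0 \<Omega> s > M"
  using someI_ex[OF f0_unbounded[of M]] unfolding cutoff_def[symmetric] by blast+

lemma weight_integrable: "r < smax \<Longrightarrow> weight integrable_on {a..r}"
  by (intro integrable_continuous_real weight_cont_int)

lemma mass_nonneg: "r < smax \<Longrightarrow> mass r \<ge> 0"
  unfolding mass_def by (intro integral_nonneg weight_integrable) (auto simp: weight_nonneg)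

lemma mass_strict_mono:
  assumes "0 \<le> r" "r < r'" "r' < smax" shows "mass r < mass r'"
proof -
  have "mass r + integral {r..r'} weight = mass r'"
    unfolding mass_def using assms by (intro Henstock_Kurzweil_Integration.integral_combine weight_integrable) auto
  moreover have "integral {r..r'} (\<lambda>_. 0) < integral {r..r'} weight"
    using assms by (intro integral_less_real weight_cont_int continuous_intros) (auto simp: weight_pos)
  ultimately show ?thesis by simp
qed

lemma mass_mono: "0 \<le> r \<Longrightarrow> r \<le> r' \<Longrightarrow> r' < smax \<Longrightarrow> mass r \<le> mass r'"
  using mass_strict_mono[of r r'] by (cases "r = r'") auto

text \<open>The weight has an explicit primitive, which blows up at \<open>smax\<close>.\<close>

lemma mass_unbounded: "\<exists>r. 0 \<le> r \<and> r < smax \<and> mass r \<ge> m"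
proof -
  \<comment> \<open>Solves \<open>mass r = \<bar>m\<bar>\<close>, where \<open>1 - 2 * r\<^sub>0\<^sup>2 * r = 1 / (1 + c)\<close>.\<close>
  define c where "c = 2 * \<bar>m\<bar> / r\<^sub>0\<^sup>2"
  have c: "c \<ge> 0" by (simp add: c_def)
  define r where "r = smax * (c / (1 + c))"
  have "c / (1 + c) < 1" using c by (simp add: field_simps)
  then have "smax * (c / (1 + c)) < smax * 1" using smax_pos by (intro mult_strict_left_mono) auto
  then have r: "0 \<le> r" "r < smax" using c smax_pos by (auto simp: r_def)
  define G where "G s = r\<^sub>0\<^sup>2 / 2 * inverse (1 - 2 * r\<^sub>0\<^sup>2 * s)" for s
  have "(G has_real_derivative weight s) (at s within {0..r})" if "s \<in> {0..r}" for s
  proof -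
    define d where "d = 1 - 2 * r\<^sub>0\<^sup>2 * s"
    have "d \<noteq> 0" using gap_pos[of s] that r by (auto simp: d_def)
    have "((\<lambda>s. 1 - 2 * r\<^sub>0\<^sup>2 * s) has_real_derivative - (2 * r\<^sub>0\<^sup>2)) (at s within {0..r})"
      by (auto intro!: derivative_eq_intros)
    from DERIV_cmult[OF DERIV_inverse'[OF this], of "r\<^sub>0\<^sup>2 / 2"] \<open>d \<noteq> 0\<close>
    have "(G has_real_derivative r\<^sub>0\<^sup>2 / 2 * - (inverse d * - (2 * r\<^sub>0\<^sup>2) * inverse d)) (at s within {0..r})"
      unfolding G_def[abs_def] d_def by blast
    moreover have "r\<^sub>0\<^sup>2 / 2 * - (inverse d * - (2 * r\<^sub>0\<^sup>2) * inverse d) = r\<^sub>0 ^ 4 / d\<^sup>2"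
      using \<open>d \<noteq> 0\<close> by (simp add: divide_simps power2_eq_square power4_eq_xxxx)
    ultimately show ?thesis by (simp add: weight_eq d_def)
  qed
  then have "(weight has_integral G r - G 0) {0..r}"
    using r(1) by (intro fundamental_theorem_of_calculus) (auto simp: has_real_derivative_iff_has_vector_derivative)
  then have "mass r = G r - G 0" unfolding mass_def by (rule integral_unique)
  moreover have "1 - 2 * r\<^sub>0\<^sup>2 * r = inverse (1 + c)"
  proof -
    have "2 * r\<^sub>0\<^sup>2 * r = c / (1 + c)" using r0_pos by (simp add: r_def smax_def)
    moreover have "1 - c / (1 + c) = inverse (1 + c)" using c by (simp add: divide_simps)
    ultimately show ?thesis by simp
  qed
  ultimately have "mass r = r\<^sub>0\<^sup>2 * (1 + c) / 2 - r\<^sub>0\<^sup>2 / 2" by (simp add: G_def)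
  also have "\<dots> = \<bar>m\<bar>" using r0_pos by (simp add: c_def field_simps)
  finally show ?thesis using r by (intro exI[of _ r]) auto
qed

definition energy :: "(real \<times> real \<Rightarrow> real) \<Rightarrow> real \<Rightarrow> real \<Rightarrow> real" where
  "energy p y r = integral {0..r} (\<lambda>s. (f0 r\<^sub>0 \<Omega> s - p (s, y)) * weight s)"

text \<open>A set, because \<open>f0 - p\<close> is a difference of convex functions and may change sign several times.\<close>

definition minimizers :: "(real \<times> real \<Rightarrow> real) \<Rightarrow> real \<Rightarrow> real set" where
  "minimizers p y = {r \<in> {0..<smax}. \<forall>r'\<in>{0..<smax}. energy p y r \<le> energy p y r'}"

definition lowest :: "(real \<times> real \<Rightarrow> real) \<Rightarrow> real \<Rightarrow> real" where "lowest p y = Inf (minimizers p y)"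

definition highest :: "(real \<times> real \<Rightarrow> real) \<Rightarrow> real \<Rightarrow> real" where "highest p y = Sup (minimizers p y)"

definition min_energy :: "(real \<times> real \<Rightarrow> real) \<Rightarrow> real \<Rightarrow> real" where "min_energy p y = energy p y (lowest p y)"

lemma section_cont:
  fixes p :: "real \<times> real \<Rightarrow> real"
  assumes "pot p"
  shows "continuous_on A (\<lambda>s. p (s, y))"
  by (rule continuous_on_compose2[OF assms]) (auto intro!: continuous_intros)

lemma energy_cont_integrand:
  assumes "pot p" "B \<subseteq> {..<smax}"
  shows "continuous_on B (\<lambda>s. (f0 r\<^sub>0 \<Omega> s - p (s, y)) * weight s)"
  by (intro continuous_intros section_cont[OF assms(1)] continuous_on_subset[OF f0_cont assms(2)]
      continuous_on_subset[OF weight_cont assms(2)])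

lemma energy_integrable:
  assumes "pot p" "r < smax"
  shows "(\<lambda>s. (f0 r\<^sub>0 \<Omega> s - p (s, y)) * weight s) integrable_on {a..r}"
  using assms by (intro integrable_continuous_real energy_cont_integrand) auto

lemma energy_0 [simp]: "energy p y 0 = 0" by (simp add: energy_def)

lemma energy_split:
  assumes "pot p" "0 \<le> r'" "r' \<le> r" "r < smax"
  shows "energy p y r = energy p y r' + integral {r'..r} (\<lambda>s. (f0 r\<^sub>0 \<Omega> s - p (s, y)) * weight s)"
  unfolding energy_def using assms
  by (subst Henstock_Kurzweil_Integration.integral_combine) (auto intro!: energy_integrable)

lemma pdiff_integrable:
  assumes "pot p" "pot p'" "r < smax"
  shows "(\<lambda>s. (p' (s, y') - p (s, y)) * weight s) integrable_on {a..r}"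
  using assms by (intro integrable_continuous_real continuous_intros section_cont weight_cont_int) auto

lemma energy_diff:
  assumes "pot p" "pot p'" "r < smax"
  shows "energy p y r - energy p' y' r = integral {0..r} (\<lambda>s. (p' (s, y') - p (s, y)) * weight s)"
  unfolding energy_def
  unfolding integral_diff[OF energy_integrable[OF assms(1,3)] energy_integrable[OF assms(2,3)], symmetric]
  by (intro integral_cong) (simp add: algebra_simps)

lemma energy_perturb:
  assumes "pot p" "pot p'" "r < smax"
    and e: "\<And>s. s \<in> {0..r} \<Longrightarrow> \<bar>p' (s, y') - p (s, y)\<bar> \<le> e"
  shows "\<bar>energy p y r - energy p' y' r\<bar> \<le> e * mass r"
proof -
  have "norm (integral {0..r} (\<lambda>s. (p' (s, y') - p (s, y)) * weight s)) \<le> integral {0..r} (\<lambda>s. e * weight s)"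
    using assms by (intro integral_norm_bound_integral pdiff_integrable integrable_on_mult_right weight_integrable)
      (auto simp: abs_mult weight_nonneg intro!: mult_right_mono)
  then show ?thesis using energy_diff[OF assms(1-3), of y y'] by (simp add: mass_def)
qed

lemma energy_deriv:
  assumes "pot p" "0 < r" "r < smax"
  shows "(energy p y has_real_derivative (f0 r\<^sub>0 \<Omega> r - p (r, y)) * weight r) (at r)"
proof -
  obtain b where b: "r < b" "b < smax" using assms(3) dense by blast
  have "((\<lambda>x. integral {0..x} (\<lambda>s. (f0 r\<^sub>0 \<Omega> s - p (s, y)) * weight s)) has_real_derivative
      (f0 r\<^sub>0 \<Omega> r - p (r, y)) * weight r) (at r within {0..b})"
    using b assms(2) by (intro integral_has_real_derivative energy_cont_integrand[OF assms(1)]) auto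
  then show ?thesis using b assms(2) unfolding energy_def[abs_def] by (simp add: at_within_Icc_at)
qed

lemma energy_cont:
  assumes "pot p"
  shows "continuous_on {0..<smax} (energy p y)"
  unfolding continuous_on_eq_continuous_within
proof
  fix x assume x: "x \<in> {0..<smax}"
  then obtain b where b: "x < b" "b < smax" using dense[of x smax] by auto
  have "continuous_on {0..b} (energy p y)"
    unfolding energy_def[abs_def] using b by (intro indefinite_integral_continuous_1 energy_integrable assms)
  then have "continuous (at x within {0..b}) (energy p y)"
    using x b by (auto simp: continuous_on_eq_continuous_within)
  moreover have "at x within {0..b} = at x within {0..<smax}"
    by (rule at_within_nhd[of _ "{..<b}"]) (use x b in auto)
  ultimately show "continuous (at x within {0..<smax}) (energy p y)" by simp
qed

text \<open>The weight is positive, so stationarity of the energy is the relation on the free boundary.\<close>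

lemma minimizers_foc:
  assumes "pot p" "r \<in> minimizers p y" "r > 0"
  shows "f0 r\<^sub>0 \<Omega> r = p (r, y)"
proof -
  have r: "r < smax" using assms(2) by (simp add: minimizers_def)
  define d where "d = min r (smax - r)"
  have "(f0 r\<^sub>0 \<Omega> r - p (r, y)) * weight r = 0"
  proof (rule DERIV_local_min[OF energy_deriv[OF assms(1) assms(3) r]])
    show "d > 0" using r assms(3) by (simp add: d_def)
    show "\<forall>t. \<bar>r - t\<bar> < d \<longrightarrow> energy p y r \<le> energy p y t"
    proof (intro allI impI)
      fix t assume "\<bar>r - t\<bar> < d"
      then have "t \<in> {0..<smax}" by (auto simp: d_def)
      then show "energy p y r \<le> energy p y t" using assms(2) unfolding minimizers_def by blast
    qed
  qed
  then show ?thesis using weight_pos[OF r] by simp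
qed

lemma minimizers_bound:
  assumes "pot p" "\<And>s. 0 \<le> s \<Longrightarrow> s < smax \<Longrightarrow> p (s, y) \<le> M"
  shows "minimizers p y \<subseteq> {0..cutoff M}"
proof
  fix r assume r: "r \<in> minimizers p y"
  then have r': "0 \<le> r" "r < smax" by (auto simp: minimizers_def)
  show "r \<in> {0..cutoff M}"
  proof (rule ccontr)
    assume "\<not> r \<in> {0..cutoff M}"
    then have "r > cutoff M" using r' by auto
    then have "f0 r\<^sub>0 \<Omega> r > M" "r > 0" using cutoff(1,3)[of M] r' by force+
    then show False using minimizers_foc[OF assms(1) r] assms(2)[OF r'] by simp
  qed
qed

lemma minimizers_nonempty_bound:
  assumes "pot p" "\<And>s. 0 \<le> s \<Longrightarrow> s < smax \<Longrightarrow> p (s, y) \<le> M"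
  shows "minimizers p y \<noteq> {}"
proof -
  have "continuous_on {0..cutoff M} (energy p y)"
    using cutoff(2)[of M] by (intro continuous_on_subset[OF energy_cont[OF assms(1)]]) auto
  from continuous_attains_inf[OF compact_Icc _ this]
  obtain r where r: "r \<in> {0..cutoff M}" "\<And>t. t \<in> {0..cutoff M} \<Longrightarrow> energy p y r \<le> energy p y t"
    using cutoff(1)[of M] by force
  have "energy p y r \<le> energy p y t" if t: "0 \<le> t" "t < smax" for t
  proof (cases "t \<le> cutoff M")
    case True then show ?thesis using r(2) t by auto
  next
    case False
    have "0 \<le> integral {cutoff M..t} (\<lambda>s. (f0 r\<^sub>0 \<Omega> s - p (s, y)) * weight s)"
    proof (rule integral_nonneg[OF energy_integrable[OF assms(1) t(2)]])
      fix s assume s: "s \<in> {cutoff M..t}"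
      then have "p (s, y) \<le> f0 r\<^sub>0 \<Omega> s" using cutoff(1)[of M] cutoff(3)[of M s] assms(2)[of s] t by force
      then show "0 \<le> (f0 r\<^sub>0 \<Omega> s - p (s, y)) * weight s" by (simp add: weight_nonneg)
    qed
    then have "energy p y (cutoff M) \<le> energy p y t"
      using energy_split[OF assms(1), of "cutoff M" t y] False t cutoff(1)[of M] by simp
    then show ?thesis using r(2)[of "cutoff M"] cutoff(1)[of M] by auto
  qed
  then have "r \<in> minimizers p y" using r(1) cutoff(2)[of M] by (auto simp: minimizers_def)
  then show ?thesis by blast
qed

lemma section_bound:
  assumes "pot p"
  obtains M where "\<And>s. 0 \<le> s \<Longrightarrow> s < smax \<Longrightarrow> p (s, y) \<le> (M::real)"
proof -
  have "bounded ((\<lambda>s. p (s, y)) ` {0..smax})"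
    by (intro compact_imp_bounded compact_continuous_image section_cont[OF assms]) auto
  then obtain M where "\<forall>s\<in>{0..smax}. norm (p (s, y)) \<le> M" by (auto simp: bounded_iff)
  then show thesis using that[of M] by force
qed

lemma minimizers_nonempty:
  assumes "pot p" shows "minimizers p y \<noteq> {}"
proof -
  obtain M where "\<And>s. 0 \<le> s \<Longrightarrow> s < smax \<Longrightarrow> p (s, y) \<le> M" by (rule section_bound[OF assms, of y]) blast
  then show ?thesis by (rule minimizers_nonempty_bound[OF assms])
qed

text \<open>Minimizers are stable under simultaneous uniform convergence of the potentials along the column
  and convergence of the slopes.\<close>

lemma minimizers_limit:
  assumes p: "pot p" and pn: "\<And>n. pot (pn n)"
    and r: "\<And>n. r n \<in> minimizers (pn n) (yn n)" and lim: "r \<longlonglongrightarrow> r'" and r': "r' < smax"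
    and e: "\<And>n s. 0 \<le> s \<Longrightarrow> s < smax \<Longrightarrow> \<bar>pn n (s, yn n) - p (s, y)\<bar> \<le> e n" and e0: "e \<longlonglongrightarrow> 0"
  shows "r' \<in> minimizers p y"
proof -
  have r0: "0 \<le> r n" "r n < smax" for n using r[of n] by (auto simp: minimizers_def)
  have r'0: "0 \<le> r'" using LIMSEQ_le_const[OF lim] r0 by blast
  have ep: "\<bar>energy p y t - energy (pn n) (yn n) t\<bar> \<le> e n * mass t" if "t < smax" for t n
    using that e by (intro energy_perturb p pn) auto
  have conv: "(\<lambda>n. energy (pn n) (yn n) t) \<longlonglongrightarrow> energy p y t" if "t < smax" for t
    by (rule LIM_zero_cancel, rule Lim_null_comparison[OF always_eventually tendsto_mult_left_zero[OF e0, of "mass t"]])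
       (use ep[OF that] in \<open>auto simp: abs_minus_commute\<close>)
  have E: "(\<lambda>n. energy p y (r n)) \<longlonglongrightarrow> energy p y r'"
    by (rule continuous_on_tendsto_compose[OF energy_cont[OF p] lim]) (use r0 r'0 r' in auto)
  obtain b where b: "r' < b" "b < smax" using r' dense by blast
  have ev: "\<forall>\<^sub>F n in sequentially. r n < b" using order_tendstoD(2)[OF lim b(1)] .
  have e_nn: "e n \<ge> 0" for n using e[of 0 n] smax_pos by force
  have "\<forall>\<^sub>F n in sequentially. norm (energy (pn n) (yn n) (r n) - energy p y (r n)) \<le> e n * mass b"
    using ev
  proof eventually_elim
    case (elim n)
    have "\<bar>energy p y (r n) - energy (pn n) (yn n) (r n)\<bar> \<le> e n * mass (r n)" using ep[OF r0(2)] .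
    also have "\<dots> \<le> e n * mass b" using elim r0(1) b(2) e_nn by (intro mult_left_mono mass_mono) auto
    finally show ?case by (simp add: abs_minus_commute)
  qed
  then have "(\<lambda>n. energy (pn n) (yn n) (r n) - energy p y (r n)) \<longlonglongrightarrow> 0"
    by (rule Lim_null_comparison[OF _ tendsto_mult_left_zero[OF e0]])
  from tendsto_add[OF this E] have E': "(\<lambda>n. energy (pn n) (yn n) (r n)) \<longlonglongrightarrow> energy p y r'" by simp
  have "energy p y r' \<le> energy p y t" if "0 \<le> t" "t < smax" for t
    by (rule LIMSEQ_le[OF E' conv[OF that(2)]]) (use r that in \<open>auto simp: minimizers_def\<close>)
  then show ?thesis using r'0 r' by (auto simp: minimizers_def)
qed

lemma minimizers_compact:
  assumes p: "pot p" shows "compact (minimizers p y)"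
proof -
  obtain M where M: "\<And>s. 0 \<le> s \<Longrightarrow> s < smax \<Longrightarrow> p (s, y) \<le> M" by (rule section_bound[OF p, of y]) blast
  have b: "minimizers p y \<subseteq> {0..cutoff M}" by (rule minimizers_bound[OF p M])
  have "closed (minimizers p y)"
    unfolding closed_sequential_limits
  proof (intro allI impI, elim conjE)
    fix r l assume r: "\<forall>n. r n \<in> minimizers p y" "r \<longlonglongrightarrow> l"
    have "r n \<le> cutoff M" for n using b r(1) by (meson atLeastAtMost_iff subsetD)
    then have "l \<le> cutoff M" by (intro LIMSEQ_le_const2[OF r(2)]) blast
    then show "l \<in> minimizers p y"
      using r(1) cutoff(2)[of M]
      by (intro minimizers_limit[where p=p and pn="\<lambda>_. p" and r=r and r'=l and y=y and yn="\<lambda>_. y" and e="\<lambda>_. 0", OF p p _ r(2)])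
        simp_all
  qed
  then show ?thesis using b by (meson bounded_closed_interval bounded_subset compact_eq_bounded_closed)
qed

lemma lowest_highest:
  assumes p: "pot p"
  shows "lowest p y \<in> minimizers p y" "highest p y \<in> minimizers p y"
    "r \<in> minimizers p y \<Longrightarrow> lowest p y \<le> r" "r \<in> minimizers p y \<Longrightarrow> r \<le> highest p y"
proof -
  note c = minimizers_compact[OF p, of y] and ne = minimizers_nonempty[OF p, of y]
  have bd: "bdd_below (minimizers p y)" "bdd_above (minimizers p y)"
    using compact_imp_bounded[OF c] bounded_imp_bdd_below bounded_imp_bdd_above by auto
  show "lowest p y \<in> minimizers p y" unfolding lowest_def
    by (rule closed_contains_Inf[OF ne bd(1) compact_imp_closed[OF c]])
  show "highest p y \<in> minimizers p y" unfolding highest_def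
    by (rule closed_contains_Sup[OF ne bd(2) compact_imp_closed[OF c]])
  show "r \<in> minimizers p y \<Longrightarrow> lowest p y \<le> r" unfolding lowest_def by (rule cInf_lower[OF _ bd(1)])
  show "r \<in> minimizers p y \<Longrightarrow> r \<le> highest p y" unfolding highest_def by (rule cSup_upper[OF _ bd(2)])
qed

lemma min_energy_eq: "pot p \<Longrightarrow> r \<in> minimizers p y \<Longrightarrow> min_energy p y = energy p y r"
  using lowest_highest(1)[of p y] unfolding min_energy_def minimizers_def by force

lemma min_energy_le: "pot p \<Longrightarrow> 0 \<le> r \<Longrightarrow> r < smax \<Longrightarrow> min_energy p y \<le> energy p y r"
  using lowest_highest(1)[of p y] unfolding min_energy_def minimizers_def by force

lemma minimizersI: "pot p \<Longrightarrow> 0 \<le> r \<Longrightarrow> r < smax \<Longrightarrow> energy p y r \<le> min_energy p y \<Longrightarrow> r \<in> minimizers p y"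
  using min_energy_le[of p _ y] unfolding minimizers_def by force

end

section \<open>Columns of different slope\<close>

text \<open>What the argument needs from convexity in the slope variable: monotonicity, and that constancy on
  some interval extends to all smaller slopes.\<close>

definition column_convex :: "(real \<times> real \<Rightarrow> real) \<Rightarrow> bool" where
  "column_convex p \<longleftrightarrow> pot p \<and> (\<forall>s y y'. y \<le> y' \<longrightarrow> p (s, y) \<le> p (s, y')) \<and>
     (\<forall>s u y y'. u \<le> y \<longrightarrow> y < y' \<longrightarrow> p (s, y) = p (s, y') \<longrightarrow> p (s, u) = p (s, y))"

lemma column_convexD:
  assumes "column_convex p"
  shows "pot p" "y \<le> y' \<Longrightarrow> p (s, y) \<le> p (s, y')"
    "u \<le> y \<Longrightarrow> y < y' \<Longrightarrow> p (s, y) = p (s, y') \<Longrightarrow> p (s, u) = p (s, y)"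
  using assms unfolding column_convex_def by blast+

lemma legendre_column_convex:
  assumes Q: "compact Q" "continuous_on Q \<psi>" "Q \<noteq> {}" and nn: "\<And>q. q \<in> Q \<Longrightarrow> 0 \<le> snd q"
  shows "column_convex (legendre Q \<psi>)"
proof -
  have mono: "legendre Q \<psi> (s, y) \<le> legendre Q \<psi> (s, y')" if "y \<le> y'" for s y y'
    using that nn by (intro legendre_mono_arg Q) (auto simp: inner_prod_def mult_right_mono)
  have "legendre Q \<psi> (s, u) = legendre Q \<psi> (s, y)"
    if "u \<le> y" "y < y'" "legendre Q \<psi> (s, y) = legendre Q \<psi> (s, y')" for s u y y'
  proof -
    define t where "t = (y - u) / (y' - u)"
    have t: "0 \<le> t" "t < 1" using that by (auto simp: t_def field_simps)
    have "t * (y' - u) = y - u" using that by (simp add: t_def)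
    then have "(1 - t) *\<^sub>R (s, u) + t *\<^sub>R (s, y') = (s, y)" by (simp add: algebra_simps)
    then have "legendre Q \<psi> (s, y) \<le> (1 - t) * legendre Q \<psi> (s, u) + t * legendre Q \<psi> (s, y')"
      using legendre_line_convex[OF Q, of t "(s, u)" "(s, y')"] t by simp
    then have "(1 - t) * legendre Q \<psi> (s, y) \<le> (1 - t) * legendre Q \<psi> (s, u)"
      using that(3) by (simp add: algebra_simps)
    then have "legendre Q \<psi> (s, y) \<le> legendre Q \<psi> (s, u)" using t by simp
    with mono[OF that(1), of s] show ?thesis by simp
  qed
  with mono legendre_continuous[OF Q] show ?thesis unfolding column_convex_def by blast
qed

context params
begin

text \<open>Exchange argument: if the smaller slope uses the larger height, swapping the two heights changes
  the total energy by minus the integral of the nonnegative function \<open>p (s, y') - p (s, y)\<close> over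
  the overlap, so that integral vanishes and both heights are optimal for both slopes.\<close>

lemma minimizers_overlap:
  assumes p: "column_convex p" and "y < y'" and r: "r \<in> minimizers p y" and r': "r' \<in> minimizers p y'" and "r' < r"
  shows "s \<in> {r'..r} \<Longrightarrow> p (s, y) = p (s, y')" "r \<in> minimizers p y'" "r' \<in> minimizers p y"
proof -
  note pc = column_convexD(1)[OF p]
  have b: "0 \<le> r'" "r < smax" "0 \<le> r" "r' < smax" using r r' by (auto simp: minimizers_def)
  define D where "D = (\<lambda>s. (p (s, y') - p (s, y)) * weight s)"
  have Dc: "continuous_on {r'..r} D"
    unfolding D_def using b by (intro continuous_intros section_cont[OF pc] weight_cont_int) auto
  have D0: "D s \<ge> 0" for s unfolding D_def using column_convexD(2)[OF p, of y y' s] \<open>y < y'\<close> weight_nonneg by simp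
  have i: "(\<lambda>s. (f0 r\<^sub>0 \<Omega> s - p (s, y)) * weight s) integrable_on {r'..r}" for y
    by (rule energy_integrable[OF pc b(2)])
  have "integral {r'..r} D = (energy p y r - energy p y r') - (energy p y' r - energy p y' r')"
    unfolding energy_split[OF pc b(1) less_imp_le[OF \<open>r' < r\<close>] b(2)] add_diff_cancel_left'
      integral_diff[OF i i, symmetric] D_def by (intro integral_cong) (simp add: algebra_simps)
  moreover have "energy p y r \<le> energy p y r'" "energy p y' r' \<le> energy p y' r"
    using r r' b by (auto simp: minimizers_def)
  moreover have "integral {r'..r} D \<ge> 0"
    using D0 by (intro integral_nonneg integrable_continuous_real Dc)
  ultimately have z: "integral {r'..r} D = 0" and e: "energy p y r' \<le> energy p y r" "energy p y' r \<le> energy p y' r'"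
    by linarith+
  have "D s = 0" if "s \<in> {r'..r}" for s
    using integral_eq_0_iff[OF Dc \<open>r' < r\<close> D0] z that by auto
  then show "s \<in> {r'..r} \<Longrightarrow> p (s, y) = p (s, y')"
    using weight_pos[of s] b unfolding D_def by force
  show "r \<in> minimizers p y'" "r' \<in> minimizers p y" using r r' e b unfolding minimizers_def by force+
qed

lemma lowest_mono: "column_convex p \<Longrightarrow> y \<le> y' \<Longrightarrow> lowest p y \<le> lowest p y'"
  using minimizers_overlap(3)[of p y y' "lowest p y" "lowest p y'"] lowest_highest(1,3)[of p]
  by (metis column_convexD(1) linorder_not_le order_le_less)

lemma highest_mono: "column_convex p \<Longrightarrow> y \<le> y' \<Longrightarrow> highest p y \<le> highest p y'"
  using minimizers_overlap(2)[of p y y' "highest p y" "highest p y'"] lowest_highest(2,4)[of p]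
  by (metis column_convexD(1) linorder_not_le order_le_less)

text \<open>Slopes that are the only ones to have optimal heights on both sides of some rational level; each
  level accounts for at most one such slope.\<close>

definition ambiguous :: "(real \<times> real \<Rightarrow> real) \<Rightarrow> real set" where
  "ambiguous p = (\<Union>r\<in>\<rat>. {y. {y. lowest p y < r \<and> r < highest p y} = {y}})"

lemma countable_ambiguous: "countable (ambiguous p)"
  unfolding ambiguous_def
proof (intro countable_UN countable_rat)
  fix r :: real
  show "countable {y. {y. lowest p y < r \<and> r < highest p y} = {y}}"
    by (rule countable_subset[of _ "{THE y. {y. lowest p y < r \<and> r < highest p y} = {y}}"]) auto
qed

text \<open>At each rational level in the gap another slope is ambiguous as well, and the overlap of the two
  columns makes the potential constant; density of the rationals extends this to every level.\<close>

lemma gap_const: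
  assumes p: "column_convex p" and y: "y \<notin> ambiguous p" and s: "lowest p y < s" "s \<le> highest p y" and u: "u \<le> y"
  shows "p (s, u) = p (s, y)"
proof -
  note pc = column_convexD(1)[OF p]
  have rat: "p (r, u) = p (r, y)" if r: "r \<in> \<rat>" "lowest p y < r" "r < highest p y" for r
  proof -
    have "{y. lowest p y < r \<and> r < highest p y} \<noteq> {y}" using y r(1) unfolding ambiguous_def by blast
    then obtain y' where y': "y' \<noteq> y" "lowest p y' < r" "r < highest p y'" using r by auto
    show ?thesis
    proof (cases "y < y'")
      case True
      have "p (r, y) = p (r, y')"
        using minimizers_overlap(1)[OF p True, of "highest p y" "lowest p y'" r] lowest_highest[OF pc] y' r by auto
      from column_convexD(3)[OF p u True this] show ?thesis .
    next
      case False
      then have l: "y' < y" using y' by simp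
      have e: "p (r, y') = p (r, y)"
        using minimizers_overlap(1)[OF p l, of "highest p y'" "lowest p y" r] lowest_highest[OF pc] y' r by auto
      show ?thesis
      proof (cases "u \<le> y'")
        case True then show ?thesis using column_convexD(3)[OF p True l e] e by simp
      next
        case False
        then show ?thesis using column_convexD(2)[OF p, of y' u r] column_convexD(2)[OF p, of u y r] u e by simp
      qed
    qed
  qed
  show ?thesis
  proof (rule ccontr)
    assume "p (s, u) \<noteq> p (s, y)"
    define G where "G = {s. p (s, u) \<noteq> p (s, y)}"
    have "open G" unfolding G_def
      by (intro open_Collect_neq section_cont[OF pc])
    moreover have "s \<in> G" using \<open>p (s, u) \<noteq> p (s, y)\<close> by (simp add: G_def)
    ultimately obtain d where d: "d > 0" "\<And>x. \<bar>x - s\<bar> < d \<Longrightarrow> x \<in> G"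
      by (auto simp: open_dist dist_real_def)
    obtain r where "r \<in> \<rat>" "max (s - d) (lowest p y) < r" "r < s"
      using Rats_dense_in_real[of "max (s - d) (lowest p y)" s] d(1) s(1) by auto
    then have "r \<in> \<rat>" "lowest p y < r" "r < highest p y" "r \<in> G" using d(2)[of r] s(2) by auto
    then show False using rat[of r] by (auto simp: G_def)
  qed
qed

text \<open>An optimal height for one potential is a competitor for the other.\<close>

lemma min_energy_cmp:
  assumes "pot p" "pot p'" "r \<in> minimizers p' y'"
    and "\<And>s. s \<in> {0..r} \<Longrightarrow> \<bar>p' (s, y') - p (s, y)\<bar> \<le> e"
  shows "min_energy p y \<le> min_energy p' y' + e * mass r"
proof -
  have r: "0 \<le> r" "r < smax" using assms(3) by (auto simp: minimizers_def)
  have "min_energy p y \<le> energy p y r" by (rule min_energy_le[OF assms(1) r])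
  also have "\<dots> \<le> energy p' y' r + e * mass r" using energy_perturb[OF assms(1,2) r(2) assms(4)] by linarith
  finally show ?thesis using min_energy_eq[OF assms(2,3)] by simp
qed

lemma min_energy_nonpos: "pot p \<Longrightarrow> min_energy p y \<le> 0"
  using min_energy_le[of p 0 y] smax_pos by simp

lemma min_energy_cont:
  assumes p: "column_convex p" and L: "\<And>s y y'. \<bar>p (s, y) - p (s, y')\<bar> \<le> L * \<bar>y - y'\<bar>"
  shows "continuous_on {..Y} (min_energy p)"
proof -
  note pc = column_convexD(1)[OF p]
  obtain M where M: "\<And>s. 0 \<le> s \<Longrightarrow> s < smax \<Longrightarrow> p (s, Y) \<le> M" by (rule section_bound[OF pc, of Y]) blast
  have L0: "L \<ge> 0" using L[of 0 1 0] by (simp add: order_trans[OF abs_ge_zero])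
  have le: "min_energy p y \<le> min_energy p y' + L * mass (cutoff M) * \<bar>y - y'\<bar>" if "y \<le> Y" "y' \<le> Y" for y y'
  proof -
    have "minimizers p y' \<subseteq> {0..cutoff M}"
      using that M column_convexD(2)[OF p, of y' Y] by (intro minimizers_bound[OF pc]) (meson order_trans)
    with lowest_highest(1)[OF pc] have r: "lowest p y' \<in> {0..cutoff M}" by blast
    have "min_energy p y \<le> min_energy p y' + (L * \<bar>y - y'\<bar>) * mass (lowest p y')"
      using L[of _ y' y] by (intro min_energy_cmp[OF pc pc lowest_highest(1)[OF pc]]) (simp add: abs_minus_commute)
    also have "(L * \<bar>y - y'\<bar>) * mass (lowest p y') \<le> (L * \<bar>y - y'\<bar>) * mass (cutoff M)"
      using r L0 cutoff(2)[of M] by (intro mult_left_mono mass_mono) auto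
    finally show ?thesis by (simp add: algebra_simps)
  qed
  have "(L * mass (cutoff M))-lipschitz_on {..Y} (min_energy p)"
    unfolding lipschitz_on_def dist_real_def
  proof (intro conjI ballI)
    show "0 \<le> L * mass (cutoff M)" using L0 mass_nonneg cutoff(2) by simp
    fix y y' assume "y \<in> {..Y}" "y' \<in> {..Y}"
    then show "\<bar>min_energy p y - min_energy p y'\<bar> \<le> L * mass (cutoff M) * \<bar>y - y'\<bar>"
      using le[of y y'] le[of y' y] by (auto simp: abs_le_iff abs_minus_commute)
  qed
  then show ?thesis by (rule lipschitz_on_continuous_on)
qed

end

section \<open>The measures of the free boundary problem\<close>

lemma AE_snd_notin:
  assumes "countable (N :: real set)"
  shows "AE x in (lborel :: (real \<times> real) measure). snd x \<notin> N"
proof -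
  have N[measurable]: "N \<in> sets borel" using assms by (rule sets.countable[rotated]) auto
  have m: "{x \<in> space (lborel \<Otimes>\<^sub>M lborel). snd x \<notin> N} \<in> sets (lborel \<Otimes>\<^sub>M (lborel :: real measure))"
    by measurable
  have "AE s in lborel. AE z in lborel. snd (s::real, z) \<notin> N"
    by (rule AE_I2, rule AE_I'[OF countable_imp_null_set_lborel[OF assms]]) auto
  from lborel_pair.AE_pair_measure[OF m this] show ?thesis unfolding lborel_prod .
qed

lemma AE_fst_notin:
  assumes "countable (N :: real set)"
  shows "AE x in (lborel :: (real \<times> real) measure). fst x \<notin> N"
proof -
  have N[measurable]: "N \<in> sets borel" using assms by (rule sets.countable[rotated]) auto
  have m: "{x \<in> space (lborel \<Otimes>\<^sub>M lborel). fst x \<notin> N} \<in> sets ((lborel :: real measure) \<Otimes>\<^sub>M (lborel :: real measure))"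
    by measurable
  have "AE s in lborel. s \<notin> N" by (rule AE_I'[OF countable_imp_null_set_lborel[OF assms]]) auto
  then have "AE s in lborel. AE z in lborel. fst (s::real, z::real) \<notin> N"
    by (rule eventually_mono) auto
  from lborel_pair.AE_pair_measure[OF m this] show ?thesis unfolding lborel_prod .
qed

context params
begin

lemma D_set_measurable [measurable]:
  assumes [measurable]: "\<rho> \<in> borel_measurable borel"
  shows "D_set H \<rho> \<in> sets borel"
proof -
  have "{x \<in> space (borel \<Otimes>\<^sub>M borel). 0 \<le> fst x \<and> fst x \<le> \<rho> (snd x) \<and> 0 \<le> snd x \<and> snd x \<le> H}
     \<in> sets (borel \<Otimes>\<^sub>M (borel::real measure))" by measurable
  moreover have "D_set H \<rho> = {x \<in> space (borel \<Otimes>\<^sub>M borel). 0 \<le> fst x \<and> fst x \<le> \<rho> (snd x) \<and> 0 \<le> snd x \<and> snd x \<le> H}"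
    by (auto simp: D_set_def space_pair_measure)
  ultimately show ?thesis unfolding borel_prod by simp
qed

lemma weight_fst_measurable [measurable]: "(\<lambda>x::real \<times> real. weight (fst x)) \<in> borel_measurable borel"
  by (rule measurable_compose[OF _ weight_borel]) (intro borel_measurable_continuous_onI continuous_intros)

lemma mu_density:
  "mu r\<^sub>0 H \<Omega> \<rho> = density lborel (\<lambda>x. ennreal (weight (fst x) * indicator (D_set H \<rho>) x))"
  unfolding mu_def weight_def by (auto intro!: arg_cong[where f="density lborel"] simp: fun_eq_iff split: split_indicator)

lemma sets_mu [simp]: "sets (mu r\<^sub>0 H \<Omega> \<rho>) = sets borel" and space_mu [simp]: "space (mu r\<^sub>0 H \<Omega> \<rho>) = UNIV"
  by (simp_all add: mu_def)

lemma measurable_mu [simp]: "borel_measurable (mu r\<^sub>0 H \<Omega> \<rho>) = borel_measurable borel"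
   "(mu r\<^sub>0 H \<Omega> \<rho>) \<rightarrow>\<^sub>M (borel :: (real \<times> real) measure) = borel \<rightarrow>\<^sub>M borel"
  by (rule measurable_cong_sets[OF sets_mu refl])+

lemma AE_mu:
  assumes [measurable]: "\<rho> \<in> borel_measurable borel"
  shows "(AE x in mu r\<^sub>0 H \<Omega> \<rho>. P x) \<longleftrightarrow> (AE x in lborel. weight (fst x) > 0 \<longrightarrow> x \<in> D_set H \<rho> \<longrightarrow> P x)"
  unfolding mu_density
  by (subst AE_density) (auto intro!: AE_cong split: split_indicator simp: weight_nonneg less_le)

lemma AE_mu_lborel:
  assumes [measurable]: "\<rho> \<in> borel_measurable borel" and "AE x in lborel. x \<in> D_set H \<rho> \<longrightarrow> P x"
  shows "AE x in mu r\<^sub>0 H \<Omega> \<rho>. P x"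
  unfolding AE_mu[OF assms(1)] using assms(2) by eventually_elim auto

lemma nn_integral_mu:
  assumes [measurable]: "\<rho> \<in> borel_measurable borel" "F \<in> borel_measurable borel"
  shows "(\<integral>\<^sup>+x. F x \<partial>mu r\<^sub>0 H \<Omega> \<rho>) =
    (\<integral>\<^sup>+z\<in>{0..H}. (\<integral>\<^sup>+s\<in>{0..\<rho> z}. F (s, z) * ennreal (weight s) \<partial>lborel) \<partial>lborel)"
proof -
  have Fm[measurable]: "F \<in> borel_measurable (borel \<Otimes>\<^sub>M borel)" unfolding borel_prod by simp
  have Dm[measurable]: "D_set H \<rho> \<in> sets (borel \<Otimes>\<^sub>M borel)" unfolding borel_prod by simp
  have "(\<integral>\<^sup>+x. F x \<partial>mu r\<^sub>0 H \<Omega> \<rho>) = (\<integral>\<^sup>+x. ennreal (weight (fst x) * indicator (D_set H \<rho>) x) * F x \<partial>lborel)"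
    unfolding mu_density by (subst nn_integral_density) auto
  also have "\<dots> = (\<integral>\<^sup>+x. ennreal (weight (fst x) * indicator (D_set H \<rho>) x) * F x \<partial>(lborel \<Otimes>\<^sub>M lborel))"
    by (simp add: lborel_prod)
  also have "\<dots> = (\<integral>\<^sup>+z. \<integral>\<^sup>+s. ennreal (weight s * indicator (D_set H \<rho>) (s, z)) * F (s, z) \<partial>lborel \<partial>lborel)"
    by (subst lborel_pair.nn_integral_snd[symmetric]) simp_all
  also have "\<dots> = (\<integral>\<^sup>+z\<in>{0..H}. (\<integral>\<^sup>+s\<in>{0..\<rho> z}. F (s, z) * ennreal (weight s) \<partial>lborel) \<partial>lborel)"
  proof (rule nn_integral_cong)
    fix z
    have "(\<integral>\<^sup>+s. ennreal (weight s * indicator (D_set H \<rho>) (s, z)) * F (s, z) \<partial>lborel)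
      = (\<integral>\<^sup>+s. F (s, z) * ennreal (weight s) * indicator {0..\<rho> z} s * indicator {0..H} z \<partial>lborel)"
      by (rule nn_integral_cong) (auto simp: D_set_def mult.commute split: split_indicator)
    then show "(\<integral>\<^sup>+s. ennreal (weight s * indicator (D_set H \<rho>) (s, z)) * F (s, z) \<partial>lborel)
      = (\<integral>\<^sup>+s\<in>{0..\<rho> z}. F (s, z) * ennreal (weight s) \<partial>lborel) * indicator {0..H} z"
      by (simp add: nn_integral_multc split: split_indicator)
  qed
  finally show ?thesis .
qed

text \<open>Fubini, column by column.\<close>

lemma integral_mu:
  assumes [measurable]: "\<rho> \<in> borel_measurable borel" "F \<in> borel_measurable borel"
    and i: "integrable (mu r\<^sub>0 H \<Omega> \<rho>) F"
  shows "set_integrable lborel {0..H} (\<lambda>z. LINT s:{0..\<rho> z}|lborel. F (s, z) * weight s)"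
    and "(LINT x|(mu r\<^sub>0 H \<Omega> \<rho>). F x) = (LINT z:{0..H}|lborel. LINT s:{0..\<rho> z}|lborel. F (s, z) * weight s)"
proof -
  define G where "G s z = weight s * indicator (D_set H \<rho>) (s, z) * F (s, z)" for s z
  have "integrable lborel (\<lambda>x. weight (fst x) * indicator (D_set H \<rho>) x * F x)"
    using i unfolding mu_density by (subst (asm) integrable_density) (auto simp: weight_nonneg)
  then have iG: "integrable (lborel \<Otimes>\<^sub>M lborel) (case_prod G)"
    by (simp add: lborel_prod G_def case_prod_beta')
  have inner: "(LINT s|lborel. G s z) = indicator {0..H} z *\<^sub>R (LINT s:{0..\<rho> z}|lborel. F (s, z) * weight s)" for z
  proof -
    have "(LINT s|lborel. G s z) = (LINT s|lborel. indicator {0..H} z *\<^sub>R (indicator {0..\<rho> z} s *\<^sub>R (F (s, z) * weight s)))"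
      by (rule Bochner_Integration.integral_cong) (auto simp: G_def D_set_def split: split_indicator)
    then show ?thesis by (simp add: set_lebesgue_integral_def)
  qed
  show "set_integrable lborel {0..H} (\<lambda>z. LINT s:{0..\<rho> z}|lborel. F (s, z) * weight s)"
    using lborel_pair.integrable_snd[OF iG] unfolding set_integrable_def inner .
  have "(LINT x|(mu r\<^sub>0 H \<Omega> \<rho>). F x) = (LINT x|lborel. weight (fst x) * indicator (D_set H \<rho>) x * F x)"
    unfolding mu_density by (subst integral_density) (auto simp: weight_nonneg)
  also have "\<dots> = integral\<^sup>L (lborel \<Otimes>\<^sub>M lborel) (case_prod G)"
    by (simp add: lborel_prod G_def case_prod_beta')
  also have "\<dots> = (LINT z|lborel. LINT s|lborel. G s z)"
    by (rule lborel_pair.integral_snd[OF iG, symmetric])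
  finally show "(LINT x|(mu r\<^sub>0 H \<Omega> \<rho>). F x) = (LINT z:{0..H}|lborel. LINT s:{0..\<rho> z}|lborel. F (s, z) * weight s)"
    unfolding inner set_lebesgue_integral_def .
qed

lemma mass_lebesgue:
  assumes "r < smax"
  shows "set_integrable lborel {0..r} weight" "mass r = (LINT s:{0..r}|lborel. weight s)"
    "(\<integral>\<^sup>+s\<in>{0..r}. ennreal (weight s) \<partial>lborel) = ennreal (mass r)"
proof -
  show i: "set_integrable lborel {0..r} weight"
    by (rule borel_integrable_atLeastAtMost'[OF weight_cont_int[OF assms]])
  show e: "mass r = (LINT s:{0..r}|lborel. weight s)"
    unfolding mass_def using set_borel_integral_eq_integral(2)[OF i] by simp
  have "(\<integral>\<^sup>+s\<in>{0..r}. ennreal (weight s) \<partial>lborel) = (\<integral>\<^sup>+s. ennreal (indicator {0..r} s *\<^sub>R weight s) \<partial>lborel)"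
    by (rule nn_integral_cong) (auto split: split_indicator)
  also have "\<dots> = ennreal (LINT s|lborel. indicator {0..r} s *\<^sub>R weight s)"
    using i unfolding set_integrable_def by (intro nn_integral_eq_integral) (auto simp: weight_nonneg)
  finally show "(\<integral>\<^sup>+s\<in>{0..r}. ennreal (weight s) \<partial>lborel) = ennreal (mass r)"
    by (simp add: e set_lebesgue_integral_def)
qed

lemma energy_lebesgue:
  assumes "pot p" "r < smax"
  shows "set_integrable lborel {0..r} (\<lambda>s. (f0 r\<^sub>0 \<Omega> s - p (s, y)) * weight s)"
    "energy p y r = (LINT s:{0..r}|lborel. (f0 r\<^sub>0 \<Omega> s - p (s, y)) * weight s)"
proof -
  have "continuous_on {0..r} (\<lambda>s. (f0 r\<^sub>0 \<Omega> s - p (s, y)) * weight s)"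
    using assms by (intro energy_cont_integrand) auto
  then show i: "set_integrable lborel {0..r} (\<lambda>s. (f0 r\<^sub>0 \<Omega> s - p (s, y)) * weight s)"
    by (rule borel_integrable_atLeastAtMost')
  show "energy p y r = (LINT s:{0..r}|lborel. (f0 r\<^sub>0 \<Omega> s - p (s, y)) * weight s)"
    unfolding energy_def using set_borel_integral_eq_integral(2)[OF i] by simp
qed

lemma emeasure_mu:
  assumes [measurable]: "\<rho> \<in> borel_measurable borel" and "\<And>z. z \<in> {0..H} \<Longrightarrow> \<rho> z < smax"
  shows "emeasure (mu r\<^sub>0 H \<Omega> \<rho>) UNIV = (\<integral>\<^sup>+z\<in>{0..H}. ennreal (mass (\<rho> z)) \<partial>lborel)"
proof -
  have "emeasure (mu r\<^sub>0 H \<Omega> \<rho>) UNIV = (\<integral>\<^sup>+x. 1 \<partial>mu r\<^sub>0 H \<Omega> \<rho>)" by simp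
  also have "\<dots> = (\<integral>\<^sup>+z\<in>{0..H}. (\<integral>\<^sup>+s\<in>{0..\<rho> z}. 1 * ennreal (weight s) \<partial>lborel) \<partial>lborel)"
    by (rule nn_integral_mu) auto
  also have "\<dots> = (\<integral>\<^sup>+z\<in>{0..H}. ennreal (mass (\<rho> z)) \<partial>lborel)"
    by (intro nn_integral_cong) (auto simp: mass_lebesgue(3)[OF assms(2)] split: split_indicator)
  finally show ?thesis .
qed

lemma finite_measure_mu:
  assumes [measurable]: "\<rho> \<in> borel_measurable borel" and "\<And>z. z \<in> {0..H} \<Longrightarrow> \<rho> z \<le> t" and "0 \<le> t" "t < smax"
  shows "finite_measure (mu r\<^sub>0 H \<Omega> \<rho>)"
proof
  have "emeasure (mu r\<^sub>0 H \<Omega> \<rho>) UNIV = (\<integral>\<^sup>+z\<in>{0..H}. ennreal (mass (\<rho> z)) \<partial>lborel)"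
    using assms by (intro emeasure_mu) force+
  also have "\<dots> \<le> (\<integral>\<^sup>+z\<in>{0..H}. ennreal (mass t) \<partial>lborel)"
  proof (intro nn_integral_mono)
    fix z
    have "mass (\<rho> z) \<le> mass t" if "z \<in> {0..H}"
    proof (cases "0 \<le> \<rho> z")
      case True then show ?thesis using assms that by (intro mass_mono) auto
    next
      case False then show ?thesis using mass_nonneg[OF assms(4)] by (simp add: mass_def)
    qed
    then show "ennreal (mass (\<rho> z)) * indicator {0..H} z \<le> ennreal (mass t) * indicator {0..H} z"
      by (auto split: split_indicator intro: ennreal_leI)
  qed
  also have "\<dots> < \<infinity>" using H_pos by (simp add: nn_integral_cmult ennreal_mult_less_top)
  finally show "emeasure (mu r\<^sub>0 H \<Omega> \<rho>) (space (mu r\<^sub>0 H \<Omega> \<rho>)) \<noteq> \<infinity>" by simp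
qed

lemma D_set_cong: "(\<And>z. z \<in> {0..H} \<Longrightarrow> \<rho> z = \<rho>' z) \<Longrightarrow> D_set H \<rho> = D_set H \<rho>'"
  by (auto simp: D_set_def)

text \<open>Profiles enter the functionals only through their measures, so null sets of heights do not matter.\<close>

lemma mu_cong_AE:
  assumes [measurable]: "\<rho> \<in> borel_measurable borel" "\<rho>' \<in> borel_measurable borel"
    and ae: "AE z in lborel. z \<in> {0..H} \<longrightarrow> \<rho> z = \<rho>' z"
  shows "mu r\<^sub>0 H \<Omega> \<rho> = mu r\<^sub>0 H \<Omega> \<rho>'"
proof (rule measure_eqI)
  fix A assume "A \<in> sets (mu r\<^sub>0 H \<Omega> \<rho>)"
  then have A[measurable]: "A \<in> sets borel" by simp
  have eq: "emeasure (mu r\<^sub>0 H \<Omega> \<rho>) A = (\<integral>\<^sup>+z\<in>{0..H}. (\<integral>\<^sup>+s\<in>{0..\<rho> z}. indicator A (s, z) * ennreal (weight s) \<partial>lborel) \<partial>lborel)"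
    if [measurable]: "\<rho> \<in> borel_measurable borel" for \<rho>
    using nn_integral_mu[OF that, of "indicator A"] by simp
  show "emeasure (mu r\<^sub>0 H \<Omega> \<rho>) A = emeasure (mu r\<^sub>0 H \<Omega> \<rho>') A"
    unfolding eq[OF assms(1)] eq[OF assms(2)]
    by (rule nn_integral_cong_AE) (use ae in eventually_elim, auto split: split_indicator)
qed simp

end

section \<open>Perturbing the potential in a single column\<close>

text \<open>The perturbations \<open>\<psi> + \<xi> / (n + 1)\<close> of a function on \<open>Q\<close>; \<open>pn n\<close> is the transform of the
  \<open>n\<close>-th one and tends to \<open>p\<close> uniformly.\<close>

locale perturbation = params +
  fixes Q :: "(real \<times> real) set" and \<psi> \<xi> :: "real \<times> real \<Rightarrow> real" and B :: real
  assumes Q: "compact Q" "continuous_on Q \<psi>" "Q \<noteq> {}" and Qnn: "\<And>q. q \<in> Q \<Longrightarrow> 0 \<le> snd q"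
    and \<xi>_cont: "continuous_on UNIV \<xi>" and \<xi>_bound: "\<And>q. q \<in> Q \<Longrightarrow> \<bar>\<xi> q\<bar> \<le> B"
begin

definition p :: "real \<times> real \<Rightarrow> real" where "p = legendre Q \<psi>"

definition pn :: "nat \<Rightarrow> real \<times> real \<Rightarrow> real" where
  "pn n = legendre Q (\<lambda>q. \<psi> q + 1 / real (Suc n) * \<xi> q)"

lemma \<xi>_contQ: "continuous_on Q \<xi>" by (rule continuous_on_subset[OF \<xi>_cont]) simp

lemma contn: "continuous_on Q (\<lambda>q. \<psi> q + 1 / real (Suc n) * \<xi> q)"
  by (intro continuous_intros Q \<xi>_contQ)

lemma B_nonneg: "B \<ge> 0" using Q(3) \<xi>_bound by (meson abs_ge_zero ex_in_conv order_trans)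

lemma p_pot: "pot p" and pn_pot: "pot (pn n)"
  unfolding p_def pn_def by (intro legendre_continuous Q contn)+

lemma p_pn: "\<bar>p x - pn n x\<bar> \<le> 1 / real (Suc n) * B"
  unfolding p_def pn_def by (rule legendre_perturb_bound[OF Q(1,2) \<xi>_contQ Q(3) \<xi>_bound]) simp_all

lemma p_pn_B: "\<bar>p x - pn n x\<bar> \<le> B"
proof -
  have "1 / real (Suc n) * B \<le> 1 * B" using B_nonneg by (intro mult_right_mono) auto
  with p_pn[of x n] show ?thesis by simp
qed

lemma quotient_bound: "\<bar>(p x - pn n x) * real (Suc n)\<bar> \<le> B"
proof -
  have "\<bar>p x - pn n x\<bar> * real (Suc n) \<le> (1 / real (Suc n) * B) * real (Suc n)"
    by (intro mult_right_mono p_pn) auto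
  then show ?thesis by (simp add: abs_mult)
qed

lemma minimizers_bounds:
  assumes "\<And>s. 0 \<le> s \<Longrightarrow> s < smax \<Longrightarrow> p (s, y) \<le> M"
  shows "minimizers p y \<subseteq> {0..cutoff (M + B)}" "minimizers (pn n) y \<subseteq> {0..cutoff (M + B)}"
proof -
  have 1: "p (s, y) \<le> M + B" if "0 \<le> s" "s < smax" for s using assms[OF that] B_nonneg by simp
  have 2: "pn n (s, y) \<le> M + B" if "0 \<le> s" "s < smax" for s
    using assms[OF that] p_pn_B[of "(s, y)" n] by simp
  show "minimizers p y \<subseteq> {0..cutoff (M + B)}" by (rule minimizers_bound[OF p_pot 1])
  show "minimizers (pn n) y \<subseteq> {0..cutoff (M + B)}" by (rule minimizers_bound[OF pn_pot 2])
qed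

lemma min_energy_quotient_bound:
  assumes M: "\<And>s. 0 \<le> s \<Longrightarrow> s < smax \<Longrightarrow> p (s, y) \<le> M"
  shows "\<bar>(min_energy (pn n) y - min_energy p y) * real (Suc n)\<bar> \<le> B * mass (cutoff (M + B))"
proof -
  define e where "e = 1 / real (Suc n) * B"
  have e: "e \<ge> 0" using B_nonneg by (simp add: e_def)
  have m: "mass r \<le> mass (cutoff (M + B))" if "r \<in> {0..cutoff (M + B)}" for r
    using that cutoff(2) by (intro mass_mono) auto
  have a: "lowest p y \<in> minimizers p y" "lowest (pn n) y \<in> minimizers (pn n) y"
    by (rule lowest_highest(1)[OF p_pot], rule lowest_highest(1)[OF pn_pot])
  have "min_energy (pn n) y \<le> min_energy p y + e * mass (lowest p y)"
    using p_pn by (intro min_energy_cmp pn_pot p_pot a) (auto simp: e_def)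
  moreover have "min_energy p y \<le> min_energy (pn n) y + e * mass (lowest (pn n) y)"
    using p_pn[of _ n] by (intro min_energy_cmp pn_pot p_pot a) (auto simp: e_def abs_minus_commute)
  moreover have "e * mass (lowest p y) \<le> e * mass (cutoff (M + B))" "e * mass (lowest (pn n) y) \<le> e * mass (cutoff (M + B))"
    using a minimizers_bounds[OF M] e by (auto intro!: mult_left_mono m)
  ultimately have "\<bar>min_energy (pn n) y - min_energy p y\<bar> \<le> e * mass (cutoff (M + B))" by linarith
  then have "\<bar>min_energy (pn n) y - min_energy p y\<bar> * real (Suc n) \<le> e * mass (cutoff (M + B)) * real (Suc n)"
    by (intro mult_right_mono) auto
  then show ?thesis by (simp add: abs_mult e_def)
qed

lemma section_measurable:
  fixes f :: "real \<times> real \<Rightarrow> 'b::topological_space"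
  assumes "f \<in> borel \<rightarrow>\<^sub>M borel"
  shows "(\<lambda>s. f (s, y)) \<in> borel \<rightarrow>\<^sub>M borel"
  by (rule measurable_compose[OF _ assms]) (intro borel_measurable_continuous_onI continuous_intros)

text \<open>The difference quotients of the minimal energy are asymptotically at least the first variation at
  some optimal height of the unperturbed column: optimal heights of the perturbed columns
  accumulate at such a height, and there the quotients of the potentials converge to \<open>\<xi>\<close> of
  the gradient by the envelope theorem.\<close>

lemma min_energy_variation:
  assumes reg: "AE s in lborel. regular p (s, y)"
    and E: "\<And>r. r \<in> minimizers p y \<Longrightarrow> E \<le> (LINT s:{0..r}|lborel. \<xi> (rgrad p (s, y)) * weight s)"
    and e: "e > 0"
  shows "\<forall>\<^sub>F n in sequentially. E - e \<le> (min_energy (pn n) y - min_energy p y) * real (Suc n)"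
proof (rule ccontr)
  assume "\<not> ?thesis"
  \<comment> \<open>Along a subsequence on which the bound fails, optimal heights of the perturbed columns
    converge. Their limit is optimal for the unperturbed column and inherits the reversed bound.\<close>
  from not_eventually_sequentiallyD[OF this] obtain k :: "nat \<Rightarrow> nat" where
    k: "strict_mono k" "\<And>n. (min_energy (pn (k n)) y - min_energy p y) * real (Suc (k n)) < E - e" by (auto simp: not_le)
  obtain M where M: "\<And>s. 0 \<le> s \<Longrightarrow> s < smax \<Longrightarrow> p (s, y) \<le> M" by (rule section_bound[OF p_pot, of y]) blast
  define t where "t = cutoff (M + B)"
  have t: "0 < t" "t < smax" using cutoff(1,2) by (auto simp: t_def)
  have am: "lowest (pn n) y \<in> minimizers (pn n) y" for n by (rule lowest_highest(1)[OF pn_pot])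
  have at: "lowest (pn n) y \<in> {0..t}" for n using subsetD[OF minimizers_bounds(2)[OF M] am] by (simp add: t_def)
  from compact_Icc[of 0 t, unfolded compact_def, rule_format, of "\<lambda>n. lowest (pn (k n)) y", OF at]
  obtain r' j where r': "r' \<in> {0..t}" and j: "strict_mono j" "((\<lambda>n. lowest (pn (k n)) y) \<circ> j) \<longlonglongrightarrow> r'" by blast
  define i where "i n = k (j n)" for n
  define r where "r n = lowest (pn (i n)) y" for n
  have sm: "strict_mono i" using strict_mono_o[OF k(1) j(1)] by (simp add: i_def[abs_def] o_def)
  have lim: "r \<longlonglongrightarrow> r'" using j(2) by (simp add: r_def[abs_def] i_def o_def)
  have rt: "r n \<in> {0..t}" for n using at by (simp add: r_def)
  have e0: "(\<lambda>n. 1 / real (Suc (i n)) * B) \<longlonglongrightarrow> 0"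
    using LIMSEQ_subseq_LIMSEQ[OF LIMSEQ_Suc[OF lim_1_over_n[where 'a=real]] sm]
    by (intro tendsto_mult_left_zero) (simp add: o_def)
  have "r' \<in> minimizers p y"
  proof (rule minimizers_limit[where p=p and pn="\<lambda>n. pn (i n)" and r=r and r'=r' and y=y and yn="\<lambda>_. y"
        and e="\<lambda>n. 1 / real (Suc (i n)) * B", OF p_pot pn_pot _ lim _ _ e0])
    show "r n \<in> minimizers (pn (i n)) y" for n using am by (simp add: r_def)
    show "r' < smax" using r' t by auto
    show "\<bar>pn (i n) (s, y) - p (s, y)\<bar> \<le> 1 / real (Suc (i n)) * B" for n s
      using p_pn[of "(s, y)" "i n"] by (simp add: abs_minus_commute)
  qed
  from E[OF this] have E': "E \<le> (LINT s:{0..r'}|lborel. \<xi> (rgrad p (s, y)) * weight s)" .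
  define F where "F n s = (p (s, y) - pn (i n) (s, y)) * real (Suc (i n))" for n s
  have Fm[measurable]: "F n \<in> borel_measurable borel" for n
    unfolding F_def by (intro borel_measurable_continuous_onI continuous_intros section_cont p_pot pn_pot)
  have Tm[measurable]: "(\<lambda>s. \<xi> (rgrad p (s, y))) \<in> borel_measurable borel"
    by (rule section_measurable, rule measurable_compose[OF measurable_rgrad])
      (intro borel_measurable_continuous_onI p_pot \<xi>_cont)+
  have "(\<lambda>n. LINT s|lborel. indicator {0..r n} s * (F n s * weight s)) \<longlonglongrightarrow>
      (LINT s|lborel. indicator {0..r'} s * (\<xi> (rgrad p (s, y)) * weight s))"
  proof (rule integral_dominated_convergence[where w="\<lambda>s. indicator {0..t} s * (B * weight s)"])
    show "integrable lborel (\<lambda>s. indicator {0..t} s * (B * weight s))"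
      using integrable_mult_right[OF mass_lebesgue(1)[OF t(2), unfolded set_integrable_def], of B]
      by (simp add: mult.left_commute)
    have ne: "AE s in lborel. s \<noteq> r'" by (rule AE_lborel_singleton)
    show "AE s in lborel. (\<lambda>n. indicator {0..r n} s * (F n s * weight s)) \<longlonglongrightarrow>
        indicator {0..r'} s * (\<xi> (rgrad p (s, y)) * weight s)"
      using reg ne
    proof eventually_elim
      case (elim s)
      have "(\<lambda>n. (p (s, y) - pn n (s, y)) * real (Suc n)) \<longlonglongrightarrow> \<xi> (rgrad p (s, y))"
        unfolding p_def pn_def
      proof (rule legendre_perturb[OF Q(1,2) \<xi>_contQ Q(3)])
        fix q assume "q \<in> Q" "legendre Q \<psi> (s, y) = (s, y) \<bullet> q - \<psi> q"
        from contact_subgrad[OF Q(1,2) this] show "q = rgrad (legendre Q \<psi>) (s, y)"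
          using elim(1) by (intro subgrad_eq_rgrad legendre_subgrads_nonempty Q) (simp_all add: p_def)
      qed
      from LIMSEQ_subseq_LIMSEQ[OF this sm] have F: "(\<lambda>n. F n s) \<longlonglongrightarrow> \<xi> (rgrad p (s, y))"
        by (simp add: F_def o_def)
      have "\<forall>\<^sub>F n in sequentially. indicator {0..r n} s = (indicator {0..r'} s :: real)"
      proof (cases "s < r'")
        case True
        from order_tendstoD(1)[OF lim True] show ?thesis
          by eventually_elim (use True in \<open>auto split: split_indicator\<close>)
      next
        case False
        then have "r' < s" using elim(2) by simp
        from order_tendstoD(2)[OF lim this] show ?thesis
          by eventually_elim (use \<open>r' < s\<close> in \<open>auto split: split_indicator\<close>)
      qed
      then have "(\<lambda>n. indicator {0..r n} s :: real) \<longlonglongrightarrow> indicator {0..r'} s" by (rule tendsto_eventually)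
      then show ?case by (intro tendsto_intros F)
    qed
    show "AE s in lborel. norm (indicator {0..r n} s * (F n s * weight s)) \<le> indicator {0..t} s * (B * weight s)" for n
    proof (rule AE_I2)
      fix s
      have "\<bar>F n s\<bar> \<le> B" unfolding F_def by (rule quotient_bound)
      then have "\<bar>F n s\<bar> * weight s \<le> B * weight s" by (intro mult_right_mono weight_nonneg)
      then show "norm (indicator {0..r n} s * (F n s * weight s)) \<le> indicator {0..t} s * (B * weight s)"
        using rt[of n] weight_nonneg[of s] B_nonneg by (auto simp: abs_mult split: split_indicator)
    qed
  qed measurable
  then have conv: "(\<lambda>n. LINT s:{0..r n}|lborel. F n s * weight s) \<longlonglongrightarrow> (LINT s:{0..r'}|lborel. \<xi> (rgrad p (s, y)) * weight s)"
    by (simp add: set_lebesgue_integral_def)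
  \<comment> \<open>The optimal height of the perturbed column is a competitor in the unperturbed one.\<close>
  have bnd: "(LINT s:{0..r n}|lborel. F n s * weight s) \<le> E - e" for n
  proof -
    have r: "0 \<le> r n" "r n < smax" using rt[of n] t by auto
    have ci: "continuous_on {0..r n} (\<lambda>s. F n s * weight s)"
      unfolding F_def using r by (intro continuous_intros section_cont p_pot pn_pot weight_cont_int)
    have "(LINT s:{0..r n}|lborel. F n s * weight s) = integral {0..r n} (\<lambda>s. F n s * weight s)"
      by (rule set_borel_integral_eq_integral[OF borel_integrable_atLeastAtMost'[OF ci]])
    also have "\<dots> = integral {0..r n} (\<lambda>s. (p (s, y) - pn (i n) (s, y)) * weight s * real (Suc (i n)))"
      by (simp add: F_def algebra_simps)
    also have "\<dots> = (energy (pn (i n)) y (r n) - energy p y (r n)) * real (Suc (i n))"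
      unfolding energy_diff[OF pn_pot p_pot r(2)] by (rule integral_mult_left)
    also have "\<dots> \<le> (min_energy (pn (i n)) y - min_energy p y) * real (Suc (i n))"
      using min_energy_le[OF p_pot r, of y] min_energy_eq[OF pn_pot am, of "i n"] by (intro mult_right_mono) (auto simp: r_def)
    also have "\<dots> \<le> E - e" using k(2)[of "j n"] by (simp add: i_def)
    finally show ?thesis .
  qed
  have "(LINT s:{0..r'}|lborel. \<xi> (rgrad p (s, y)) * weight s) \<le> E - e"
    using LIMSEQ_le_const2[OF conv] bnd by blast
  then show False using E' e by simp
qed

end

section \<open>First variation of the dual functional\<close>

lemma AE_lborel_section:
  assumes "AE x in (lborel :: (real \<times> real) measure). P x"
  shows "AE z in lborel. AE s in lborel. P (s, z)"
proof -
  obtain N where N: "N \<in> null_sets (lborel :: (real \<times> real) measure)" "{x. \<not> P x} \<subseteq> N"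
    using assms unfolding eventually_ae_filter by auto
  have sN: "{x \<in> space (lborel \<Otimes>\<^sub>M lborel). (fst x, snd x) \<notin> N} \<in> sets (lborel \<Otimes>\<^sub>M lborel)"
    using N(1) unfolding lborel_prod by (auto simp: null_sets_def)
  have "AE x in lborel \<Otimes>\<^sub>M lborel. x \<notin> N" unfolding lborel_prod by (rule AE_not_in[OF N(1)])
  from lborel_pair.AE_pair[OF this] have "AE s in lborel. AE z in lborel. (s, z) \<notin> N" .
  then have "AE z in lborel. AE s in lborel. (s, z) \<notin> N"
    using lborel_pair.AE_commute[of "\<lambda>s z. (s, z) \<notin> N", OF sN] by blast
  then show ?thesis
    by (rule eventually_mono) (erule eventually_mono, use N(2) in blast)
qed

text \<open>The map \<open>slope\<close> stands for \<open>phi \<theta>\<close> on \<open>{0..H}\<close>, continued to all reals as a continuous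
  monotone function.\<close>

locale column = params +
  fixes slope :: "real \<Rightarrow> real"
  assumes slope_cont: "continuous_on UNIV slope" and slope_mono: "mono slope" and slope_strict: "strict_mono_on {0..H} slope"
begin

lemma slope_borel [measurable]: "slope \<in> borel_measurable borel"
  by (rule borel_measurable_continuous_onI[OF slope_cont])

lemma slope_inj: "inj_on slope {0..H}" by (rule strict_mono_on_imp_inj_on[OF slope_strict])

lemma slope_le: "z \<in> {0..H} \<Longrightarrow> slope z \<le> slope H" using slope_mono by (auto dest: monoD)

definition to_slope :: "(real \<times> real) \<Rightarrow> real \<times> real" where "to_slope x = (fst x, slope (snd x))"

lemma to_slope_cont: "continuous_on UNIV to_slope"
  unfolding to_slope_def[abs_def] by (intro continuous_intros continuous_on_compose2[OF slope_cont]) auto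

lemma to_slope_borel [measurable]: "to_slope \<in> borel \<rightarrow>\<^sub>M borel"
  by (rule borel_measurable_continuous_onI[OF to_slope_cont])

definition total_energy :: "(real \<times> real \<Rightarrow> real) \<Rightarrow> real" where
  "total_energy p = (LINT z:{0..H}|lborel. min_energy p (slope z))"

text \<open>The extremal optimal profiles are monotone, hence Borel; they select optimal heights measurably.\<close>

definition lowest_profile :: "(real \<times> real \<Rightarrow> real) \<Rightarrow> real \<Rightarrow> real" where "lowest_profile p z = lowest p (slope z)"
definition highest_profile :: "(real \<times> real \<Rightarrow> real) \<Rightarrow> real \<Rightarrow> real" where "highest_profile p z = highest p (slope z)"

lemma lowest_profile_mono: "column_convex p \<Longrightarrow> mono (lowest_profile p)" and highest_profile_mono: "column_convex p \<Longrightarrow> mono (highest_profile p)"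
  unfolding lowest_profile_def highest_profile_def using slope_mono by (auto intro!: monoI lowest_mono highest_mono dest: monoD)

lemma lowest_profile_borel: "column_convex p \<Longrightarrow> lowest_profile p \<in> borel_measurable borel"
  and highest_profile_borel: "column_convex p \<Longrightarrow> highest_profile p \<in> borel_measurable borel"
  by (intro borel_measurable_mono lowest_profile_mono highest_profile_mono; assumption)+

lemma column_bound:
  assumes "column_convex p"
  obtains M where "\<And>s y. 0 \<le> s \<Longrightarrow> s < smax \<Longrightarrow> y \<le> slope H \<Longrightarrow> p (s, y) \<le> M"
proof -
  obtain M where "\<And>s. 0 \<le> s \<Longrightarrow> s < smax \<Longrightarrow> p (s, slope H) \<le> M"
    by (rule section_bound[OF column_convexD(1)[OF assms], of "slope H"]) blast
  with that[of M] column_convexD(2)[OF assms] show thesis by (meson order_trans)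
qed

lemma minimizers_column_bound:
  assumes "column_convex p"
  obtains t where "0 < t" "t < smax" "\<And>z. z \<in> {0..H} \<Longrightarrow> minimizers p (slope z) \<subseteq> {0..t}"
proof -
  obtain M where M: "\<And>s y. 0 \<le> s \<Longrightarrow> s < smax \<Longrightarrow> y \<le> slope H \<Longrightarrow> p (s, y) \<le> M"
    by (rule column_bound[OF assms]) blast
  have "minimizers p (slope z) \<subseteq> {0..cutoff M}" if "z \<in> {0..H}" for z
    using M slope_le[OF that] by (intro minimizers_bound[OF column_convexD(1)[OF assms]]) auto
  with that[of "cutoff M"] cutoff show thesis by blast
qed

lemma min_energy_slope_integrable:
  assumes "column_convex p" "\<And>s y y'. \<bar>p (s, y) - p (s, y')\<bar> \<le> L * \<bar>y - y'\<bar>"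
  shows "set_integrable lborel {0..H} (\<lambda>z. min_energy p (slope z))"
proof (rule borel_integrable_atLeastAtMost')
  show "continuous_on {0..H} (\<lambda>z. min_energy p (slope z))"
    by (rule continuous_on_compose2[OF min_energy_cont[OF assms] continuous_on_subset[OF slope_cont]]) (auto intro: slope_le)
qed

end

text \<open>That \<open>\<sigma>\<close> does not charge vertical component zero is the hypothesis that defeats the
  ambiguity of the columns; it holds both for supports inside the open quarter disc and for
  absolutely continuous measures.\<close>

locale dual = column +
  fixes Q :: "(real \<times> real) set" and \<sigma> :: "(real \<times> real) measure"
  assumes Q_compact: "compact Q" and Q_ne: "Q \<noteq> {}" and Q_nonneg: "\<And>q. q \<in> Q \<Longrightarrow> 0 \<le> fst q \<and> 0 \<le> snd q"
    and \<sigma>_prob: "prob_space \<sigma>" and \<sigma>_sets [measurable_cong, simp]: "sets \<sigma> = sets borel"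
    and \<sigma>_Q: "AE q in \<sigma>. q \<in> Q" and \<sigma>_pos: "AE q in \<sigma>. snd q > 0"
begin

sublocale \<sigma>: prob_space \<sigma> by (rule \<sigma>_prob)

definition dual_value :: "(real \<times> real \<Rightarrow> real) \<Rightarrow> real" where
  "dual_value \<psi> = total_energy (legendre Q \<psi>) - (LINT q:Q|\<sigma>. \<psi> q)"

text \<open>Maximality among all continuous functions on \<open>Q\<close>, the potential being eliminated as the Legendre
  transform.\<close>

definition dual_optimal :: "(real \<times> real \<Rightarrow> real) \<Rightarrow> bool" where
  "dual_optimal \<psi> \<longleftrightarrow> continuous_on Q \<psi> \<and> (\<forall>\<psi>'. continuous_on Q \<psi>' \<longrightarrow> dual_value \<psi>' \<le> dual_value \<psi>)"

lemma \<sigma>_space [simp]: "space \<sigma> = UNIV" using sets_eq_imp_space_eq[OF \<sigma>_sets] by simp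

lemma Q_borel [measurable]: "Q \<in> sets borel" using Q_compact by (intro borel_closed compact_imp_closed)

lemma legendre_col: "continuous_on Q \<psi> \<Longrightarrow> column_convex (legendre Q \<psi>)"
  using Q_nonneg by (intro legendre_column_convex Q_compact Q_ne) auto

lemma Q_norm_bound: obtains L where "\<And>q. q \<in> Q \<Longrightarrow> norm q \<le> L" "0 \<le> L"
proof -
  obtain L where L: "\<And>q. q \<in> Q \<Longrightarrow> norm q \<le> L"
    using compact_imp_bounded[OF Q_compact] by (auto simp: bounded_iff)
  moreover have "0 \<le> L" using L Q_ne norm_ge_zero order_trans by blast
  ultimately show thesis using that by blast
qed

lemma min_energy_legendre_integrable:
  assumes "continuous_on Q \<psi>"
  shows "set_integrable lborel {0..H} (\<lambda>z. min_energy (legendre Q \<psi>) (slope z))"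
proof -
  obtain L where L: "\<And>q. q \<in> Q \<Longrightarrow> norm q \<le> L" by (rule Q_norm_bound) blast
  show ?thesis
  proof (rule min_energy_slope_integrable[OF legendre_col[OF assms], of L])
    show "\<bar>legendre Q \<psi> (s, y) - legendre Q \<psi> (s, y')\<bar> \<le> L * \<bar>y - y'\<bar>" for s y y'
      using legendre_lipschitz[OF Q_compact assms Q_ne L, of "(s, y)" "(s, y')"] by (simp add: norm_prod_def)
  qed
qed

lemma \<sigma>_integrable:
  fixes \<psi> :: "real \<times> real \<Rightarrow> real"
  assumes c: "continuous_on Q \<psi>"
  shows "set_integrable \<sigma> Q \<psi>"
proof -
  have m: "(\<lambda>x. indicator Q x *\<^sub>R \<psi> x) \<in> borel_measurable borel"
    by (rule borel_measurable_continuous_on_indicator[OF Q_borel c])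
  obtain C where C: "\<And>q. q \<in> Q \<Longrightarrow> \<bar>\<psi> q\<bar> \<le> C"
    using compact_imp_bounded[OF compact_continuous_image[OF c Q_compact]] by (auto simp: bounded_iff)
  show ?thesis unfolding set_integrable_def
  proof (rule \<sigma>.integrable_const_bound[of _ C])
    show "AE x in \<sigma>. norm (indicator Q x *\<^sub>R \<psi> x) \<le> C" using \<sigma>_Q by eventually_elim (simp add: C)
    show "(\<lambda>x. indicator Q x *\<^sub>R \<psi> x) \<in> borel_measurable \<sigma>"
      unfolding measurable_cong_sets[OF \<sigma>_sets refl] by (rule m)
  qed
qed

text \<open>At a maximum the difference quotients of the dual functional are at most zero. The columnwise
  lower bounds hold in the limit for almost every column, and the negative parts of the errors are
  dominated, so the bound survives integration. Only one inequality is available because the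
  optimal heights of the perturbed columns may accumulate at different heights.\<close>

lemma first_variation:
  assumes J: "dual_optimal \<psi>" and \<xi>: "continuous_on UNIV \<xi>" "\<And>q. q \<in> Q \<Longrightarrow> \<bar>\<xi> q\<bar> \<le> B"
    and Ei: "set_integrable lborel {0..H} E"
    and E: "\<And>z r. z \<in> {0..H} \<Longrightarrow> r \<in> minimizers (legendre Q \<psi>) (slope z) \<Longrightarrow>
       E z \<le> (LINT s:{0..r}|lborel. \<xi> (rgrad (legendre Q \<psi>) (s, slope z)) * weight s)"
  shows "(LINT z:{0..H}|lborel. E z) \<le> (LINT q:Q|\<sigma>. \<xi> q)"
proof -
  have \<psi>: "continuous_on Q \<psi>" using J by (simp add: dual_optimal_def)
  interpret perturbation r\<^sub>0 H \<Omega> Q \<psi> \<xi> B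
    by unfold_locales (use Q_compact \<psi> Q_ne Q_nonneg \<xi> in auto)
  define D where "D n z = (min_energy (pn n) (slope z) - min_energy p (slope z)) * real (Suc n)" for n z
  have i0: "set_integrable lborel {0..H} (\<lambda>z. min_energy p (slope z))"
    unfolding p_def by (rule min_energy_legendre_integrable[OF \<psi>])
  have i1: "set_integrable lborel {0..H} (\<lambda>z. min_energy (pn n) (slope z))" for n
    unfolding pn_def by (rule min_energy_legendre_integrable[OF contn])
  have Di: "set_integrable lborel {0..H} (D n)" for n
    unfolding D_def by (intro set_integrable_mult_left set_integral_diff(1) i0 i1)
  have DJ: "(LINT z:{0..H}|lborel. D n z) \<le> (LINT q:Q|\<sigma>. \<xi> q)" for n
  proof -
    have a: "dual_value (\<lambda>q. \<psi> q + 1 / real (Suc n) * \<xi> q) \<le> dual_value \<psi>" using J contn unfolding dual_optimal_def by blast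
    have b: "(LINT q:Q|\<sigma>. \<psi> q + 1 / real (Suc n) * \<xi> q) = (LINT q:Q|\<sigma>. \<psi> q) + 1 / real (Suc n) * (LINT q:Q|\<sigma>. \<xi> q)"
      by (subst set_integral_add(2)) (intro \<sigma>_integrable \<psi> \<xi>_contQ continuous_intros, simp)+
    have "(total_energy (pn n) - total_energy p) * real (Suc n) \<le> (LINT q:Q|\<sigma>. \<xi> q)"
      using a unfolding dual_value_def b pn_def[symmetric] p_def[symmetric] by (simp add: field_simps)
    moreover have "(LINT z:{0..H}|lborel. D n z) = (total_energy (pn n) - total_energy p) * real (Suc n)"
      unfolding D_def total_energy_def set_integral_diff(2)[OF i1 i0, symmetric] by (rule set_integral_mult_left)
    ultimately show ?thesis by simp
  qed
  \<comment> \<open>The quotients need not converge. Their errors, truncated to be nonpositive, do converge to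
    zero, and the truncation only weakens the lower bound.\<close>
  define m where "m n z = min (D n z - E z) 0" for n z
  obtain M where M: "\<And>s y. 0 \<le> s \<Longrightarrow> s < smax \<Longrightarrow> y \<le> slope H \<Longrightarrow> p (s, y) \<le> M"
    by (rule column_bound[OF legendre_col[OF \<psi>], folded p_def]) blast
  define C where "C = B * mass (cutoff (M + B))"
  have DC: "\<bar>D n z\<bar> \<le> C" if "z \<in> {0..H}" for n z
    unfolding D_def C_def using slope_le[OF that] M by (intro min_energy_quotient_bound) auto
  have reg: "AE x in lborel. snd x \<in> {0..H} \<longrightarrow> regular p (fst x, slope (snd x))"
    by (rule AE_regular[OF p_pot legendre_subgrads_nonempty[OF Q, folded p_def] slope_borel _ slope_inj]) simp
  have "AE z in lborel. AE s in lborel. z \<in> {0..H} \<longrightarrow> regular p (s, slope z)"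
    using AE_lborel_section[OF reg] by simp
  then have lim: "AE z in lborel. (\<lambda>n. indicator {0..H} z *\<^sub>R m n z) \<longlonglongrightarrow> 0"
  proof eventually_elim
    case (elim z)
    show ?case
    proof (cases "z \<in> {0..H}")
      case True
      then have r: "AE s in lborel. regular p (s, slope z)" using elim by simp
      have "(\<lambda>n. m n z) \<longlonglongrightarrow> 0"
      proof (rule LIMSEQ_I)
        fix e :: real assume "e > 0"
        then have "e / 2 > 0" by simp
        from min_energy_variation[OF r E[OF True, folded p_def] this]
        obtain N where "\<And>n. n \<ge> N \<Longrightarrow> E z - e / 2 \<le> D n z"
          unfolding D_def eventually_sequentially by blast
        then show "\<exists>no. \<forall>n\<ge>no. norm (m n z - 0) < e"
          using \<open>e > 0\<close> unfolding m_def by (intro exI[of _ N]) (force simp: min_def)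
      qed
      then show ?thesis using True by simp
    qed simp
  qed
  have mi: "set_integrable lborel {0..H} (m n)" for n
  proof -
    have "integrable lborel (\<lambda>z. min (indicator {0..H} z *\<^sub>R D n z - indicator {0..H} z *\<^sub>R E z) 0)"
      using Di Ei unfolding set_integrable_def by (intro integrable_min Bochner_Integration.integrable_diff) auto
    then show ?thesis unfolding set_integrable_def
      by (rule Bochner_Integration.integrable_cong[THEN iffD1, rotated -1]) (auto simp: m_def split: split_indicator)
  qed
  have "(\<lambda>n. LINT z|lborel. indicator {0..H} z *\<^sub>R m n z) \<longlonglongrightarrow> (LINT z|(lborel::real measure). 0)"
  proof (rule integral_dominated_convergence[where w="\<lambda>z. indicator {0..H} z *\<^sub>R (C + \<bar>E z\<bar>)"])
    have "integrable lborel (\<lambda>z. indicator {0..H} z *\<^sub>R C)"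
      by (intro integrable_scaleR_left integrable_real_indicator) (auto simp: emeasure_lborel_Icc_eq)
    then have "integrable lborel (\<lambda>z. indicator {0..H} z *\<^sub>R C + norm (indicator {0..H} z *\<^sub>R E z))"
      using Ei unfolding set_integrable_def
      by (intro Bochner_Integration.integrable_add integrable_norm)
    then show "integrable lborel (\<lambda>z. indicator {0..H} z *\<^sub>R (C + \<bar>E z\<bar>))"
      by (rule Bochner_Integration.integrable_cong[THEN iffD1, rotated -1]) (auto split: split_indicator)
    show "(\<lambda>z. indicator {0..H} z *\<^sub>R m n z) \<in> borel_measurable lborel" for n
      using mi[of n] unfolding set_integrable_def by auto
    show "AE z in lborel. norm (indicator {0..H} z *\<^sub>R m n z) \<le> indicator {0..H} z *\<^sub>R (C + \<bar>E z\<bar>)" for n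
      using DC[of _ n] unfolding m_def by (intro AE_I2) (force simp: min_def split: split_indicator)
  qed (use lim in auto)
  then have ml: "(\<lambda>n. (LINT z:{0..H}|lborel. E z) + (LINT z:{0..H}|lborel. m n z)) \<longlonglongrightarrow> (LINT z:{0..H}|lborel. E z) + 0"
    unfolding set_lebesgue_integral_def by (intro tendsto_intros) simp
  have "(LINT z:{0..H}|lborel. E z) + (LINT z:{0..H}|lborel. m n z) \<le> (LINT q:Q|\<sigma>. \<xi> q)" for n
  proof -
    have "(LINT z:{0..H}|lborel. E z) + (LINT z:{0..H}|lborel. m n z) = (LINT z:{0..H}|lborel. E z + m n z)"
      by (rule set_integral_add(2)[OF Ei mi, symmetric])
    also have "\<dots> \<le> (LINT z:{0..H}|lborel. D n z)"
      by (intro set_integral_mono set_integral_add(1) Ei mi Di) (auto simp: m_def)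
    finally show ?thesis using DJ[of n] by simp
  qed
  then show ?thesis using LIMSEQ_le_const2[OF ml] by auto
qed

end

section \<open>The gradient of a dual maximizer transports the fluid\<close>

context params
begin

lemma weighted_integrable:
  fixes g :: "real \<Rightarrow> real"
  assumes [measurable]: "g \<in> borel_measurable borel" and B: "\<And>s. \<bar>g s\<bar> \<le> B" and r: "r < smax"
  shows "set_integrable lborel {0..r} (\<lambda>s. g s * weight s)"
proof -
  have "integrable lborel (\<lambda>s. B * (indicator {0..r} s *\<^sub>R weight s))"
    using mass_lebesgue(1)[OF r] unfolding set_integrable_def by (rule integrable_mult_right)
  then show ?thesis unfolding set_integrable_def
  proof (rule Bochner_Integration.integrable_bound)
    show "(\<lambda>s. indicator {0..r} s *\<^sub>R (g s * weight s)) \<in> borel_measurable lborel" by measurable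
    have "\<bar>g s\<bar> * weight s \<le> \<bar>B * weight s\<bar>" for s
      using mult_right_mono[OF B[of s] weight_nonneg[of s]] by simp
    then show "AE s in lborel. norm (indicator {0..r} s *\<^sub>R (g s * weight s)) \<le> norm (B * (indicator {0..r} s *\<^sub>R weight s))"
      by (auto simp: abs_mult weight_nonneg split: split_indicator)
  qed
qed

lemma weighted_mono:
  fixes g :: "real \<Rightarrow> real"
  assumes [measurable]: "g \<in> borel_measurable borel" and B: "\<And>s. 0 \<le> g s \<and> g s \<le> B" and r: "a \<le> r" "r < smax"
  shows "(LINT s:{0..a}|lborel. g s * weight s) \<le> (LINT s:{0..r}|lborel. g s * weight s)"
proof -
  have i: "set_integrable lborel {0..r} (\<lambda>s. g s * weight s)" if "r < smax" for r
    using B that by (intro weighted_integrable) (auto simp: abs_le_iff intro: order_trans[of _ 0])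
  show ?thesis
    unfolding set_lebesgue_integral_def
    by (rule integral_mono[OF i[unfolded set_integrable_def] i[unfolded set_integrable_def]])
      (use r B weight_nonneg in \<open>auto split: split_indicator\<close>)
qed

end

context dual
begin

text \<open>For a nonnegative perturbation the worst optimal height in each column is the lowest one, for a
  nonpositive perturbation the highest one.\<close>

lemma variation_low_high:
  fixes \<xi> :: "real \<times> real \<Rightarrow> real"
  assumes J: "dual_optimal \<psi>" and \<xi>: "continuous_on UNIV \<xi>" "\<And>q. 0 \<le> \<xi> q \<and> \<xi> q \<le> B"
  shows "(LINT x|(mu r\<^sub>0 H \<Omega> (lowest_profile (legendre Q \<psi>))). \<xi> (rgrad (legendre Q \<psi>) (to_slope x))) \<le> (LINT q:Q|\<sigma>. \<xi> q)"
    "(LINT q:Q|\<sigma>. \<xi> q) \<le> (LINT x|(mu r\<^sub>0 H \<Omega> (highest_profile (legendre Q \<psi>))). \<xi> (rgrad (legendre Q \<psi>) (to_slope x)))"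
proof -
  define p where "p = legendre Q \<psi>"
  have \<psi>: "continuous_on Q \<psi>" using J by (simp add: dual_optimal_def)
  have pc: "column_convex p" unfolding p_def by (rule legendre_col[OF \<psi>])
  note pp = column_convexD(1)[OF pc]
  define F where "F x = \<xi> (rgrad p (to_slope x))" for x
  have rm: "(\<lambda>x. \<xi> (rgrad p x)) \<in> borel_measurable borel"
    by (rule measurable_compose[OF measurable_rgrad]) (intro borel_measurable_continuous_onI pp \<xi>(1))+
  have Fm[measurable]: "F \<in> borel_measurable borel"
    unfolding F_def[abs_def] by (rule measurable_compose[OF to_slope_borel rm])
  have gm: "(\<lambda>s. \<xi> (rgrad p (s, y))) \<in> borel_measurable borel" for y
    by (rule measurable_compose[OF _ rm]) (intro borel_measurable_continuous_onI continuous_intros)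
  have Fe: "F (s, z) = \<xi> (rgrad p (s, slope z))" for s z by (simp add: F_def to_slope_def)
  have FB: "norm (F x) \<le> B" for x using \<xi>(2) by (auto simp: F_def)
  obtain t where t: "0 < t" "t < smax" "\<And>z. z \<in> {0..H} \<Longrightarrow> minimizers p (slope z) \<subseteq> {0..t}"
    by (rule minimizers_column_bound[OF pc]) blast
  have i: "integrable (mu r\<^sub>0 H \<Omega> \<rho>) F"
    if "\<rho> \<in> borel_measurable borel" "\<And>z. z \<in> {0..H} \<Longrightarrow> \<rho> z \<in> minimizers p (slope z)" for \<rho>
  proof -
    have "\<rho> z \<le> t" if "z \<in> {0..H}" for z using t(3)[OF that] \<open>\<And>z. z \<in> {0..H} \<Longrightarrow> \<rho> z \<in> minimizers p (slope z)\<close>[OF that] by auto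
    then interpret finite_measure "mu r\<^sub>0 H \<Omega> \<rho>" using that(1) t by (intro finite_measure_mu[of _ t]) auto
    show ?thesis using FB by (intro integrable_const_bound[of _ B]) simp_all
  qed
  have al: "lowest_profile p \<in> borel_measurable borel" "\<And>z. z \<in> {0..H} \<Longrightarrow> lowest_profile p z \<in> minimizers p (slope z)"
    by (rule lowest_profile_borel[OF pc]) (simp add: lowest_profile_def lowest_highest(1)[OF pp])
  have ah: "highest_profile p \<in> borel_measurable borel" "\<And>z. z \<in> {0..H} \<Longrightarrow> highest_profile p z \<in> minimizers p (slope z)"
    by (rule highest_profile_borel[OF pc]) (simp add: highest_profile_def lowest_highest(2)[OF pp])
  have b: "\<bar>\<xi> q\<bar> \<le> B" "\<bar>- \<xi> q\<bar> \<le> B" for q using \<xi>(2)[of q] by auto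
  have lt: "r < smax" if "r \<in> minimizers p y" for r y using that by (simp add: minimizers_def)
  have "(LINT z:{0..H}|lborel. LINT s:{0..lowest_profile p z}|lborel. F (s, z) * weight s) \<le> (LINT q:Q|\<sigma>. \<xi> q)"
  proof (rule first_variation[OF J \<xi>(1) b(1) integral_mu(1)[OF al(1) Fm i[OF al]]])
    fix z r assume "z \<in> {0..H}" and r: "r \<in> minimizers (legendre Q \<psi>) (slope z)"
    then show "(LINT s:{0..lowest_profile p z}|lborel. F (s, z) * weight s) \<le> (LINT s:{0..r}|lborel. \<xi> (rgrad (legendre Q \<psi>) (s, slope z)) * weight s)"
      unfolding Fe p_def[symmetric] using \<xi>(2) lowest_highest(3)[OF pp, of r "slope z"] lt
      by (intro weighted_mono[where B=B] gm) (auto simp: lowest_profile_def)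
  qed
  then show "(LINT x|(mu r\<^sub>0 H \<Omega> (lowest_profile (legendre Q \<psi>))). \<xi> (rgrad (legendre Q \<psi>) (to_slope x))) \<le> (LINT q:Q|\<sigma>. \<xi> q)"
    using integral_mu(2)[OF al(1) Fm i[OF al]] by (simp add: F_def p_def)
  have mi: "set_integrable lborel {0..H} (\<lambda>z. - (LINT s:{0..highest_profile p z}|lborel. F (s, z) * weight s))"
    using integral_mu(1)[OF ah(1) Fm i[OF ah]] unfolding set_integrable_def by simp
  have "(LINT z:{0..H}|lborel. - (LINT s:{0..highest_profile p z}|lborel. F (s, z) * weight s)) \<le> (LINT q:Q|\<sigma>. - \<xi> q)"
  proof (rule first_variation[OF J continuous_on_minus[OF \<xi>(1)] b(2) mi])
    fix z r assume "z \<in> {0..H}" and r: "r \<in> minimizers (legendre Q \<psi>) (slope z)"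
    have "(LINT s:{0..r}|lborel. \<xi> (rgrad p (s, slope z)) * weight s) \<le> (LINT s:{0..highest_profile p z}|lborel. F (s, z) * weight s)"
      unfolding Fe using \<xi>(2) lowest_highest(4)[OF pp] lt[OF lowest_highest(2)[OF pp, of "slope z"]] r
      by (intro weighted_mono[where B=B] gm) (auto simp: highest_profile_def p_def)
    then show "- (LINT s:{0..highest_profile p z}|lborel. F (s, z) * weight s) \<le> (LINT s:{0..r}|lborel. - \<xi> (rgrad (legendre Q \<psi>) (s, slope z)) * weight s)"
      by (simp add: p_def set_lebesgue_integral_def)
  qed
  then have "(LINT q:Q|\<sigma>. \<xi> q) \<le> (LINT z:{0..H}|lborel. LINT s:{0..highest_profile p z}|lborel. F (s, z) * weight s)"
    by (simp add: set_lebesgue_integral_def)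
  then show "(LINT q:Q|\<sigma>. \<xi> q) \<le> (LINT x|(mu r\<^sub>0 H \<Omega> (highest_profile (legendre Q \<psi>))). \<xi> (rgrad (legendre Q \<psi>) (to_slope x)))"
    using integral_mu(2)[OF ah(1) Fm i[OF ah]] by (simp add: F_def p_def)
qed

end

text \<open>Continuous functions increasing to the indicator of the open set \<open>U\<close>; the distance to the empty
  set is zero, hence the separate case.\<close>

definition tent :: "(real \<times> real) set \<Rightarrow> nat \<Rightarrow> real \<times> real \<Rightarrow> real" where
  "tent U n q = (if U = UNIV then 1 else min 1 (real n * infdist q (- U)))"

lemma tent_cont: "continuous_on UNIV (tent U n)"
  unfolding tent_def[abs_def] by (cases "U = UNIV") (auto intro!: continuous_intros)

lemma tent_bounds: "0 \<le> tent U n q \<and> tent U n q \<le> 1"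
  by (auto simp: tent_def infdist_nonneg)

lemma tent_lim:
  assumes "open U"
  shows "(\<lambda>n. tent U n q) \<longlonglongrightarrow> indicator U q"
proof (cases "U = UNIV")
  case False
  show ?thesis
  proof (cases "q \<in> U")
    case True
    have "infdist q (- U) \<noteq> 0"
      using in_closed_iff_infdist_zero[of "- U" q] assms False True by auto
    then have d: "infdist q (- U) > 0" using infdist_nonneg[of q "- U"] by linarith
    obtain N :: nat where N: "1 / infdist q (- U) < N" using reals_Archimedean2 by blast
    have "tent U n q = 1" if "n \<ge> N" for n
    proof -
      have "1 / infdist q (- U) < real n" using N that by linarith
      then have "1 \<le> real n * infdist q (- U)" using d by (simp add: field_simps)
      then show ?thesis using False by (simp add: tent_def)
    qed
    then have "\<forall>\<^sub>F n in sequentially. tent U n q = indicator U q"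
      using True unfolding eventually_sequentially by auto
    then show ?thesis by (rule tendsto_eventually)
  next
    case F: False
    then show ?thesis using False by (simp add: tent_def)
  qed
qed (simp add: tent_def)

lemma tent_integral_lim:
  assumes "finite_measure M" and U: "open U" and T[measurable]: "T \<in> M \<rightarrow>\<^sub>M borel"
  shows "(\<lambda>n. LINT x|M. tent U n (T x)) \<longlonglongrightarrow> measure (distr M borel T) U"
proof -
  interpret finite_measure M by fact
  have [measurable]: "U \<in> sets borel" using U by simp
  have tm[measurable]: "tent U n \<in> borel_measurable borel" for n by (rule borel_measurable_continuous_onI[OF tent_cont])
  have "(\<lambda>n. LINT x|M. tent U n (T x)) \<longlonglongrightarrow> (LINT x|M. indicator U (T x))"
    by (rule integral_dominated_convergence[where w="\<lambda>_. 1"]) (use tent_bounds tent_lim[OF U] in auto)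
  also have "(LINT x|M. indicator U (T x)) = (LINT x|(distr M borel T). indicator U x :: real)"
    by (rule integral_distr[symmetric]) simp_all
  also have "\<dots> = measure (distr M borel T) U" by simp
  finally show ?thesis .
qed

context dual
begin

lemma open_measure_eq:
  assumes M: "finite_measure M" and s: "sets M = sets borel"
    and eq: "\<And>U. open U \<Longrightarrow> measure M U = measure \<sigma> U"
  shows "M = \<sigma>"
proof (rule measure_eqI_generator_eq[where E="{U. open U}" and \<Omega>=UNIV and A="\<lambda>_. UNIV"])
  interpret M: finite_measure M by fact
  show "emeasure M U = emeasure \<sigma> U" if "U \<in> {U. open U}" for U
    using eq[of U] that by (simp add: M.emeasure_eq_measure \<sigma>.emeasure_eq_measure)
  show "emeasure M UNIV \<noteq> \<infinity>" by simp
  show "sets M = sigma_sets UNIV {U. open U}" "sets \<sigma> = sigma_sets UNIV {U. open U}"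
    by (simp_all add: s borel_def)
qed (auto simp: Int_stable_def)

text \<open>The left difference quotients in the vertical direction vanish.\<close>

lemma zero_vertical_slope:
  assumes \<psi>: "continuous_on Q \<psi>" and reg: "regular (legendre Q \<psi>) (s, y)"
    and const: "\<And>u. u \<le> y \<Longrightarrow> legendre Q \<psi> (s, u) = legendre Q \<psi> (s, y)"
  shows "snd (rgrad (legendre Q \<psi>) (s, y)) = 0"
proof -
  define p where "p = legendre Q \<psi>"
  have sub: "\<And>x. subgrads p x \<noteq> {}" unfolding p_def by (rule legendre_subgrads_nonempty[OF Q_compact \<psi> Q_ne])
  then obtain g where g: "g \<in> subgrads p (s, y)" by blast
  have fl: "dir_smooth (0, 1) p (s, y)" using reg by (simp add: regular_def p_def)
  have "(\<lambda>n. (p (s, y) - p (s, y - 1 / real (Suc n))) * real (Suc n)) \<longlonglongrightarrow> g \<bullet> (0, 1)"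
    using deriv_sequentially(2)[OF dir_smooth_imp_has_derivative[OF sub fl g]] by simp
  moreover have "p (s, y - 1 / real (Suc n)) = p (s, y)" for n
    unfolding p_def by (rule const) simp
  ultimately have "g \<bullet> (0, 1) = 0" by (simp add: LIMSEQ_const_iff)
  then show ?thesis using dir_smooth_subgrad[OF sub fl g] by (simp add: rgrad_def p_def)
qed

text \<open>The image of the lowest profile lies below \<open>\<sigma>\<close> and that of the highest profile above it.
  Between the two profiles the gradient has vertical component zero, so the images agree on
  positive vertical components, where all of \<open>\<sigma>\<close> lives; the chain of inequalities closes.\<close>

theorem optimal_transport:
  assumes J: "dual_optimal \<psi>"
  shows "distr (mu r\<^sub>0 H \<Omega> (lowest_profile (legendre Q \<psi>))) borel (\<lambda>x. rgrad (legendre Q \<psi>) (to_slope x)) = \<sigma>"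
proof -
  define p where "p = legendre Q \<psi>"
  have \<psi>: "continuous_on Q \<psi>" using J by (simp add: dual_optimal_def)
  have pc: "column_convex p" unfolding p_def by (rule legendre_col[OF \<psi>])
  note pp = column_convexD(1)[OF pc]
  define T where "T x = rgrad p (to_slope x)" for x
  have Tm[measurable]: "T \<in> borel \<rightarrow>\<^sub>M borel"
    unfolding T_def[abs_def]
    by (rule measurable_compose[OF to_slope_borel measurable_rgrad]) (intro borel_measurable_continuous_onI pp)
  define \<mu>a where "\<mu>a = mu r\<^sub>0 H \<Omega> (lowest_profile p)"
  define \<mu>b where "\<mu>b = mu r\<^sub>0 H \<Omega> (highest_profile p)"
  obtain t where t: "0 < t" "t < smax" "\<And>z. z \<in> {0..H} \<Longrightarrow> minimizers p (slope z) \<subseteq> {0..t}"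
    by (rule minimizers_column_bound[OF pc]) blast
  note al[measurable] = lowest_profile_borel[OF pc] and ah[measurable] = highest_profile_borel[OF pc]
  have fin: "finite_measure \<mu>a" "finite_measure \<mu>b"
    unfolding \<mu>a_def \<mu>b_def using t subsetD[OF t(3) lowest_highest(1)[OF pp]] subsetD[OF t(3) lowest_highest(2)[OF pp]]
    by (auto intro!: finite_measure_mu[of _ t] al ah simp: lowest_profile_def highest_profile_def)
  have Tma: "T \<in> \<mu>a \<rightarrow>\<^sub>M borel" "T \<in> \<mu>b \<rightarrow>\<^sub>M borel" by (simp_all add: \<mu>a_def \<mu>b_def)
  have lim\<sigma>: "(\<lambda>n. LINT q:Q|\<sigma>. tent U n q) \<longlonglongrightarrow> measure \<sigma> U" if U: "open U" for U
  proof -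
    have "(LINT q:Q|\<sigma>. tent U n q) = (LINT q|\<sigma>. tent U n q)" for n
    proof -
      have "tent U n \<in> borel_measurable \<sigma>"
        unfolding measurable_cong_sets[OF \<sigma>_sets refl] by (rule borel_measurable_continuous_onI[OF tent_cont])
      moreover have "AE q in \<sigma>. indicator Q q *\<^sub>R tent U n q = tent U n q"
        using \<sigma>_Q by eventually_elim simp
      ultimately show ?thesis unfolding set_lebesgue_integral_def
        by (intro integral_cong_AE) (auto simp: measurable_cong_sets[OF \<sigma>_sets refl])
    qed
    moreover have "distr \<sigma> borel (\<lambda>x. x) = \<sigma>" by (rule distr_id2) simp
    ultimately show ?thesis
      using tent_integral_lim[OF \<sigma>.finite_measure_axioms U, of "\<lambda>x. x"] by simp
  qed
  have le1: "measure (distr \<mu>a borel T) U \<le> measure \<sigma> U" if U: "open U" for U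
    by (rule LIMSEQ_le[OF tent_integral_lim[OF fin(1) U Tma(1)] lim\<sigma>[OF U]])
      (use variation_low_high(1)[OF J tent_cont tent_bounds] in \<open>auto simp: \<mu>a_def T_def p_def\<close>)
  have le2: "measure \<sigma> U \<le> measure (distr \<mu>b borel T) U" if U: "open U" for U
    by (rule LIMSEQ_le[OF lim\<sigma>[OF U] tent_integral_lim[OF fin(2) U Tma(2)]])
      (use variation_low_high(2)[OF J tent_cont tent_bounds] in \<open>auto simp: \<mu>b_def T_def p_def\<close>)
  have reg: "AE x in lborel. snd x \<in> {0..H} \<longrightarrow> regular p (fst x, slope (snd x))"
    by (rule AE_regular[OF pp legendre_subgrads_nonempty[OF Q_compact \<psi> Q_ne, folded p_def] slope_borel _ slope_inj]) simp
  have "countable {z \<in> {0..H}. slope z \<in> ambiguous p}"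
    by (rule countable_image_inj_on[OF countable_subset[OF _ countable_ambiguous[of p]] inj_on_subset[OF slope_inj]]) auto
  from AE_snd_notin[OF this] reg
  have gap: "AE x in lborel. x \<in> D_set H (highest_profile p) \<longrightarrow> 0 < snd (T x) \<longrightarrow> x \<in> D_set H (lowest_profile p)"
  proof eventually_elim
    case (elim x)
    obtain s z where x: "x = (s, z)" by (cases x)
    show ?case
    proof (intro impI, rule ccontr)
      assume h: "x \<in> D_set H (highest_profile p)" "0 < snd (T x)" "x \<notin> D_set H (lowest_profile p)"
      then have z: "z \<in> {0..H}" and s: "lowest_profile p z < s" "s \<le> highest_profile p z" by (auto simp: D_set_def x)
      have const: "p (s, u) = p (s, slope z)" if "u \<le> slope z" for u
        using gap_const[OF pc _ _ _ that, of s] s elim(1) z by (simp add: lowest_profile_def highest_profile_def x)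
      have rg: "regular p (s, slope z)" using elim(2) z by (simp add: x)
      have "snd (rgrad p (s, slope z)) = 0"
        unfolding p_def by (rule zero_vertical_slope[OF \<psi> rg[unfolded p_def] const[unfolded p_def]])
      then show False using h(2) by (simp add: T_def to_slope_def x)
    qed
  qed
  have sub: "D_set H (lowest_profile p) \<subseteq> D_set H (highest_profile p)"
  proof -
    have "lowest_profile p z \<le> highest_profile p z" for z
      unfolding lowest_profile_def highest_profile_def by (rule lowest_highest(3)[OF pp lowest_highest(2)[OF pp]])
    then show ?thesis by (force simp: D_set_def intro: order_trans)
  qed
  have eq: "measure (distr \<mu>b borel T) U = measure (distr \<mu>a borel T) U"
    if [measurable]: "U \<in> sets borel" and pos: "U \<subseteq> {q. 0 < snd q}" for U
  proof -
    have A[measurable]: "T -` U \<in> sets borel" using measurable_sets[OF Tm that(1)] by simp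
    have e: "emeasure (mu r\<^sub>0 H \<Omega> \<rho>) (T -` U) = (\<integral>\<^sup>+x. ennreal (weight (fst x) * indicator (D_set H \<rho>) x) * indicator (T -` U) x \<partial>lborel)"
      if [measurable]: "\<rho> \<in> borel_measurable borel" for \<rho>
      unfolding mu_density by (rule emeasure_density) auto
    have "emeasure \<mu>b (T -` U) = emeasure \<mu>a (T -` U)"
      unfolding \<mu>a_def \<mu>b_def e[OF al] e[OF ah]
      by (rule nn_integral_cong_AE, use gap in eventually_elim)
        (use sub pos in \<open>auto split: split_indicator\<close>)
    then show ?thesis
      unfolding measure_distr[OF Tma(1) that(1)] measure_distr[OF Tma(2) that(1)]
      by (simp add: measure_def \<mu>a_def \<mu>b_def)
  qed
  have "distr \<mu>a borel T = \<sigma>"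
  proof (rule open_measure_eq)
    show "finite_measure (distr \<mu>a borel T)" by (rule finite_measure.finite_measure_distr[OF fin(1) Tma(1)])
    fix U :: "(real \<times> real) set" assume U: "open U"
    \<comment> \<open>Passing to \<open>V\<close> costs \<open>\<sigma>\<close> nothing and discards the gradients coming from ambiguous
      columns.\<close>
    define V where "V = U \<inter> {q. 0 < snd q}"
    have V: "open V" unfolding V_def by (intro open_Int U open_Collect_less continuous_intros)
    interpret \<nu>: finite_measure "distr \<mu>a borel T" by (rule finite_measure.finite_measure_distr[OF fin(1) Tma(1)])
    have "measure \<sigma> U = measure \<sigma> V"
      using U V \<sigma>_pos by (intro \<sigma>.finite_measure_eq_AE) (auto simp: V_def)
    also have "\<dots> \<le> measure (distr \<mu>b borel T) V" by (rule le2[OF V])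
    also have "\<dots> = measure (distr \<mu>a borel T) V" using V by (intro eq) (auto simp: V_def)
    also have "\<dots> \<le> measure (distr \<mu>a borel T) U" using U V by (intro \<nu>.finite_measure_mono) (auto simp: V_def)
    finally show "measure (distr \<mu>a borel T) U = measure \<sigma> U" using le1[OF U] by simp
  qed simp
  then show ?thesis by (simp add: \<mu>a_def T_def[abs_def] p_def)
qed

end

section \<open>Existence of dual maximizers\<close>

lemma legendre_legendre_le:
  assumes "compact Q" "continuous_on Q \<psi>" "Q \<noteq> {}" "q \<in> Q" "X \<noteq> {}"
  shows "legendre X (legendre Q \<psi>) q \<le> \<psi> q"
proof (rule legendre_least[OF assms(5)])
  fix x assume "x \<in> X"
  show "q \<bullet> x - legendre Q \<psi> x \<le> \<psi> q"
    using legendre_ge[OF assms(1,2,4), of x] by (simp add: inner_commute)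
qed

text \<open>Transforming back over \<open>X\<close> gives a function below \<open>\<psi>\<close> on \<open>Q\<close>, whose transform is therefore
  not smaller; at points of \<open>X\<close> the definition of the transform over \<open>X\<close> gives the reverse
  inequality.\<close>

lemma legendre_biconjugate:
  assumes Q: "compact Q" "continuous_on Q \<psi>" "Q \<noteq> {}" and X: "compact X" "x \<in> X"
  shows "legendre Q (legendre X (legendre Q \<psi>)) x = legendre Q \<psi> x"
proof (rule antisym)
  have Xne: "X \<noteq> {}" using X by blast
  have pc: "continuous_on X (legendre Q \<psi>)" by (rule legendre_continuous[OF Q])
  have p2: "continuous_on Q (legendre X (legendre Q \<psi>))" by (rule legendre_continuous[OF X(1) pc Xne])
  show "legendre Q (legendre X (legendre Q \<psi>)) x \<le> legendre Q \<psi> x"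
  proof (rule legendre_least[OF Q(3)])
    fix q assume "q \<in> Q"
    show "x \<bullet> q - legendre X (legendre Q \<psi>) q \<le> legendre Q \<psi> x"
      using legendre_ge[OF X(1) pc X(2), of q] by (simp add: inner_commute)
  qed
  show "legendre Q \<psi> x \<le> legendre Q (legendre X (legendre Q \<psi>)) x"
    using legendre_antimono[OF Q(1) p2 Q(3), of \<psi> 0 x] legendre_legendre_le[OF Q _ Xne] by simp
qed

lemma (in params) min_energy_cong:
  assumes "pot p" "pot p'" "\<And>s. 0 \<le> s \<Longrightarrow> s < smax \<Longrightarrow> p (s, y) = p' (s, y)"
  shows "min_energy p y = min_energy p' y"
proof -
  have "min_energy p y \<le> min_energy p' y" if "pot p" "pot p'" "\<And>s. 0 \<le> s \<Longrightarrow> s < smax \<Longrightarrow> p (s, y) = p' (s, y)" for p p'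
  proof -
    have a: "lowest p' y \<in> minimizers p' y" by (rule lowest_highest(1)[OF that(2)])
    then have "lowest p' y < smax" by (simp add: minimizers_def)
    then show ?thesis using min_energy_cmp[OF that(1,2) a, of y 0] that(3) by force
  qed
  from this[of p p'] this[of p' p] assms show ?thesis by force
qed

text \<open>The set \<open>X\<close> contains all slope points that occur; transforming twice, over \<open>Q\<close> and over \<open>X\<close>,
  improves the dual functional and yields functions with a common Lipschitz constant.\<close>

locale dual_X = dual +
  fixes X :: "(real \<times> real) set"
  assumes X_compact: "compact X" and X_nonneg: "\<And>x. x \<in> X \<Longrightarrow> 0 \<le> fst x \<and> 0 \<le> snd x"
    and X_to_slope: "\<And>s z. 0 \<le> s \<Longrightarrow> s < smax \<Longrightarrow> z \<in> {0..H} \<Longrightarrow> (s, slope z) \<in> X"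
begin

lemma X_ne: "X \<noteq> {}" using X_to_slope[of 0 0] smax_pos H_pos by auto

lemma dual_value_biconjugate:
  assumes \<psi>: "continuous_on Q \<psi>"
  shows "dual_value \<psi> \<le> dual_value (legendre X (legendre Q \<psi>))"
proof -
  have pc: "pot (legendre Q \<psi>)" by (rule legendre_continuous[OF Q_compact \<psi> Q_ne])
  have c2: "continuous_on A (legendre X (legendre Q \<psi>))" for A
    by (rule legendre_continuous[OF X_compact continuous_on_subset[OF pc] X_ne]) simp
  have "min_energy (legendre Q (legendre X (legendre Q \<psi>))) (slope z) = min_energy (legendre Q \<psi>) (slope z)" if "z \<in> {0..H}" for z
    using that by (intro min_energy_cong legendre_continuous Q_compact Q_ne c2 \<psi> legendre_biconjugate X_compact X_to_slope)
  then have "total_energy (legendre Q (legendre X (legendre Q \<psi>))) = total_energy (legendre Q \<psi>)"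
    unfolding total_energy_def by (intro set_lebesgue_integral_cong) auto
  moreover have "(LINT q:Q|\<sigma>. legendre X (legendre Q \<psi>) q) \<le> (LINT q:Q|\<sigma>. \<psi> q)"
    by (intro set_integral_mono \<sigma>_integrable c2 \<psi> legendre_legendre_le Q_compact Q_ne X_ne)
  ultimately show ?thesis by (simp add: dual_value_def)
qed

lemma total_energy_le:
  assumes "set_integrable lborel {0..H} (\<lambda>z. min_energy p (slope z))"
    "\<And>z. z \<in> {0..H} \<Longrightarrow> min_energy p (slope z) \<le> c"
  shows "total_energy p \<le> H * c"
proof -
  have ic: "set_integrable lborel {0..H} (\<lambda>_. c)"
    by (rule borel_integrable_atLeastAtMost') simp
  have "total_energy p \<le> (LINT z:{0..H}|lborel. c)"
    unfolding total_energy_def by (intro set_integral_mono assms ic)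
  also have "\<dots> = H * c" using H_pos by (simp add: set_lebesgue_integral_def)
  finally show ?thesis .
qed

lemma \<sigma>_integral_ge:
  fixes \<psi> :: "real \<times> real \<Rightarrow> real"
  assumes \<psi>: "continuous_on Q \<psi>" and c: "\<And>q. q \<in> Q \<Longrightarrow> c \<le> \<psi> q"
  shows "c \<le> (LINT q:Q|\<sigma>. \<psi> q)"
proof -
  have "c = (LINT q|\<sigma>. c)" using \<sigma>.prob_space by simp
  also have "\<dots> = (LINT q:Q|\<sigma>. c)"
    unfolding set_lebesgue_integral_def
  proof (rule integral_cong_AE)
    show "AE q in \<sigma>. c = indicator Q q *\<^sub>R c" using \<sigma>_Q by eventually_elim simp
  qed simp_all
  also have "\<dots> \<le> (LINT q:Q|\<sigma>. \<psi> q)" by (intro set_integral_mono \<sigma>_integrable \<psi> continuous_on_const c)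
  finally show ?thesis .
qed

text \<open>A large minimum of \<open>\<psi>\<close> is penalized by the integral against \<open>\<sigma>\<close>, as minimal energies
  are nonpositive. A very negative minimum raises the potential everywhere and is penalized
  through the columns: filling all of them to a common height of total mass at least two beats the
  gain from \<open>\<sigma>\<close>, which has mass one.\<close>

lemma dual_value_coercive:
  obtains C where "\<And>\<psi> q0. continuous_on Q \<psi> \<Longrightarrow> q0 \<in> Q \<Longrightarrow> (\<And>q. q \<in> Q \<Longrightarrow> \<psi> q0 \<le> \<psi> q) \<Longrightarrow>
     dual_value \<psi> \<le> C \<and> \<bar>\<psi> q0\<bar> \<le> \<bar>dual_value \<psi>\<bar> + C" "C \<ge> 0"
proof -
  obtain r where r: "0 \<le> r" "r < smax" "mass r \<ge> 2 / H" using mass_unbounded by blast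
  define C0 where "C0 = integral {0..r} (\<lambda>s. f0 r\<^sub>0 \<Omega> s * weight s)"
  have fi: "(\<lambda>s. f0 r\<^sub>0 \<Omega> s * weight s) integrable_on {0..r}"
    using energy_integrable[of "\<lambda>_. 0" r 0 0] r by simp
  have *: "dual_value \<psi> \<le> H * \<bar>C0\<bar> \<and> \<bar>\<psi> q0\<bar> \<le> \<bar>dual_value \<psi>\<bar> + H * \<bar>C0\<bar>"
    if \<psi>: "continuous_on Q \<psi>" and q0: "q0 \<in> Q" "\<And>q. q \<in> Q \<Longrightarrow> \<psi> q0 \<le> \<psi> q" for \<psi> q0
  proof -
    define p where "p = legendre Q \<psi>"
    define m where "m = \<psi> q0"
    have pc: "column_convex p" unfolding p_def by (rule legendre_col[OF \<psi>])
    note pp = column_convexD(1)[OF pc]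
    have hi: "set_integrable lborel {0..H} (\<lambda>z. min_energy p (slope z))"
      unfolding p_def by (rule min_energy_legendre_integrable[OF \<psi>])
    have m: "m \<le> (LINT q:Q|\<sigma>. \<psi> q)" unfolding m_def by (rule \<sigma>_integral_ge[OF \<psi> q0(2)])
    have low: "p x \<ge> - m" if "x \<in> X" for x
    proof -
      have "0 \<le> x \<bullet> q0" using X_nonneg[OF that] Q_nonneg[OF q0(1)] by (simp add: inner_prod_def)
      then show ?thesis using legendre_ge[OF Q_compact \<psi> q0(1), of x] by (simp add: p_def m_def)
    qed
    have "total_energy p \<le> H * 0" by (rule total_energy_le[OF hi min_energy_nonpos[OF pp]])
    then have J1: "dual_value \<psi> \<le> - m" using m by (simp add: dual_value_def p_def)
    have "total_energy p \<le> H * (C0 + m * mass r)"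
    proof (rule total_energy_le[OF hi])
      fix z assume z: "z \<in> {0..H}"
      have "min_energy p (slope z) \<le> energy p (slope z) r" by (rule min_energy_le[OF pp r(1,2)])
      also have "\<dots> \<le> integral {0..r} (\<lambda>s. f0 r\<^sub>0 \<Omega> s * weight s + m * weight s)"
        unfolding energy_def
      proof (intro integral_le energy_integrable pp r Henstock_Kurzweil_Integration.integrable_add fi integrable_on_mult_right weight_integrable)
        fix s assume s: "s \<in> {0..r}"
        then have "- m \<le> p (s, slope z)" using r z by (intro low X_to_slope) auto
        then have "(f0 r\<^sub>0 \<Omega> s - p (s, slope z)) * weight s \<le> (f0 r\<^sub>0 \<Omega> s + m) * weight s"
          by (intro mult_right_mono weight_nonneg) simp
        then show "(f0 r\<^sub>0 \<Omega> s - p (s, slope z)) * weight s \<le> f0 r\<^sub>0 \<Omega> s * weight s + m * weight s"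
          by (simp add: algebra_simps)
      qed
      also have "\<dots> = C0 + m * mass r"
        unfolding C0_def mass_def using fi weight_integrable[OF r(2)]
        by (subst Henstock_Kurzweil_Integration.integral_add) (auto intro!: integrable_on_mult_right)
      finally show "min_energy p (slope z) \<le> C0 + m * mass r" .
    qed
    then have J2: "dual_value \<psi> \<le> H * C0 + m * (H * mass r - 1)" using m by (simp add: dual_value_def p_def algebra_simps)
    have HM: "H * mass r - 1 \<ge> 1" using r(3) H_pos by (simp add: field_simps)
    have CC: "H * C0 \<le> H * \<bar>C0\<bar>" "H * \<bar>C0\<bar> \<ge> 0" using H_pos by (auto intro: mult_left_mono)
    show ?thesis
    proof (cases "m \<ge> 0")
      case True then show ?thesis using J1 CC by (auto simp: m_def[symmetric])
    next
      case False
      then have "m * (H * mass r - 1) \<le> m * 1" using HM by (intro mult_left_mono_neg) auto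
      then have "dual_value \<psi> \<le> H * \<bar>C0\<bar> + m" using J2 CC by linarith
      then show ?thesis using False by (auto simp: m_def[symmetric])
    qed
  qed
  show thesis
    by (rule that[of "H * \<bar>C0\<bar>"]) (use * H_pos in auto)
qed

text \<open>Double transforms of a maximizing sequence are bounded and equi-Lipschitz, so a subsequence
  converges uniformly; the dual functional is upper semicontinuous, because optimal heights for
  the limit are competitors along the sequence.\<close>

theorem dual_optimal_exists: "\<exists>\<psi>. dual_optimal \<psi>"
proof -
  obtain C where C: "\<And>\<psi> q0. continuous_on Q \<psi> \<Longrightarrow> q0 \<in> Q \<Longrightarrow> (\<And>q. q \<in> Q \<Longrightarrow> \<psi> q0 \<le> \<psi> q) \<Longrightarrow>
     dual_value \<psi> \<le> C \<and> \<bar>\<psi> q0\<bar> \<le> \<bar>dual_value \<psi>\<bar> + C" "C \<ge> 0" by (rule dual_value_coercive) blast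
  have min_ex: "\<exists>q0\<in>Q. \<forall>q\<in>Q. \<psi> q0 \<le> \<psi> q" if "continuous_on Q \<psi>" for \<psi> :: "real \<times> real \<Rightarrow> real"
    using continuous_attains_inf[OF Q_compact Q_ne that] .
  define V where "V = dual_value ` {\<psi>. continuous_on Q \<psi>}"
  have Vb: "bdd_above V"
  proof (rule bdd_aboveI[of _ C])
    fix v assume "v \<in> V"
    then obtain \<psi> where "continuous_on Q \<psi>" "v = dual_value \<psi>" by (auto simp: V_def)
    then show "v \<le> C" using min_ex[of \<psi>] C(1)[of \<psi>] by blast
  qed
  have Vne: "V \<noteq> {}" using continuous_on_const by (auto simp: V_def)
  define S where "S = Sup V"
  have "\<exists>\<psi>. continuous_on Q \<psi> \<and> dual_value \<psi> > S - 1 / real (Suc n)" for n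
  proof -
    have "S - 1 / real (Suc n) < Sup V" by (simp add: S_def)
    from less_cSupD[OF Vne this] show ?thesis by (auto simp: V_def)
  qed
  then obtain f where f: "\<And>n. continuous_on Q (f n)" "\<And>n. dual_value (f n) > S - 1 / real (Suc n)" by metis
  define g where "g n = legendre X (legendre Q (f n))" for n
  have lc: "continuous_on A (legendre Q (f n))" for A n by (rule legendre_continuous[OF Q_compact f(1) Q_ne])
  have gc: "continuous_on A (g n)" for A n unfolding g_def by (rule legendre_continuous[OF X_compact lc X_ne])
  have gJ: "dual_value (g n) > S - 1 / real (Suc n)" for n
    using dual_value_biconjugate[OF f(1), of n] f(2)[of n] by (simp add: g_def)
  have gS: "dual_value (g n) \<le> S" for n
    unfolding S_def by (rule cSup_upper[OF _ Vb]) (use gc in \<open>auto simp: V_def\<close>)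
  obtain R where R: "\<And>x. x \<in> X \<Longrightarrow> norm x \<le> R"
    using compact_imp_bounded[OF X_compact] by (auto simp: bounded_iff)
  have R0: "R \<ge> 0" using R X_ne norm_ge_zero order_trans by blast
  have glip: "\<bar>g n x - g n y\<bar> \<le> R * norm (x - y)" for n x y
    unfolding g_def by (rule legendre_lipschitz[OF X_compact lc X_ne R])
  obtain L where L: "\<And>q. q \<in> Q \<Longrightarrow> norm q \<le> L" "0 \<le> L" by (rule Q_norm_bound) blast
  \<comment> \<open>Coercivity bounds the minimum, the Lipschitz constant bounds the oscillation over \<open>Q\<close>.\<close>
  define K where "K = \<bar>S\<bar> + 1 + C + R * (2 * L)"
  have gb: "norm (g n q) \<le> K" if q: "q \<in> Q" for n q
  proof -
    obtain q0 where q0: "q0 \<in> Q" "\<And>q. q \<in> Q \<Longrightarrow> g n q0 \<le> g n q" using min_ex[OF gc] by blast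
    have "1 / real (Suc n) \<le> 1" by simp
    then have "\<bar>dual_value (g n)\<bar> \<le> \<bar>S\<bar> + 1" using gJ[of n] gS[of n] by linarith
    then have "\<bar>g n q0\<bar> \<le> \<bar>S\<bar> + 1 + C" using C(1)[OF gc q0] by linarith
    moreover have "\<bar>g n q - g n q0\<bar> \<le> R * (2 * L)"
    proof -
      have "norm (q - q0) \<le> 2 * L" using norm_triangle_ineq4[of q q0] L(1)[OF q] L(1)[OF q0(1)] by linarith
      then have "R * norm (q - q0) \<le> R * (2 * L)" using R0 by (intro mult_left_mono)
      then show ?thesis using glip[of n q q0] by linarith
    qed
    ultimately show ?thesis by (simp add: K_def)
  qed
  have equi: "\<exists>d>0. \<forall>n y. y \<in> Q \<and> norm (x - y) < d \<longrightarrow> norm (g n x - g n y) < e" if "x \<in> Q" "0 < e" for x e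
  proof (intro exI[of _ "e / (R + 1)"] conjI allI impI)
    show "0 < e / (R + 1)" using that R0 by simp
    fix n y assume "y \<in> Q \<and> norm (x - y) < e / (R + 1)"
    then have "(R + 1) * norm (x - y) < e" using R0 by (simp add: field_simps)
    moreover have "R * norm (x - y) \<le> (R + 1) * norm (x - y)" by (intro mult_right_mono) auto
    ultimately show "norm (g n x - g n y) < e" using glip[of n x y] by simp
  qed
  obtain h k where h: "continuous_on Q h" "strict_mono (k :: nat \<Rightarrow> nat)"
    "\<And>e. 0 < e \<Longrightarrow> \<exists>N. \<forall>n x. n \<ge> N \<and> x \<in> Q \<longrightarrow> norm (g (k n) x - h x) < e"
    using Arzela_Ascoli[OF Q_compact gb equi] by metis
  define p_lim where "p_lim = legendre Q h"
  have pc: "column_convex p_lim" unfolding p_lim_def by (rule legendre_col[OF h(1)])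
  note pp = column_convexD(1)[OF pc]
  obtain t where t: "0 < t" "t < smax" "\<And>z. z \<in> {0..H} \<Longrightarrow> minimizers p_lim (slope z) \<subseteq> {0..t}"
    by (rule minimizers_column_bound[OF pc]) blast
  have mt: "mass t \<ge> 0" by (rule mass_nonneg[OF t(2)])
  have close: "dual_value (g n) \<le> dual_value h + e * (1 + H * mass t)"
    if e: "e > 0" "\<And>q. q \<in> Q \<Longrightarrow> \<bar>g n q - h q\<bar> \<le> e" for n e
  proof -
    define pg where "pg = legendre Q (g n)"
    have pgc: "column_convex pg" unfolding pg_def by (rule legendre_col[OF gc])
    have d: "\<bar>pg x - p_lim x\<bar> \<le> e" for x
    proof -
      have "p_lim x \<le> pg x + e" unfolding pg_def p_lim_def
        by (rule legendre_antimono[OF Q_compact gc Q_ne]) (use e(2) in force)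
      moreover have "pg x \<le> p_lim x + e" unfolding pg_def p_lim_def
        by (rule legendre_antimono[OF Q_compact h(1) Q_ne]) (use e(2) in force)
      ultimately show ?thesis by linarith
    qed
    have "min_energy pg (slope z) \<le> min_energy p_lim (slope z) + e * mass t" if z: "z \<in> {0..H}" for z
    proof -
      have a: "lowest p_lim (slope z) \<in> minimizers p_lim (slope z)" by (rule lowest_highest(1)[OF pp])
      have "min_energy pg (slope z) \<le> min_energy p_lim (slope z) + e * mass (lowest p_lim (slope z))"
        using d by (intro min_energy_cmp[OF column_convexD(1)[OF pgc] pp a]) (simp add: abs_minus_commute)
      also have "e * mass (lowest p_lim (slope z)) \<le> e * mass t"
        using subsetD[OF t(3)[OF z] a] t e by (intro mult_left_mono mass_mono) auto
      finally show ?thesis by simp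
    qed
    then have "total_energy pg \<le> (LINT z:{0..H}|lborel. min_energy p_lim (slope z) + e * mass t)"
      unfolding total_energy_def using min_energy_legendre_integrable[OF gc[of Q n]] min_energy_legendre_integrable[OF h(1)]
      by (intro set_integral_mono set_integral_add(1)) (auto simp: pg_def p_lim_def intro!: borel_integrable_atLeastAtMost')
    also have "\<dots> = total_energy p_lim + H * (e * mass t)"
    proof -
      have "set_integrable lborel {0..H} (\<lambda>_. e * mass t)" by (rule borel_integrable_atLeastAtMost') simp
      from set_integral_add(2)[OF min_energy_legendre_integrable[OF h(1)] this]
      show ?thesis using H_pos by (simp add: total_energy_def p_lim_def set_lebesgue_integral_def)
    qed
    finally have 1: "total_energy pg \<le> total_energy p_lim + H * (e * mass t)" .
    have "- e \<le> (LINT q:Q|\<sigma>. g n q - h q)"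
      by (rule \<sigma>_integral_ge) (use e(2) in \<open>force intro!: continuous_intros gc h(1) simp: abs_le_iff\<close>)+
    also have "\<dots> = (LINT q:Q|\<sigma>. g n q) - (LINT q:Q|\<sigma>. h q)"
      by (intro set_integral_diff(2) \<sigma>_integrable gc h(1))
    finally show ?thesis using 1 by (simp add: dual_value_def pg_def p_lim_def algebra_simps)
  qed
  have "S \<le> dual_value h"
  proof (rule field_le_epsilon)
    fix d :: real assume d: "d > 0"
    define c where "c = 1 + H * mass t"
    have c: "c > 0" using mt H_pos by (simp add: c_def add_pos_nonneg)
    define e where "e = d / 2 / c"
    have e: "e > 0" "e * c = d / 2" using c d by (auto simp: e_def)
    obtain N where N: "\<And>n x. n \<ge> N \<Longrightarrow> x \<in> Q \<Longrightarrow> \<bar>g (k n) x - h x\<bar> < e" using h(3)[OF e(1)] by force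
    obtain M :: nat where M: "1 / real (Suc M) < d / 2" using nat_approx_posE[of "d / 2"] d by auto
    define n where "n = max N M"
    have "M \<le> k n" using seq_suble[OF h(2), of n] by (simp add: n_def)
    then have "1 / real (Suc (k n)) \<le> 1 / real (Suc M)" by (intro divide_left_mono) auto
    moreover have "dual_value (g (k n)) \<le> dual_value h + e * c"
      unfolding c_def by (rule close[OF e(1)]) (use N in \<open>auto simp: n_def intro: less_imp_le\<close>)
    ultimately show "S \<le> dual_value h + d" using gJ[of "k n"] M e(2) by linarith
  qed
  moreover have "dual_value \<psi> \<le> S" if "continuous_on Q \<psi>" for \<psi>
    unfolding S_def by (rule cSup_upper[OF _ Vb]) (use that in \<open>auto simp: V_def\<close>)
  ultimately show ?thesis using h(1) unfolding dual_optimal_def by (intro exI[of _ h]) (auto intro: order_trans)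
qed

end

section \<open>The primal functional\<close>

lemma norm_diff_sq: "(norm (x - y))\<^sup>2 = (norm x)\<^sup>2 + (norm y)\<^sup>2 - 2 * (x \<bullet> (y :: 'a::real_inner))"
  by (simp add: power2_norm_eq_inner inner_diff_left inner_diff_right inner_commute)

lemma ext_integral_real:
  assumes "set_integrable M A f"
  shows "ext_integral M A f = ereal (LINT x:A|M. f x)"
proof -
  define g where "g x = indicator A x *\<^sub>R f x" for x
  have g: "integrable M g" using assms by (simp add: g_def[abs_def] set_integrable_def)
  have 1: "(\<integral>\<^sup>+x\<in>A. ennreal (f x) \<partial>M) = (\<integral>\<^sup>+x. ennreal (g x) \<partial>M)"
    "(\<integral>\<^sup>+x\<in>A. ennreal (- f x) \<partial>M) = (\<integral>\<^sup>+x. ennreal (- g x) \<partial>M)"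
    by (intro nn_integral_cong; auto simp: g_def split: split_indicator)+
  have fin: "(\<integral>\<^sup>+x. ennreal (g x) \<partial>M) < \<infinity>" "(\<integral>\<^sup>+x. ennreal (- g x) \<partial>M) < \<infinity>"
    using g unfolding real_integrable_def by (auto simp: less_top)
  have "ereal (LINT x|M. g x) = ereal (enn2real (\<integral>\<^sup>+x. ennreal (g x) \<partial>M)) - ereal (enn2real (\<integral>\<^sup>+x. ennreal (- g x) \<partial>M))"
    using real_lebesgue_integral_def[OF g] by simp
  also have "\<dots> = enn2ereal (\<integral>\<^sup>+x. ennreal (g x) \<partial>M) - enn2ereal (\<integral>\<^sup>+x. ennreal (- g x) \<partial>M)"
    using fin by (metis ennreal_enn2real enn2ereal_ennreal enn2real_nonneg infinity_ennreal_def)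
  finally show ?thesis unfolding ext_integral_def 1 by (simp add: g_def[abs_def] set_lebesgue_integral_def)
qed

lemma ext_integral_mono:
  assumes "AE x in M. x \<in> A \<longrightarrow> g x \<le> f x"
  shows "ext_integral M A g \<le> ext_integral M A f"
  unfolding ext_integral_def
proof (intro ereal_minus_mono)
  show "enn2ereal (\<integral>\<^sup>+x\<in>A. ennreal (g x) \<partial>M) \<le> enn2ereal (\<integral>\<^sup>+x\<in>A. ennreal (f x) \<partial>M)"
    unfolding less_eq_ennreal.rep_eq[symmetric]
    by (rule nn_integral_mono_AE, use assms in eventually_elim) (auto intro: ennreal_leI split: split_indicator)
  show "enn2ereal (\<integral>\<^sup>+x\<in>A. ennreal (- f x) \<partial>M) \<le> enn2ereal (\<integral>\<^sup>+x\<in>A. ennreal (- g x) \<partial>M)"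
    unfolding less_eq_ennreal.rep_eq[symmetric]
    by (rule nn_integral_mono_AE, use assms in eventually_elim) (auto intro: ennreal_leI split: split_indicator)
qed

lemma ext_integral_cong:
  assumes "AE x in M. x \<in> A \<longrightarrow> g x = f x"
  shows "ext_integral M A g = ext_integral M A f"
  by (intro antisym ext_integral_mono; use assms in eventually_elim) auto

lemma integral_le_nn_integral:
  assumes "integrable M u" "AE x in M. u x \<le> v x"
  shows "ennreal (LINT x|M. u x) \<le> (\<integral>\<^sup>+x. ennreal (v x) \<partial>M)"
proof -
  have i: "integrable M (\<lambda>x. max (u x) 0)" using assms by auto
  have "ennreal (LINT x|M. u x) \<le> ennreal (LINT x|M. max (u x) 0)"
    by (intro ennreal_leI integral_mono assms i) auto
  also have "\<dots> = (\<integral>\<^sup>+x. ennreal (max (u x) 0) \<partial>M)"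
    by (rule nn_integral_eq_integral[OF i, symmetric]) auto
  also have "\<dots> = (\<integral>\<^sup>+x. ennreal (u x) \<partial>M)" by (intro nn_integral_cong) (auto simp: max_def ennreal_neg)
  also have "\<dots> \<le> (\<integral>\<^sup>+x. ennreal (v x) \<partial>M)"
    by (rule nn_integral_mono_AE, use assms(2) in eventually_elim) (rule ennreal_leI)
  finally show ?thesis .
qed

locale dual_theta = dual +
  fixes \<theta> :: "real \<Rightarrow> real"
  assumes slope_theta: "\<And>z. z \<in> {0..H} \<Longrightarrow> slope z = z / \<theta> z"
begin

definition half_moment :: real where "half_moment = (LINT q|\<sigma>. (norm q)\<^sup>2) / 2"

lemma \<sigma>_bounded_integrable:
  fixes h :: "real \<times> real \<Rightarrow> real"
  assumes "h \<in> borel_measurable borel" "\<And>q. q \<in> Q \<Longrightarrow> \<bar>h q\<bar> \<le> C"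
  shows "integrable \<sigma> h"
proof (rule \<sigma>.integrable_const_bound[of _ C])
  show "AE x in \<sigma>. norm (h x) \<le> C" using \<sigma>_Q by eventually_elim (simp add: assms)
  show "h \<in> borel_measurable \<sigma>" using assms(1) unfolding measurable_cong_sets[OF \<sigma>_sets refl] .
qed

lemma norm_sq_borel [measurable]: "(\<lambda>q::real \<times> real. (norm q)\<^sup>2) \<in> borel_measurable borel"
  by (intro borel_measurable_continuous_onI continuous_intros)

lemma norm_sq_integrable: "integrable \<sigma> (\<lambda>q. (norm q)\<^sup>2)"
proof -
  obtain L where L: "\<And>q. q \<in> Q \<Longrightarrow> norm q \<le> L" "0 \<le> L" by (rule Q_norm_bound) blast
  show ?thesis
    by (rule \<sigma>_bounded_integrable[of _ "L\<^sup>2", OF norm_sq_borel]) (use L in \<open>auto intro: power_mono\<close>)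
qed

lemma second_moment_eq: "second_moment \<sigma> = ereal half_moment"
proof -
  have "(\<integral>\<^sup>+q. ennreal ((norm q)\<^sup>2) \<partial>\<sigma>) = ennreal (LINT q|\<sigma>. (norm q)\<^sup>2)"
    by (rule nn_integral_eq_integral[OF norm_sq_integrable]) auto
  then show ?thesis unfolding second_moment_def half_moment_def by (simp add: enn2ereal_ennreal)
qed

lemma f_map_eq: "f_map H \<theta> = (\<lambda>x. if snd x \<in> {0..H} then to_slope x else 0)"
  by (auto simp: f_map_def to_slope_def slope_theta fun_eq_iff)

lemma f_map_borel [measurable]: "f_map H \<theta> \<in> borel \<rightarrow>\<^sub>M borel"
proof -
  have s: "snd \<in> borel \<rightarrow>\<^sub>M (borel :: real measure)" for x :: "(real \<times> real) measure"
    by (intro borel_measurable_continuous_onI continuous_intros)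
  have "Measurable.pred borel (\<lambda>x::real \<times> real. snd x \<in> {0..H})"
    by (rule measurable_compose[OF s]) measurable
  then show ?thesis unfolding f_map_eq by (intro measurable_If) auto
qed

text \<open>Members of \<open>R0_set\<close> are Borel on \<open>{0..H}\<close> only; profiles are Borel on all reals. Each member of
  \<open>R0_set\<close> agrees on \<open>{0..H}\<close> with a profile.\<close>

definition profile :: "(real \<Rightarrow> real) \<Rightarrow> bool" where
  "profile \<rho> \<longleftrightarrow> \<rho> \<in> borel_measurable borel \<and> (\<forall>z\<in>{0..H}. 0 \<le> \<rho> z \<and> \<rho> z < smax) \<and> prob_space (mu r\<^sub>0 H \<Omega> \<rho>)"

lemma profileD:
  assumes "profile \<rho>"
  shows "\<rho> \<in> borel_measurable borel" "z \<in> {0..H} \<Longrightarrow> 0 \<le> \<rho> z" "z \<in> {0..H} \<Longrightarrow> \<rho> z < smax" "prob_space (mu r\<^sub>0 H \<Omega> \<rho>)"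
  using assms by (auto simp: profile_def)

lemma profile_R0: "profile \<rho> \<Longrightarrow> \<rho> \<in> R0_set r\<^sub>0 H \<Omega>"
  by (auto simp: profile_def R0_set_def R_set_def smax_def intro: measurable_restrict_space1)

lemma R0_profile:
  assumes "\<rho> \<in> R0_set r\<^sub>0 H \<Omega>"
  obtains \<rho>' where "profile \<rho>'" "\<And>z. z \<in> {0..H} \<Longrightarrow> \<rho>' z = \<rho> z" "mu r\<^sub>0 H \<Omega> \<rho>' = mu r\<^sub>0 H \<Omega> \<rho>"
proof -
  define \<rho>' where "\<rho>' z = \<rho> z * indicator {0..H} z" for z
  have e: "\<rho>' z = \<rho> z" if "z \<in> {0..H}" for z using that by (simp add: \<rho>'_def)
  have "\<rho> \<in> borel_measurable (restrict_space borel {0..H})" using assms by (simp add: R0_set_def R_set_def)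
  then have b: "\<rho>' \<in> borel_measurable borel"
    unfolding \<rho>'_def[abs_def] by (subst (asm) borel_measurable_restrict_space_iff) (auto simp: mult.commute)
  have m: "mu r\<^sub>0 H \<Omega> \<rho>' = mu r\<^sub>0 H \<Omega> \<rho>" proof -
    have "D_set H \<rho>' = D_set H \<rho>" by (rule D_set_cong) (rule e)
    then show ?thesis by (simp add: mu_def)
  qed
  have "profile \<rho>'"
    using assms b e m unfolding profile_def by (auto simp: R0_set_def R_set_def smax_def)
  then show thesis using e m by (rule that)
qed

lemma K_fun_mu_cong:
  assumes "\<rho> \<in> R0_set r\<^sub>0 H \<Omega>" "\<rho>' \<in> R0_set r\<^sub>0 H \<Omega>" "mu r\<^sub>0 H \<Omega> \<rho> = mu r\<^sub>0 H \<Omega> \<rho>'"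
  shows "K_fun r\<^sub>0 H \<Omega> \<theta> \<sigma> \<rho> = K_fun r\<^sub>0 H \<Omega> \<theta> \<sigma> \<rho>'"
  unfolding K_fun_def using assms by simp

lemma AE_profile:
  assumes "profile \<rho>"
  shows "AE x in mu r\<^sub>0 H \<Omega> \<rho>. x \<in> D_set H \<rho> \<and> snd x \<in> {0..H} \<and> 0 \<le> fst x \<and> fst x < smax"
  using profileD[OF assms] by (intro AE_mu_lborel AE_I2) (auto simp: D_set_def intro: le_less_trans)

lemma to_slope_bound:
  obtains C where "\<And>x. 0 \<le> fst x \<Longrightarrow> fst x < smax \<Longrightarrow> snd x \<in> {0..H} \<Longrightarrow> norm (to_slope x) \<le> C" "0 \<le> C"
proof -
  have "compact (to_slope ` ({0..smax} \<times> {0..H}))"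
    by (intro compact_continuous_image continuous_on_subset[OF to_slope_cont] compact_Times) auto
  from compact_imp_bounded[OF this]
  obtain C where C: "\<And>x. x \<in> {0..smax} \<times> {0..H} \<Longrightarrow> norm (to_slope x) \<le> C"
    unfolding bounded_iff by blast
  have "norm (to_slope (0, 0)) \<le> C" using smax_pos H_pos by (intro C) auto
  then have "0 \<le> C" using norm_ge_zero order_trans by blast
  with C show thesis by (intro that[of C]) (auto simp: mem_Times_iff)
qed

lemma p_to_slope_integrable:
  assumes "profile \<rho>" "pot h0"
  shows "integrable (mu r\<^sub>0 H \<Omega> \<rho>) (\<lambda>x. h0 (to_slope x))"
proof -
  interpret prob_space "mu r\<^sub>0 H \<Omega> \<rho>" using profileD(4)[OF assms(1)] .
  have "compact ((\<lambda>x. h0 (to_slope x)) ` ({0..smax} \<times> {0..H}))"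
    by (intro compact_continuous_image compact_Times continuous_on_compose2[OF assms(2) continuous_on_subset[OF to_slope_cont]]) auto
  from compact_imp_bounded[OF this]
  obtain C where C: "\<And>x. x \<in> {0..smax} \<times> {0..H} \<Longrightarrow> \<bar>h0 (to_slope x)\<bar> \<le> C"
    unfolding bounded_iff real_norm_def by blast
  show ?thesis
  proof (rule integrable_const_bound[of _ C])
    show "AE x in mu r\<^sub>0 H \<Omega> \<rho>. norm (h0 (to_slope x)) \<le> C"
      using AE_profile[OF assms(1)] by eventually_elim (use C in \<open>auto simp: mem_Times_iff\<close>)
    show "(\<lambda>x. h0 (to_slope x)) \<in> borel_measurable (mu r\<^sub>0 H \<Omega> \<rho>)"
      by (simp add: measurable_compose[OF to_slope_borel borel_measurable_continuous_onI[OF assms(2)]])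
  qed
qed

lemma f0_fst_borel [measurable]: "(\<lambda>x::real \<times> real. f0 r\<^sub>0 \<Omega> (fst x)) \<in> borel_measurable borel"
  by (rule measurable_compose[OF _ f0_borel]) (intro borel_measurable_continuous_onI continuous_intros)

definition external_energy :: "real \<times> real \<Rightarrow> real" where
  "external_energy x = f0 r\<^sub>0 \<Omega> (fst x) - (norm (to_slope x))\<^sup>2 / 2"

lemma to_slope_norm_integrable:
  assumes "profile \<rho>" shows "integrable (mu r\<^sub>0 H \<Omega> \<rho>) (\<lambda>x. (norm (to_slope x))\<^sup>2)"
  by (rule p_to_slope_integrable[OF assms]) (intro continuous_intros)

lemma ext_external_energy:
  assumes "profile \<rho>"
  shows "ext_integral (mu r\<^sub>0 H \<Omega> \<rho>) (W_set r\<^sub>0 H) (\<lambda>(s, z). f0 r\<^sub>0 \<Omega> s - (s\<^sup>2 + z\<^sup>2 / (\<theta> z)\<^sup>2) / 2)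
    = ext_integral (mu r\<^sub>0 H \<Omega> \<rho>) UNIV external_energy"
proof -
  have "ext_integral (mu r\<^sub>0 H \<Omega> \<rho>) (W_set r\<^sub>0 H) (\<lambda>(s, z). f0 r\<^sub>0 \<Omega> s - (s\<^sup>2 + z\<^sup>2 / (\<theta> z)\<^sup>2) / 2)
    = ext_integral (mu r\<^sub>0 H \<Omega> \<rho>) (W_set r\<^sub>0 H) external_energy"
  proof (intro ext_integral_cong AE_I2 impI)
    fix x assume "x \<in> W_set r\<^sub>0 H"
    then show "(case x of (s, z) \<Rightarrow> f0 r\<^sub>0 \<Omega> s - (s\<^sup>2 + z\<^sup>2 / (\<theta> z)\<^sup>2) / 2) = external_energy x"
      by (auto simp: W_set_def external_energy_def to_slope_def slope_theta norm_Pair power_divide)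
  qed
  also have "\<dots> = ext_integral (mu r\<^sub>0 H \<Omega> \<rho>) UNIV external_energy"
  proof -
    have "AE x in mu r\<^sub>0 H \<Omega> \<rho>. x \<in> W_set r\<^sub>0 H"
      using AE_profile[OF assms] by eventually_elim (auto simp: W_set_def smax_def mem_Times_iff)
    then have "(\<integral>\<^sup>+x\<in>W_set r\<^sub>0 H. F x \<partial>mu r\<^sub>0 H \<Omega> \<rho>) = (\<integral>\<^sup>+x\<in>UNIV. F x \<partial>mu r\<^sub>0 H \<Omega> \<rho>)" for F
      by (intro nn_integral_cong_AE) (auto elim!: eventually_mono)
    then show ?thesis unfolding ext_integral_def by simp
  qed
  finally show ?thesis .
qed

text \<open>The transport cost is nonnegative and the quadratic part of the external energy is bounded, so an
  infinite integral of \<open>f0\<close> dominates everything.\<close>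

lemma K_infinite:
  assumes \<rho>: "profile \<rho>" and inf: "\<not> integrable (mu r\<^sub>0 H \<Omega> \<rho>) (\<lambda>x. f0 r\<^sub>0 \<Omega> (fst x))"
  shows "K_fun r\<^sub>0 H \<Omega> \<theta> \<sigma> \<rho> = \<infinity>"
proof -
  interpret prob_space "mu r\<^sub>0 H \<Omega> \<rho>" using profileD(4)[OF \<rho>] .
  obtain C where C: "\<And>x. 0 \<le> fst x \<Longrightarrow> fst x < smax \<Longrightarrow> snd x \<in> {0..H} \<Longrightarrow> norm (to_slope x) \<le> C" "0 \<le> C"
    by (rule to_slope_bound) blast
  have A: "AE x in mu r\<^sub>0 H \<Omega> \<rho>. 0 < f0 r\<^sub>0 \<Omega> (fst x) \<and> (norm (to_slope x))\<^sup>2 / 2 \<le> C\<^sup>2"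
    using AE_profile[OF \<rho>]
  proof eventually_elim
    case (elim x)
    then have "(norm (to_slope x))\<^sup>2 \<le> C\<^sup>2" using C(1)[of x] by (intro power_mono) auto
    then have "(norm (to_slope x))\<^sup>2 / 2 \<le> C\<^sup>2" using zero_le_power2[of C] by linarith
    then show ?case using f0_pos[of "fst x"] elim by simp
  qed
  have top: "(\<integral>\<^sup>+x. ennreal (f0 r\<^sub>0 \<Omega> (fst x)) \<partial>mu r\<^sub>0 H \<Omega> \<rho>) = \<infinity>"
  proof (rule ccontr)
    assume "\<not> ?thesis"
    then have "integrable (mu r\<^sub>0 H \<Omega> \<rho>) (\<lambda>x. f0 r\<^sub>0 \<Omega> (fst x))"
      using A by (intro integrableI_nonneg) (auto simp: less_top elim: eventually_mono)
    then show False using inf by simp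
  qed
  have "(\<integral>\<^sup>+x. ennreal (f0 r\<^sub>0 \<Omega> (fst x)) \<partial>mu r\<^sub>0 H \<Omega> \<rho>)
     \<le> (\<integral>\<^sup>+x. ennreal (external_energy x) + ennreal (C\<^sup>2) \<partial>mu r\<^sub>0 H \<Omega> \<rho>)"
  proof (rule nn_integral_mono_AE, use A in eventually_elim)
    case (elim x)
    then have "ennreal (f0 r\<^sub>0 \<Omega> (fst x)) \<le> ennreal (max 0 (external_energy x) + C\<^sup>2)"
      by (intro ennreal_leI) (auto simp: external_energy_def)
    also have "\<dots> = ennreal (external_energy x) + ennreal (C\<^sup>2)"
      by (subst ennreal_plus) (auto simp: max_def ennreal_neg)
    finally show ?case .
  qed
  also have "\<dots> = (\<integral>\<^sup>+x. ennreal (external_energy x) \<partial>mu r\<^sub>0 H \<Omega> \<rho>) + ennreal (C\<^sup>2)"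
    using emeasure_space_1 by (subst nn_integral_add) (simp_all add: external_energy_def[abs_def])
  finally have 1: "(\<integral>\<^sup>+x. ennreal (external_energy x) \<partial>mu r\<^sub>0 H \<Omega> \<rho>) = \<infinity>"
    unfolding top by (auto simp: top_unique)
  have "(\<integral>\<^sup>+x. ennreal (- external_energy x) \<partial>mu r\<^sub>0 H \<Omega> \<rho>) \<le> (\<integral>\<^sup>+x. ennreal (C\<^sup>2) \<partial>mu r\<^sub>0 H \<Omega> \<rho>)"
    by (rule nn_integral_mono_AE, use A in eventually_elim) (auto intro!: ennreal_leI simp: external_energy_def)
  also have "\<dots> < \<infinity>" using emeasure_space_1 by simp
  finally have 2: "(\<integral>\<^sup>+x. ennreal (- external_energy x) \<partial>mu r\<^sub>0 H \<Omega> \<rho>) < \<infinity>" .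
  have "ext_integral (mu r\<^sub>0 H \<Omega> \<rho>) UNIV external_energy = \<infinity>"
    unfolding ext_integral_def using 1 2 by (cases "\<integral>\<^sup>+x. ennreal (- external_energy x) \<partial>mu r\<^sub>0 H \<Omega> \<rho>") auto
  then show ?thesis
    unfolding K_fun_def ext_external_energy[OF \<rho>] using profile_R0[OF \<rho>] by simp
qed

end

section \<open>Duality\<close>

context dual_theta
begin

lemma energy_fubini:
  assumes \<rho>: "profile \<rho>" and f: "integrable (mu r\<^sub>0 H \<Omega> \<rho>) (\<lambda>x. f0 r\<^sub>0 \<Omega> (fst x))" and p: "pot p"
  shows "set_integrable lborel {0..H} (\<lambda>z. energy p (slope z) (\<rho> z))"
    "(LINT x|(mu r\<^sub>0 H \<Omega> \<rho>). f0 r\<^sub>0 \<Omega> (fst x) - p (to_slope x)) = (LINT z:{0..H}|lborel. energy p (slope z) (\<rho> z))"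
proof -
  note [measurable] = profileD(1)[OF \<rho>]
  define F where "F x = f0 r\<^sub>0 \<Omega> (fst x) - p (to_slope x)" for x
  have Fm[measurable]: "F \<in> borel_measurable borel"
    unfolding F_def[abs_def]
    by (intro borel_measurable_diff f0_fst_borel measurable_compose[OF to_slope_borel borel_measurable_continuous_onI[OF p]])
  have Fi: "integrable (mu r\<^sub>0 H \<Omega> \<rho>) F"
    unfolding F_def by (intro Bochner_Integration.integrable_diff f p_to_slope_integrable \<rho> p)
  have e: "(LINT s:{0..\<rho> z}|lborel. F (s, z) * weight s) = energy p (slope z) (\<rho> z)" if "z \<in> {0..H}" for z
    using energy_lebesgue(2)[OF p profileD(3)[OF \<rho> that], of "slope z"] by (simp add: F_def to_slope_def)
  note I = integral_mu[OF profileD(1)[OF \<rho>] Fm Fi]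
  show "set_integrable lborel {0..H} (\<lambda>z. energy p (slope z) (\<rho> z))"
    using I(1) by (rule set_integrable_cong[THEN iffD1, rotated -1]) (auto simp: e)
  have "(LINT x|(mu r\<^sub>0 H \<Omega> \<rho>). F x) = (LINT z:{0..H}|lborel. energy p (slope z) (\<rho> z))"
    unfolding I(2) by (rule set_lebesgue_integral_cong) (auto simp: e)
  then show "(LINT x|(mu r\<^sub>0 H \<Omega> \<rho>). f0 r\<^sub>0 \<Omega> (fst x) - p (to_slope x)) = (LINT z:{0..H}|lborel. energy p (slope z) (\<rho> z))"
    by (simp add: F_def)
qed

lemma \<sigma>_indicator_integral:
  fixes \<psi> :: "real \<times> real \<Rightarrow> real"
  assumes \<psi>: "continuous_on Q \<psi>"
  shows "(\<lambda>q. indicator Q q * \<psi> q) \<in> borel_measurable borel"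
    "integrable \<sigma> (\<lambda>q. indicator Q q * \<psi> q)" "(LINT q|\<sigma>. indicator Q q * \<psi> q) = (LINT q:Q|\<sigma>. \<psi> q)"
  using borel_measurable_continuous_on_indicator[OF Q_borel \<psi>] \<sigma>_integrable[OF \<psi>]
  by (auto simp: set_integrable_def set_lebesgue_integral_def)

lemma f_map_AE: "profile \<rho> \<Longrightarrow> AE x in mu r\<^sub>0 H \<Omega> \<rho>. f_map H \<theta> x = to_slope x"
  by (rule eventually_mono[OF AE_profile]) (auto simp: f_map_eq)

text \<open>Expand the square and bound the mixed term \<open>x \<bullet> y\<close> by \<open>\<psi> x\<close> plus its transform at
  \<open>y\<close>; both terms depend on one marginal only.\<close>

lemma coupling_lower:
  assumes \<rho>: "profile \<rho>" and \<psi>: "continuous_on Q \<psi>"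
    and G: "G \<in> couplings \<sigma> (distr (mu r\<^sub>0 H \<Omega> \<rho>) borel (f_map H \<theta>))"
  shows "ennreal (2 * half_moment + (LINT x|(mu r\<^sub>0 H \<Omega> \<rho>). (norm (to_slope x))\<^sup>2) - 2 * (LINT q:Q|\<sigma>. \<psi> q)
      - 2 * (LINT x|(mu r\<^sub>0 H \<Omega> \<rho>). legendre Q \<psi> (to_slope x)))
     \<le> (\<integral>\<^sup>+(x, y). ennreal ((dist x y)\<^sup>2) \<partial>G)"
proof -
  define p where "p = legendre Q \<psi>"
  have pp: "pot p" unfolding p_def by (rule legendre_continuous[OF Q_compact \<psi> Q_ne])
  have pb: "p \<in> borel_measurable borel" by (rule borel_measurable_continuous_onI[OF pp])
  define \<mu> where "\<mu> = mu r\<^sub>0 H \<Omega> \<rho>"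
  define f where "f = f_map H \<theta>"
  have fm: "f \<in> \<mu> \<rightarrow>\<^sub>M borel" using f_map_borel by (simp add: f_def \<mu>_def)
  have Gs: "sets G = sets borel" and G1: "distr G borel fst = \<sigma>" and G2: "distr G borel snd = distr \<mu> borel f"
    using G unfolding couplings_def \<mu>_def f_def by auto
  have m1: "fst \<in> G \<rightarrow>\<^sub>M borel" and m2': "snd \<in> G \<rightarrow>\<^sub>M borel"
    unfolding measurable_cong_sets[OF Gs refl] by (intro borel_measurable_continuous_onI continuous_intros)+
  have i1: "integrable G (\<lambda>x. h (fst x))" "(LINT x|G. h (fst x)) = (LINT q|\<sigma>. h q)"
    if "h \<in> borel_measurable borel" "integrable \<sigma> h" for h :: "real \<times> real \<Rightarrow> real"
    using integrable_distr[OF m1, of h] integral_distr[OF m1 that(1)] that(2) unfolding G1 by auto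
  have i2: "integrable G (\<lambda>x. h (snd x))" "(LINT x|G. h (snd x)) = (LINT x|\<mu>. h (to_slope x))"
    if h: "pot h" for h
  proof -
    have hb: "h \<in> borel_measurable borel" by (rule borel_measurable_continuous_onI[OF h])
    have ae: "AE x in \<mu>. h (f x) = h (to_slope x)" using f_map_AE[OF \<rho>] unfolding \<mu>_def f_def by eventually_elim simp
    have mf: "(\<lambda>x. h (f x)) \<in> borel_measurable \<mu>" by (rule measurable_compose[OF fm hb])
    have ms: "(\<lambda>x. h (to_slope x)) \<in> borel_measurable \<mu>"
      using measurable_compose[OF to_slope_borel hb] by (simp add: \<mu>_def)
    have "integrable \<mu> (\<lambda>x. h (f x))"
      using p_to_slope_integrable[OF \<rho> h] integrable_cong_AE[OF mf ms ae] by (simp add: \<mu>_def)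
    then have "integrable (distr \<mu> borel f) h" using integrable_distr_eq[OF fm hb] by simp
    then show "integrable G (\<lambda>x. h (snd x))" using integrable_distr[OF m2', of h] unfolding G2 by simp
    have "(LINT x|G. h (snd x)) = (LINT x|\<mu>. h (f x))"
      using integral_distr[OF m2' hb] integral_distr[OF fm hb] unfolding G2 by simp
    also have "\<dots> = (LINT x|\<mu>. h (to_slope x))" by (rule integral_cong_AE[OF mf ms ae])
    finally show "(LINT x|G. h (snd x)) = (LINT x|\<mu>. h (to_slope x))" .
  qed
  define \<psi>' where "\<psi>' q = indicator Q q * \<psi> q" for q
  note psi' = \<sigma>_indicator_integral[OF \<psi>, folded \<psi>'_def]
  have pn: "pot (\<lambda>y. (norm y)\<^sup>2)" by (intro continuous_intros)
  note I1 = i1[OF norm_sq_borel norm_sq_integrable] and I2 = i2[OF pn] and I3 = i1[OF psi'(1,2)] and I4 = i2[OF pp]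
  define u where "u x = (norm (fst x))\<^sup>2 + (norm (snd x))\<^sup>2 - 2 * \<psi>' (fst x) - 2 * p (snd x)" for x
  have ui: "integrable G u"
    unfolding u_def using I1(1) I2(1) I3(1) I4(1)
    by (intro Bochner_Integration.integrable_diff Bochner_Integration.integrable_add integrable_mult_right)
  have uI: "(LINT x|G. u x) = 2 * half_moment + (LINT x|\<mu>. (norm (to_slope x))\<^sup>2) - 2 * (LINT q:Q|\<sigma>. \<psi> q) - 2 * (LINT x|\<mu>. p (to_slope x))"
    unfolding u_def using I1 I2 I3 I4 psi'(3) by (simp add: half_moment_def)
  have "AE x in G. fst x \<in> Q" using \<sigma>_Q AE_distrD[OF m1, of "\<lambda>q. q \<in> Q"] unfolding G1 by simp
  then have le: "AE x in G. u x \<le> (dist (fst x) (snd x))\<^sup>2"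
  proof eventually_elim
    case (elim x)
    then show ?case
      using legendre_ge[OF Q_compact \<psi>, of "fst x" "snd x"]
      by (simp add: u_def \<psi>'_def dist_norm norm_diff_sq inner_commute p_def)
  qed
  show ?thesis
    using integral_le_nn_integral[OF ui le] unfolding uI p_def \<mu>_def by (simp add: case_prod_beta')
qed

lemma K_finite:
  assumes \<rho>: "profile \<rho>" and f: "integrable (mu r\<^sub>0 H \<Omega> \<rho>) (\<lambda>x. f0 r\<^sub>0 \<Omega> (fst x))"
  shows "K_fun r\<^sub>0 H \<Omega> \<theta> \<sigma> \<rho> = ereal (1/2) * enn2ereal (wasserstein2_sq \<sigma> (distr (mu r\<^sub>0 H \<Omega> \<rho>) borel (f_map H \<theta>)))
     + ereal ((LINT x|(mu r\<^sub>0 H \<Omega> \<rho>). f0 r\<^sub>0 \<Omega> (fst x)) - (LINT x|(mu r\<^sub>0 H \<Omega> \<rho>). (norm (to_slope x))\<^sup>2) / 2)"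
proof -
  have g: "integrable (mu r\<^sub>0 H \<Omega> \<rho>) external_energy"
    unfolding external_energy_def[abs_def] using f to_slope_norm_integrable[OF \<rho>] by auto
  have "ext_integral (mu r\<^sub>0 H \<Omega> \<rho>) UNIV external_energy = ereal (LINT x|(mu r\<^sub>0 H \<Omega> \<rho>). external_energy x)"
    using ext_integral_real[of "mu r\<^sub>0 H \<Omega> \<rho>" UNIV external_energy] g by (simp add: set_integrable_def set_lebesgue_integral_def)
  also have "(LINT x|(mu r\<^sub>0 H \<Omega> \<rho>). external_energy x)
    = (LINT x|(mu r\<^sub>0 H \<Omega> \<rho>). f0 r\<^sub>0 \<Omega> (fst x)) - (LINT x|(mu r\<^sub>0 H \<Omega> \<rho>). (norm (to_slope x))\<^sup>2) / 2"
    unfolding external_energy_def using f to_slope_norm_integrable[OF \<rho>] by simp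
  finally show ?thesis unfolding K_fun_def ext_external_energy[OF \<rho>] using profile_R0[OF \<rho>] by simp
qed

lemma K_lower:
  assumes \<rho>: "profile \<rho>" and f: "integrable (mu r\<^sub>0 H \<Omega> \<rho>) (\<lambda>x. f0 r\<^sub>0 \<Omega> (fst x))" and \<psi>: "continuous_on Q \<psi>"
  shows "ereal (half_moment - (LINT q:Q|\<sigma>. \<psi> q) + (LINT z:{0..H}|lborel. energy (legendre Q \<psi>) (slope z) (\<rho> z)))
    \<le> K_fun r\<^sub>0 H \<Omega> \<theta> \<sigma> \<rho>"
proof -
  have pp: "pot (legendre Q \<psi>)" by (rule legendre_continuous[OF Q_compact \<psi> Q_ne])
  define v where "v = 2 * half_moment + (LINT x|(mu r\<^sub>0 H \<Omega> \<rho>). (norm (to_slope x))\<^sup>2) - 2 * (LINT q:Q|\<sigma>. \<psi> q)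
      - 2 * (LINT x|(mu r\<^sub>0 H \<Omega> \<rho>). legendre Q \<psi> (to_slope x))"
  have "ennreal v \<le> wasserstein2_sq \<sigma> (distr (mu r\<^sub>0 H \<Omega> \<rho>) borel (f_map H \<theta>))"
    unfolding wasserstein2_sq_def v_def by (rule INF_greatest) (rule coupling_lower[OF \<rho> \<psi>])
  then have "enn2ereal (ennreal v) \<le> enn2ereal (wasserstein2_sq \<sigma> (distr (mu r\<^sub>0 H \<Omega> \<rho>) borel (f_map H \<theta>)))"
    by (simp add: less_eq_ennreal.rep_eq)
  moreover have "ereal v \<le> enn2ereal (ennreal v)" by (simp add: ennreal.rep_eq max_def)
  ultimately have "ereal v \<le> enn2ereal (wasserstein2_sq \<sigma> (distr (mu r\<^sub>0 H \<Omega> \<rho>) borel (f_map H \<theta>)))"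
    by (rule order_trans[rotated])
  then have "ereal (1/2) * ereal v \<le> ereal (1/2) * enn2ereal (wasserstein2_sq \<sigma> (distr (mu r\<^sub>0 H \<Omega> \<rho>) borel (f_map H \<theta>)))"
    by (intro ereal_mult_left_mono) auto
  then have "ereal (v / 2) + ereal ((LINT x|(mu r\<^sub>0 H \<Omega> \<rho>). f0 r\<^sub>0 \<Omega> (fst x)) - (LINT x|(mu r\<^sub>0 H \<Omega> \<rho>). (norm (to_slope x))\<^sup>2) / 2)
     \<le> K_fun r\<^sub>0 H \<Omega> \<theta> \<sigma> \<rho>"
    unfolding K_finite[OF \<rho> f] by (intro add_right_mono) simp
  moreover have "(LINT x|(mu r\<^sub>0 H \<Omega> \<rho>). f0 r\<^sub>0 \<Omega> (fst x) - legendre Q \<psi> (to_slope x))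
     = (LINT x|(mu r\<^sub>0 H \<Omega> \<rho>). f0 r\<^sub>0 \<Omega> (fst x)) - (LINT x|(mu r\<^sub>0 H \<Omega> \<rho>). legendre Q \<psi> (to_slope x))"
    by (rule Bochner_Integration.integral_diff[OF f p_to_slope_integrable[OF \<rho> pp]])
  then have "v / 2 + ((LINT x|(mu r\<^sub>0 H \<Omega> \<rho>). f0 r\<^sub>0 \<Omega> (fst x)) - (LINT x|(mu r\<^sub>0 H \<Omega> \<rho>). (norm (to_slope x))\<^sup>2) / 2)
     = half_moment - (LINT q:Q|\<sigma>. \<psi> q) + (LINT z:{0..H}|lborel. energy (legendre Q \<psi>) (slope z) (\<rho> z))"
    unfolding energy_fubini(2)[OF \<rho> f pp, symmetric] by (simp add: v_def field_simps)
  ultimately show ?thesis by simp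
qed

lemma total_energy_le_energy:
  assumes \<rho>: "profile \<rho>" and f: "integrable (mu r\<^sub>0 H \<Omega> \<rho>) (\<lambda>x. f0 r\<^sub>0 \<Omega> (fst x))" and \<psi>: "continuous_on Q \<psi>"
  shows "total_energy (legendre Q \<psi>) \<le> (LINT z:{0..H}|lborel. energy (legendre Q \<psi>) (slope z) (\<rho> z))"
proof -
  have pp: "pot (legendre Q \<psi>)" by (rule legendre_continuous[OF Q_compact \<psi> Q_ne])
  show ?thesis unfolding total_energy_def
    by (intro set_integral_mono min_energy_legendre_integrable \<psi> energy_fubini(1) \<rho> f pp min_energy_le profileD(2,3)[OF \<rho>])
qed

theorem weak_duality:
  assumes "\<rho> \<in> R0_set r\<^sub>0 H \<Omega>" and \<psi>: "continuous_on Q \<psi>"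
  shows "ereal (half_moment + dual_value \<psi>) \<le> K_fun r\<^sub>0 H \<Omega> \<theta> \<sigma> \<rho>"
proof -
  obtain \<rho>' where \<rho>': "profile \<rho>'" "mu r\<^sub>0 H \<Omega> \<rho>' = mu r\<^sub>0 H \<Omega> \<rho>" by (rule R0_profile[OF assms(1)]) blast
  have "ereal (half_moment + dual_value \<psi>) \<le> K_fun r\<^sub>0 H \<Omega> \<theta> \<sigma> \<rho>'"
  proof (cases "integrable (mu r\<^sub>0 H \<Omega> \<rho>') (\<lambda>x. f0 r\<^sub>0 \<Omega> (fst x))")
    case False
    show ?thesis unfolding K_infinite[OF \<rho>'(1) False] by simp
  next
    case True
    have "half_moment + dual_value \<psi> \<le> half_moment - (LINT q:Q|\<sigma>. \<psi> q) + (LINT z:{0..H}|lborel. energy (legendre Q \<psi>) (slope z) (\<rho>' z))"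
      using total_energy_le_energy[OF \<rho>'(1) True \<psi>] by (simp add: dual_value_def)
    with K_lower[OF \<rho>'(1) True \<psi>] show ?thesis by (meson ereal_less_eq(3) order_trans)
  qed
  then show ?thesis using K_fun_mu_cong[OF profile_R0[OF \<rho>'(1)] assms(1) \<rho>'(2)] by simp
qed

lemma profile_mass:
  assumes \<rho>: "profile \<rho>"
  shows "set_integrable lborel {0..H} (\<lambda>z. mass (\<rho> z))" "(LINT z:{0..H}|lborel. mass (\<rho> z)) = 1"
proof -
  interpret prob_space "mu r\<^sub>0 H \<Omega> \<rho>" using profileD(4)[OF \<rho>] .
  have e: "(LINT s:{0..\<rho> z}|lborel. 1 * weight s) = mass (\<rho> z)" if "z \<in> {0..H}" for z
    using mass_lebesgue(2)[OF profileD(3)[OF \<rho> that]] by simp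
  have "integrable (mu r\<^sub>0 H \<Omega> \<rho>) (\<lambda>_. 1 :: real)" by simp
  note I = integral_mu[OF profileD(1)[OF \<rho>] borel_measurable_const this]
  show "set_integrable lborel {0..H} (\<lambda>z. mass (\<rho> z))"
    using I(1) by (rule set_integrable_cong[THEN iffD1, rotated -1]) (use e in auto)
  have "(LINT z:{0..H}|lborel. mass (\<rho> z)) = (LINT z:{0..H}|lborel. LINT s:{0..\<rho> z}|lborel. 1 * weight s)"
    by (rule set_lebesgue_integral_cong) (use e in auto)
  also have "\<dots> = (LINT x|(mu r\<^sub>0 H \<Omega> \<rho>). 1)" by (rule I(2)[symmetric])
  finally show "(LINT z:{0..H}|lborel. mass (\<rho> z)) = 1" using prob_space by simp
qed

lemma AE_eq_of_integral_le:
  fixes g h :: "real \<Rightarrow> real"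
  assumes "set_integrable lborel {0..H} g" "set_integrable lborel {0..H} h"
    and le: "AE z in lborel. z \<in> {0..H} \<longrightarrow> g z \<le> h z" and i: "(LINT z:{0..H}|lborel. h z) \<le> (LINT z:{0..H}|lborel. g z)"
  shows "AE z in lborel. z \<in> {0..H} \<longrightarrow> g z = h z"
proof -
  define d where "d z = indicator {0..H} z *\<^sub>R h z - indicator {0..H} z *\<^sub>R g z" for z
  have di: "integrable lborel d"
    unfolding d_def using assms(1,2) by (intro Bochner_Integration.integrable_diff) (auto simp: set_integrable_def)
  have d0: "AE z in lborel. 0 \<le> d z" using le by eventually_elim (auto simp: d_def split: split_indicator)
  have "(LINT z|lborel. d z) = (LINT z:{0..H}|lborel. h z) - (LINT z:{0..H}|lborel. g z)"
    unfolding d_def set_lebesgue_integral_def using assms(1,2) by (simp add: set_integrable_def)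
  moreover have "(LINT z|lborel. d z) \<ge> 0" by (rule integral_nonneg_AE[OF d0])
  ultimately have "(LINT z|lborel. d z) = 0" using i by linarith
  then have "AE z in lborel. d z = 0" using integral_nonneg_eq_0_iff_AE[OF di d0] by simp
  then show ?thesis by eventually_elim (auto simp: d_def split: split_indicator_asm)
qed

text \<open>Without duality gap almost every column height is optimal, hence at least the lowest optimal
  height; since both profiles carry total mass one, they agree.\<close>

theorem duality_equality:
  assumes R: "\<rho> \<in> R0_set r\<^sub>0 H \<Omega>" and \<psi>: "continuous_on Q \<psi>" and K: "K_fun r\<^sub>0 H \<Omega> \<theta> \<sigma> \<rho> \<le> ereal (half_moment + dual_value \<psi>)"
    and pa: "profile (lowest_profile (legendre Q \<psi>))"
  shows "AE z in lborel. z \<in> {0..H} \<longrightarrow> \<rho> z = lowest_profile (legendre Q \<psi>) z"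
proof -
  define p where "p = legendre Q \<psi>"
  have pp: "pot p" unfolding p_def by (rule legendre_continuous[OF Q_compact \<psi> Q_ne])
  obtain \<rho>' where \<rho>': "profile \<rho>'" "\<And>z. z \<in> {0..H} \<Longrightarrow> \<rho>' z = \<rho> z" "mu r\<^sub>0 H \<Omega> \<rho>' = mu r\<^sub>0 H \<Omega> \<rho>"
    by (rule R0_profile[OF R]) blast
  have K': "K_fun r\<^sub>0 H \<Omega> \<theta> \<sigma> \<rho>' \<le> ereal (half_moment + dual_value \<psi>)"
    using K K_fun_mu_cong[OF profile_R0[OF \<rho>'(1)] R \<rho>'(3)] by simp
  have f: "integrable (mu r\<^sub>0 H \<Omega> \<rho>') (\<lambda>x. f0 r\<^sub>0 \<Omega> (fst x))"
    using K' K_infinite[OF \<rho>'(1)] by fastforce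
  have "ereal (half_moment - (LINT q:Q|\<sigma>. \<psi> q) + (LINT z:{0..H}|lborel. energy p (slope z) (\<rho>' z))) \<le> ereal (half_moment + dual_value \<psi>)"
    using K_lower[OF \<rho>'(1) f \<psi>] K' unfolding p_def by (rule order_trans)
  then have le: "(LINT z:{0..H}|lborel. energy p (slope z) (\<rho>' z)) \<le> (LINT z:{0..H}|lborel. min_energy p (slope z))"
    by (simp add: dual_value_def total_energy_def p_def)
  have "AE z in lborel. z \<in> {0..H} \<longrightarrow> min_energy p (slope z) = energy p (slope z) (\<rho>' z)"
    by (rule AE_eq_of_integral_le[OF _ energy_fubini(1)[OF \<rho>'(1) f pp] _ le])
      (auto simp: p_def intro!: min_energy_legendre_integrable \<psi> min_energy_le pp[unfolded p_def] profileD(2,3)[OF \<rho>'(1)])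
  then have ge: "AE z in lborel. z \<in> {0..H} \<longrightarrow> lowest_profile p z \<le> \<rho>' z"
  proof eventually_elim
    case (elim z)
    show ?case
    proof
      assume z: "z \<in> {0..H}"
      then have "\<rho>' z \<in> minimizers p (slope z)" using elim by (intro minimizersI pp profileD(2,3)[OF \<rho>'(1)]) auto
      then show "lowest_profile p z \<le> \<rho>' z" unfolding lowest_profile_def by (rule lowest_highest(3)[OF pp])
    qed
  qed
  have pa': "profile (lowest_profile p)" using pa by (simp add: p_def)
  have "AE z in lborel. z \<in> {0..H} \<longrightarrow> mass (lowest_profile p z) = mass (\<rho>' z)"
  proof (rule AE_eq_of_integral_le[OF profile_mass(1)[OF pa'] profile_mass(1)[OF \<rho>'(1)]])
    show "AE z in lborel. z \<in> {0..H} \<longrightarrow> mass (lowest_profile p z) \<le> mass (\<rho>' z)"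
      using ge by eventually_elim (auto intro!: mass_mono profileD(2)[OF pa'] profileD(3)[OF \<rho>'(1)])
  qed (simp add: profile_mass(2)[OF pa'] profile_mass(2)[OF \<rho>'(1)])
  with ge show ?thesis
  proof eventually_elim
    case (elim z)
    show ?case
    proof
      assume z: "z \<in> {0..H}"
      have "\<not> lowest_profile p z < \<rho>' z"
      proof
        assume "lowest_profile p z < \<rho>' z"
        from mass_strict_mono[OF profileD(2)[OF pa' z] this profileD(3)[OF \<rho>'(1) z]] show False
          using elim z by simp
      qed
      moreover have "lowest_profile p z \<le> \<rho>' z" using elim z by simp
      ultimately have "\<rho>' z = lowest_profile p z" by linarith
      then show "\<rho> z = lowest_profile (legendre Q \<psi>) z" using \<rho>'(2)[OF z] by (simp add: p_def)
    qed
  qed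
qed

text \<open>The supremum is attained, points attaining it are subgradients, and at a regular point the
  gradient is the only one.\<close>

lemma contact_AE:
  assumes \<psi>: "continuous_on Q \<psi>" and \<rho>: "profile \<rho>"
  shows "AE x in mu r\<^sub>0 H \<Omega> \<rho>. regular (legendre Q \<psi>) (to_slope x) \<and> rgrad (legendre Q \<psi>) (to_slope x) \<in> Q \<and>
    legendre Q \<psi> (to_slope x) = to_slope x \<bullet> rgrad (legendre Q \<psi>) (to_slope x) - \<psi> (rgrad (legendre Q \<psi>) (to_slope x))"
proof -
  have "AE x in lborel. snd x \<in> {0..H} \<longrightarrow> regular (legendre Q \<psi>) (fst x, slope (snd x))"
    by (rule AE_regular[OF legendre_continuous[OF Q_compact \<psi> Q_ne] legendre_subgrads_nonempty[OF Q_compact \<psi> Q_ne] slope_borel _ slope_inj]) simp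
  then have "AE x in mu r\<^sub>0 H \<Omega> \<rho>. regular (legendre Q \<psi>) (to_slope x)"
    by (intro AE_mu_lborel[OF profileD(1)[OF \<rho>]]) (auto simp: D_set_def to_slope_def elim!: eventually_mono)
  then show ?thesis
  proof eventually_elim
    case (elim x)
    obtain q where q: "q \<in> Q" "legendre Q \<psi> (to_slope x) = to_slope x \<bullet> q - \<psi> q"
      by (rule legendre_attained[OF Q_compact \<psi> Q_ne])
    have "q = rgrad (legendre Q \<psi>) (to_slope x)"
      by (rule subgrad_eq_rgrad[OF legendre_subgrads_nonempty[OF Q_compact \<psi> Q_ne] elim contact_subgrad[OF Q_compact \<psi> q]])
    with q elim show ?case by simp
  qed
qed

text \<open>The coupling induced by the gradient map turns the inequality of the lower bound into an equality,
  because almost every transported pair is in contact.\<close>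

theorem strong_duality:
  assumes J: "dual_optimal \<psi>"
  shows "profile (lowest_profile (legendre Q \<psi>))" "K_fun r\<^sub>0 H \<Omega> \<theta> \<sigma> (lowest_profile (legendre Q \<psi>)) = ereal (half_moment + dual_value \<psi>)"
proof -
  define p where "p = legendre Q \<psi>"
  define \<mu> where "\<mu> = mu r\<^sub>0 H \<Omega> (lowest_profile p)"
  have \<psi>: "continuous_on Q \<psi>" using J by (simp add: dual_optimal_def)
  have pc: "column_convex p" unfolding p_def by (rule legendre_col[OF \<psi>])
  note pp = column_convexD(1)[OF pc]
  have pb: "p \<in> borel_measurable borel" by (rule borel_measurable_continuous_onI[OF pp])
  define T where "T x = rgrad p (to_slope x)" for x
  have Tb: "T \<in> borel \<rightarrow>\<^sub>M borel"
    unfolding T_def[abs_def] by (rule measurable_compose[OF to_slope_borel measurable_rgrad[OF pb]])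
  have Tm: "T \<in> \<mu> \<rightarrow>\<^sub>M borel" using Tb by (simp add: \<mu>_def)
  have dT: "distr \<mu> borel T = \<sigma>" using optimal_transport[OF J] by (simp add: \<mu>_def T_def[abs_def] p_def)
  have "emeasure \<mu> UNIV = emeasure (distr \<mu> borel T) UNIV" using Tm by (subst emeasure_distr) (simp_all add: \<mu>_def)
  then have "emeasure \<mu> UNIV = 1" using \<sigma>.emeasure_space_1 by (simp add: dT)
  then have "prob_space \<mu>" by (intro prob_spaceI) (simp add: \<mu>_def)
  then have pr: "profile (lowest_profile p)"
    using lowest_profile_borel[OF pc] lowest_highest(1)[OF pp] by (auto simp: profile_def \<mu>_def lowest_profile_def minimizers_def)
  then show "profile (lowest_profile (legendre Q \<psi>))" by (simp add: p_def)
  interpret \<mu>: prob_space \<mu> by fact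
  obtain t where t: "0 < t" "t < smax" "\<And>z. z \<in> {0..H} \<Longrightarrow> minimizers p (slope z) \<subseteq> {0..t}"
    by (rule minimizers_column_bound[OF pc]) blast
  have f: "integrable \<mu> (\<lambda>x. f0 r\<^sub>0 \<Omega> (fst x))"
  proof (rule \<mu>.integrable_const_bound[of _ "f0 r\<^sub>0 \<Omega> t"])
    show "AE x in \<mu>. norm (f0 r\<^sub>0 \<Omega> (fst x)) \<le> f0 r\<^sub>0 \<Omega> t"
      using AE_profile[OF pr] unfolding \<mu>_def
    proof eventually_elim
      case (elim x)
      then have "fst x \<le> lowest_profile p (snd x)" by (auto simp: D_set_def)
      also have "\<dots> \<le> t" using t(3)[of "snd x"] lowest_highest(1)[OF pp, of "slope (snd x)"] elim by (auto simp: lowest_profile_def)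
      finally have "f0 r\<^sub>0 \<Omega> (fst x) \<le> f0 r\<^sub>0 \<Omega> t" using t by (intro f0_mono)
      then show ?case using f0_pos[of "fst x"] elim by simp
    qed
  qed (simp add: \<mu>_def)
  note f' = f[unfolded \<mu>_def]
  define \<psi>' where "\<psi>' q = indicator Q q * \<psi> q" for q
  note psi' = \<sigma>_indicator_integral[OF \<psi>, folded \<psi>'_def]
  have i1: "integrable \<mu> (\<lambda>x. h (T x))" "(LINT x|\<mu>. h (T x)) = (LINT q|\<sigma>. h q)"
    if "h \<in> borel_measurable borel" "integrable \<sigma> h" for h :: "real \<times> real \<Rightarrow> real"
    using integrable_distr[OF Tm, of h] integral_distr[OF Tm that(1)] that(2) unfolding dT by auto
  note I1 = i1[OF norm_sq_borel norm_sq_integrable] and I3 = i1[OF psi'(1,2)]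
    and I2 = to_slope_norm_integrable[OF pr, folded \<mu>_def] and I4 = p_to_slope_integrable[OF pr pp, folded \<mu>_def]
  define u where "u x = (norm (T x))\<^sup>2 + (norm (to_slope x))\<^sup>2 - 2 * \<psi>' (T x) - 2 * p (to_slope x)" for x
  define v where "v = 2 * half_moment + (LINT x|\<mu>. (norm (to_slope x))\<^sup>2) - 2 * (LINT q:Q|\<sigma>. \<psi> q) - 2 * (LINT x|\<mu>. p (to_slope x))"
  have ui: "integrable \<mu> u"
    unfolding u_def using I1(1) I2 I3(1) I4
    by (intro Bochner_Integration.integrable_diff Bochner_Integration.integrable_add integrable_mult_right)
  have uI: "(LINT x|\<mu>. u x) = v"
    unfolding u_def v_def using I1 I2 I3 I4 psi'(3) by (simp add: half_moment_def)
  have eq: "AE x in \<mu>. u x = (dist (T x) (f_map H \<theta> x))\<^sup>2"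
    using contact_AE[OF \<psi> pr] f_map_AE[OF pr] unfolding \<mu>_def
  proof eventually_elim
    case (elim x)
    then show ?case
      by (simp add: u_def \<psi>'_def T_def p_def dist_norm norm_diff_sq inner_commute)
  qed
  then have u0: "AE x in \<mu>. 0 \<le> u x" by eventually_elim simp
  then have v0: "v \<ge> 0" using integral_nonneg_AE uI by metis
  define G where "G = distr \<mu> borel (\<lambda>x. (T x, f_map H \<theta> x))"
  have fm: "f_map H \<theta> \<in> \<mu> \<rightarrow>\<^sub>M borel" using f_map_borel by (simp add: \<mu>_def)
  have Gm: "(\<lambda>x. (T x, f_map H \<theta> x)) \<in> \<mu> \<rightarrow>\<^sub>M borel"
    using measurable_Pair[OF Tm fm] by (simp add: borel_prod)
  have mf: "fst \<in> borel \<rightarrow>\<^sub>M (borel :: (real \<times> real) measure)" "snd \<in> borel \<rightarrow>\<^sub>M (borel :: (real \<times> real) measure)"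
    by (intro borel_measurable_continuous_onI continuous_intros)+
  have Gc: "G \<in> couplings \<sigma> (distr \<mu> borel (f_map H \<theta>))"
    unfolding couplings_def G_def using dT
    by (simp add: distr_distr[OF mf(1) Gm] distr_distr[OF mf(2) Gm] o_def)
  have "wasserstein2_sq \<sigma> (distr \<mu> borel (f_map H \<theta>)) \<le> (\<integral>\<^sup>+(x, y). ennreal ((dist x y)\<^sup>2) \<partial>G)"
    unfolding wasserstein2_sq_def by (rule INF_lower[OF Gc])
  also have "\<dots> = (\<integral>\<^sup>+x. ennreal ((dist (T x) (f_map H \<theta> x))\<^sup>2) \<partial>\<mu>)"
    unfolding G_def
    by (subst nn_integral_distr[OF Gm])
      (auto simp: case_prod_beta' intro!: borel_measurable_continuous_onI continuous_intros measurable_compose[OF _ measurable_ennreal])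
  also have "\<dots> = (\<integral>\<^sup>+x. ennreal (u x) \<partial>\<mu>)"
    by (rule nn_integral_cong_AE, use eq in eventually_elim) simp
  also have "\<dots> = ennreal v" using nn_integral_eq_integral[OF ui u0] uI by simp
  finally have "enn2ereal (wasserstein2_sq \<sigma> (distr \<mu> borel (f_map H \<theta>))) \<le> ereal v"
    using v0 by (metis enn2ereal_ennreal less_eq_ennreal.rep_eq)
  then have "ereal (1/2) * enn2ereal (wasserstein2_sq \<sigma> (distr \<mu> borel (f_map H \<theta>))) \<le> ereal (1/2) * ereal v"
    by (intro ereal_mult_left_mono) auto
  then have "K_fun r\<^sub>0 H \<Omega> \<theta> \<sigma> (lowest_profile p) \<le> ereal (v / 2) + ereal ((LINT x|\<mu>. f0 r\<^sub>0 \<Omega> (fst x)) - (LINT x|\<mu>. (norm (to_slope x))\<^sup>2) / 2)"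
    unfolding K_finite[OF pr f'] \<mu>_def by (intro add_right_mono) simp
  also have "\<dots> = ereal (half_moment - (LINT q:Q|\<sigma>. \<psi> q) + (LINT x|\<mu>. f0 r\<^sub>0 \<Omega> (fst x) - p (to_slope x)))"
    using f I4 by (simp add: v_def field_simps)
  also have "(LINT x|\<mu>. f0 r\<^sub>0 \<Omega> (fst x) - p (to_slope x)) = total_energy p"
    unfolding \<mu>_def energy_fubini(2)[OF pr f' pp] total_energy_def
    by (simp add: lowest_profile_def min_energy_def)
  also have "half_moment - (LINT q:Q|\<sigma>. \<psi> q) + total_energy p = half_moment + dual_value \<psi>" by (simp add: dual_value_def p_def)
  finally have "K_fun r\<^sub>0 H \<Omega> \<theta> \<sigma> (lowest_profile p) \<le> ereal (half_moment + dual_value \<psi>)" .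
  with weak_duality[OF profile_R0[OF pr] \<psi>]
  show "K_fun r\<^sub>0 H \<Omega> \<theta> \<sigma> (lowest_profile (legendre Q \<psi>)) = ereal (half_moment + dual_value \<psi>)" unfolding p_def[symmetric] by (rule antisym[rotated])
qed

end

section \<open>The potentials of the dual problem\<close>

locale problem = params +
  fixes l :: real and I :: "real set" and \<theta> :: "real \<Rightarrow> real"
  assumes l_pos: "l > 0" and I_open: "open I" and I_pos: "I \<subseteq> {0<..}" and I_away: "0 \<notin> closure I"
    and \<theta>_I: "\<theta> ` {0..H} \<subseteq> I" and \<theta>_cont: "continuous_on {0..H} \<theta>"
    and phi_strict: "strict_mono_on {0..H} (phi \<theta>)"
begin

text \<open>Clamping the height to \<open>{0..H}\<close> makes the map continuous and monotone on all reals.\<close>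

definition slope :: "real \<Rightarrow> real" where "slope z = phi \<theta> (max 0 (min H z))"
definition Q :: "(real \<times> real) set" where "Q = closure (Bplus l)"
definition slope_pairs :: "(real \<times> real) set" where "slope_pairs = (\<lambda>((s, z), m). (s, z / m)) ` (W_set r\<^sub>0 H \<times> I)"
definition X :: "(real \<times> real) set" where "X = closure slope_pairs"

lemma slope_eq: "z \<in> {0..H} \<Longrightarrow> slope z = z / \<theta> z"
proof -
  assume "z \<in> {0..H}"
  then have "max 0 (min H z) = z" by auto
  then show ?thesis by (simp add: slope_def phi_def)
qed

lemma \<theta>_mem: "z \<in> {0..H} \<Longrightarrow> \<theta> z \<in> I" using \<theta>_I by blast

lemma \<theta>_pos: "z \<in> {0..H} \<Longrightarrow> \<theta> z > 0" using \<theta>_mem I_pos by blast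

lemma clamp_mem: "max 0 (min H z) \<in> {0..H}" using H_pos by auto

lemma phi_cont: "continuous_on {0..H} (phi \<theta>)"
  unfolding phi_def[abs_def] using \<theta>_pos by (intro continuous_intros \<theta>_cont) force+

lemma slope_continuous: "continuous_on UNIV slope"
  unfolding slope_def[abs_def]
  by (rule continuous_on_compose2[OF phi_cont]) (auto intro!: continuous_intros simp: H_pos less_imp_le)

lemma slope_monotone: "mono slope"
proof (rule monoI)
  fix x y :: real assume "x \<le> y"
  then have "max 0 (min H x) \<le> max 0 (min H y)" by auto
  then show "slope x \<le> slope y" unfolding slope_def
    using strict_mono_on_leD[OF phi_strict clamp_mem clamp_mem] by blast
qed

lemma slope_strictly: "strict_mono_on {0..H} slope"
proof (rule strict_mono_onI)
  fix x y assume "x \<in> {0..H}" "y \<in> {0..H}" "x < y"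
  moreover then have "max 0 (min H x) = x" "max 0 (min H y) = y" by auto
  ultimately show "slope x < slope y" using strict_mono_onD[OF phi_strict, of x y] by (simp add: slope_def)
qed

sublocale column r\<^sub>0 H \<Omega> slope
  by unfold_locales (rule slope_continuous slope_monotone slope_strictly)+

lemma I_lower: obtains m0 where "m0 > 0" "\<And>m. m \<in> I \<Longrightarrow> m0 \<le> m"
proof -
  obtain e where e: "e > 0" "\<And>m. m \<in> I \<Longrightarrow> \<not> dist m 0 < e"
    using I_away unfolding closure_approachable by blast
  show thesis
  proof (rule that[OF e(1)])
    fix m assume "m \<in> I"
    with e(2)[OF this] I_pos show "e \<le> m" by (auto simp: dist_real_def)
  qed
qed

lemma Bplus_ne: "Bplus l \<noteq> {}"
proof -
  have "norm (l / 4, l / 4) \<le> norm (l / 4) + norm (l / 4)" by (rule norm_Pair_le)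
  also have "\<dots> < l" using l_pos by simp
  finally have "norm (l / 4, l / 4) < l" .
  moreover have "dist (0, 0) (l / 4, l / 4) = norm (l / 4, l / 4)" by (simp add: dist_norm norm_Pair)
  ultimately have "(l / 4, l / 4) \<in> Bplus l" using l_pos by (simp add: Bplus_def)
  then show ?thesis by blast
qed

lemma Bplus_convex: "convex (Bplus l)"
  unfolding Bplus_def by (intro convex_Int convex_ball convex_Times convex_real_interval)

lemma Q_cball: "Q \<subseteq> closure (ball (0, 0) l)" unfolding Q_def Bplus_def by (rule closure_mono) auto

lemma Q_comp: "compact Q"
proof -
  have "bounded (Bplus l)" by (rule bounded_subset[OF bounded_ball]) (auto simp: Bplus_def)
  then show ?thesis by (simp add: Q_def compact_closure)
qed

lemma Q_nonempty: "Q \<noteq> {}" using Bplus_ne closure_subset by (auto simp: Q_def)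

lemma Q_nn: "q \<in> Q \<Longrightarrow> 0 \<le> fst q \<and> 0 \<le> snd q"
proof -
  have "closed ({q. 0 \<le> fst q} \<inter> {q :: real \<times> real. 0 \<le> snd q})"
    by (intro closed_Int closed_Collect_le continuous_intros)
  then have "Q \<subseteq> {q. 0 \<le> fst q} \<inter> {q. 0 \<le> snd q}"
    unfolding Q_def by (intro closure_minimal) (auto simp: Bplus_def)
  then show "q \<in> Q \<Longrightarrow> 0 \<le> fst q \<and> 0 \<le> snd q" by auto
qed

lemma slope_pairs_mem: "(s, z) \<in> W_set r\<^sub>0 H \<Longrightarrow> m \<in> I \<Longrightarrow> (s, z / m) \<in> slope_pairs"
  unfolding slope_pairs_def by force

lemma slope_pairs_ne: "slope_pairs \<noteq> {}"
  using \<theta>_mem[of 0] H_pos smax_pos by (auto simp: slope_pairs_def W_set_def smax_def)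

lemma slope_pairs_bounded: "bounded slope_pairs"
proof -
  obtain m0 where m0: "m0 > 0" "\<And>m. m \<in> I \<Longrightarrow> m0 \<le> m" by (rule I_lower) blast
  have "slope_pairs \<subseteq> {0..smax} \<times> {0..H / m0}"
  proof
    fix x assume "x \<in> slope_pairs"
    then obtain s z m where x: "x = (s, z / m)" "(s, z) \<in> W_set r\<^sub>0 H" "m \<in> I" by (auto simp: slope_pairs_def)
    have "z / m \<le> H / m0" using x m0(1) m0(2)[OF x(3)] by (intro frac_le) (auto simp: W_set_def)
    moreover have "0 \<le> z / m" using x m0(1) m0(2)[OF x(3)] by (auto simp: W_set_def)
    ultimately show "x \<in> {0..smax} \<times> {0..H / m0}" using x by (auto simp: W_set_def smax_def)
  qed
  then show ?thesis by (rule bounded_subset[rotated]) (intro bounded_Times bounded_closed_interval)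
qed

lemma X_comp: "compact X" unfolding X_def using slope_pairs_bounded by (simp add: compact_closure)

lemma X_nonempty: "X \<noteq> {}" using slope_pairs_ne closure_subset by (auto simp: X_def)

lemma X_nn: "x \<in> X \<Longrightarrow> 0 \<le> fst x \<and> 0 \<le> snd x"
proof -
  have "closed ({q. 0 \<le> fst q} \<inter> {q :: real \<times> real. 0 \<le> snd q})"
    by (intro closed_Int closed_Collect_le continuous_intros)
  moreover have "slope_pairs \<subseteq> {q. 0 \<le> fst q} \<inter> {q. 0 \<le> snd q}"
    using I_pos by (force simp: slope_pairs_def W_set_def)
  ultimately have "X \<subseteq> {q. 0 \<le> fst q} \<inter> {q. 0 \<le> snd q}" unfolding X_def by (intro closure_minimal)
  then show "x \<in> X \<Longrightarrow> 0 \<le> fst x \<and> 0 \<le> snd x" by auto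
qed

lemma W_iff: "(s, z) \<in> W_set r\<^sub>0 H \<longleftrightarrow> 0 \<le> s \<and> s < smax \<and> z \<in> {0..H}" by (auto simp: W_set_def smax_def)

lemma X_sh: "0 \<le> s \<Longrightarrow> s < smax \<Longrightarrow> z \<in> {0..H} \<Longrightarrow> (s, slope z) \<in> X"
  using slope_pairs_mem[of s z "\<theta> z"] \<theta>_mem[of z] closure_subset by (auto simp: W_iff X_def slope_eq)

lemma cost_inner: "cost (s, z) m q = (s, z / m) \<bullet> q"
  by (cases q) (simp add: cost_def inner_prod_def)

text \<open>The supremum over the dense set of attained slope points is the supremum over its compact closure.\<close>

lemma SUP_slope_pairs:
  assumes p: "continuous_on UNIV p" and P: "\<And>s z m. (s, z) \<in> W_set r\<^sub>0 H \<Longrightarrow> m \<in> I \<Longrightarrow> P ((s, z), m) = p (s, z / m)"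
  shows "(SUP (x, m) \<in> W_set r\<^sub>0 H \<times> I. cost x m q - P (x, m)) = legendre X p q"
proof -
  have pX: "continuous_on X p" by (rule continuous_on_subset[OF p]) simp
  have "(\<lambda>(x, m). cost x m q - P (x, m)) ` (W_set r\<^sub>0 H \<times> I) = (\<lambda>x. q \<bullet> x - p x) ` slope_pairs"
    unfolding slope_pairs_def image_image
    by (intro image_cong refl) (auto simp: cost_inner P inner_commute)
  moreover have "(SUP x\<in>slope_pairs. q \<bullet> x - p x) = legendre X p q"
  proof (rule antisym)
    show "(SUP x\<in>slope_pairs. q \<bullet> x - p x) \<le> legendre X p q"
      by (rule cSUP_least[OF slope_pairs_ne legendre_ge[OF X_comp pX]]) (use closure_subset in \<open>auto simp: X_def\<close>)
    have bdd: "bdd_above ((\<lambda>x. q \<bullet> x - p x) ` slope_pairs)"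
      by (rule bdd_above_mono[OF legendre_bdd[OF X_comp pX]]) (use closure_subset in \<open>auto simp: X_def\<close>)
    show "legendre X p q \<le> (SUP x\<in>slope_pairs. q \<bullet> x - p x)"
    proof (rule legendre_least[OF X_nonempty])
      fix x assume "x \<in> X"
      then show "q \<bullet> x - p x \<le> (SUP x\<in>slope_pairs. q \<bullet> x - p x)"
        unfolding X_def
        by (rule continuous_le_on_closure[rotated])
          (auto intro!: continuous_intros continuous_on_subset[OF p] cSUP_upper bdd)
    qed
  qed
  ultimately show ?thesis by simp
qed

text \<open>The cost involves \<open>(s, z, m)\<close> through \<open>(s, z / m)\<close> only, which turns the two suprema in the
  definition of \<open>U0_set\<close> into Legendre transforms.\<close>

lemma U0D:
  assumes "(P, \<Psi>) \<in> U0_set r\<^sub>0 H I l"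
  shows "continuous_on Q \<Psi>" "continuous_on (closure (ball (0, 0) l)) \<Psi>" "(P, \<Psi>) \<in> U_set r\<^sub>0 H I l"
    "(s, z) \<in> W_set r\<^sub>0 H \<Longrightarrow> m \<in> I \<Longrightarrow> P ((s, z), m) = legendre Q \<Psi> (s, z / m)"
    "q \<in> ball (0, 0) l \<Longrightarrow> \<Psi> q = legendre X (legendre Q \<Psi>) q"
proof -
  show c: "continuous_on (closure (ball (0, 0) l)) \<Psi>" and "(P, \<Psi>) \<in> U_set r\<^sub>0 H I l"
    using assms by (auto simp: U0_set_def U_set_def)
  show cQ: "continuous_on Q \<Psi>" by (rule continuous_on_subset[OF c Q_cball])
  have P: "P ((s, z), m) = legendre Q \<Psi> (s, z / m)" if "(s, z) \<in> W_set r\<^sub>0 H" "m \<in> I" for s z m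
    using assms that unfolding U0_set_def legendre_def Q_def cost_inner[symmetric] by blast
  then show "(s, z) \<in> W_set r\<^sub>0 H \<Longrightarrow> m \<in> I \<Longrightarrow> P ((s, z), m) = legendre Q \<Psi> (s, z / m)" .
  assume "q \<in> ball (0, 0) l"
  then have "\<Psi> q = (SUP (x, m) \<in> W_set r\<^sub>0 H \<times> I. cost x m q - P (x, m))"
    using assms unfolding U0_set_def by blast
  also have "\<dots> = legendre X (legendre Q \<Psi>) q"
    by (rule SUP_slope_pairs[OF legendre_continuous[OF Q_comp cQ Q_nonempty] P])
  finally show "\<Psi> q = legendre X (legendre Q \<Psi>) q" .
qed

text \<open>Transforming twice produces a member of \<open>U0_set\<close> from any continuous function on \<open>Q\<close>.\<close>

lemma U0_construct:
  assumes \<psi>: "continuous_on Q \<psi>"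
  shows "((\<lambda>((s, z), m). legendre Q \<psi> (s, z / m)), legendre X (legendre Q \<psi>)) \<in> U0_set r\<^sub>0 H I l"
proof -
  define p where "p = legendre Q \<psi>"
  define P where "P = (\<lambda>((s, z), m). p (s, z / m))"
  define \<Psi> where "\<Psi> = legendre X p"
  have pc: "continuous_on A p" for A unfolding p_def by (rule legendre_continuous[OF Q_comp \<psi> Q_nonempty])
  have \<Psi>c: "continuous_on A \<Psi>" for A unfolding \<Psi>_def by (rule legendre_continuous[OF X_comp pc X_nonempty])
  have Pe: "P ((s, z), m) = p (s, z / m)" for s z m by (simp add: P_def)
  have X_in: "(s, z / m) \<in> X" if "(s, z) \<in> W_set r\<^sub>0 H" "m \<in> I" for s z m
    using slope_pairs_mem[OF that] closure_subset by (auto simp: X_def)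
  have bi: "p x = legendre Q \<Psi> x" if "x \<in> X" for x
    unfolding p_def \<Psi>_def by (rule legendre_biconjugate[OF Q_comp \<psi> Q_nonempty X_comp that, symmetric])
  have Pc: "continuous_on (closure (W_set r\<^sub>0 H) \<times> closure I) P"
    unfolding P_def case_prod_beta'
    by (rule continuous_on_compose2[OF pc[of UNIV]]) (use I_away in \<open>auto intro!: continuous_intros\<close>)
  have 1: "P (x, m) = (SUP q\<in>closure (Bplus l). cost x m q - \<Psi> q)" if "x \<in> W_set r\<^sub>0 H" "m \<in> I" for x m
  proof (cases x)
    case (Pair s z)
    then show ?thesis using bi[OF X_in[of s z m]] that by (simp add: Pe cost_inner legendre_def Q_def)
  qed
  have 2: "\<Psi> q = (SUP (x, m) \<in> W_set r\<^sub>0 H \<times> I. cost x m q - P (x, m))" for q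
    unfolding \<Psi>_def by (rule SUP_slope_pairs[OF pc Pe, symmetric])
  have 3: "cost x m q \<le> P (x, m) + \<Psi> q" if x: "x \<in> W_set r\<^sub>0 H" "m \<in> I" for x m q
  proof (cases x)
    case (Pair s z)
    then show ?thesis using legendre_ge[OF X_comp pc X_in[of s z m], of q] x
      by (simp add: Pe cost_inner \<Psi>_def inner_commute)
  qed
  have "(P, \<Psi>) \<in> U0_set r\<^sub>0 H I l"
    unfolding U0_set_def U_set_def using Pc \<Psi>c 1 2 3 by auto
  then show ?thesis by (simp add: P_def \<Psi>_def p_def)
qed

end

locale problem_sigma = problem +
  fixes \<sigma> :: "(real \<times> real) measure"
  assumes \<sigma>_bp: "\<sigma> \<in> borel_prob" and \<sigma>Q: "AE q in \<sigma>. q \<in> Q" and \<sigma>pos: "AE q in \<sigma>. snd q > 0"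
begin

sublocale dual_X r\<^sub>0 H \<Omega> slope Q \<sigma> X
proof -
  have s: "sets \<sigma> = sets borel" "prob_space \<sigma>" using \<sigma>_bp by (auto simp: borel_prob_def)
  interpret prob_space \<sigma> by (rule s(2))
  show "dual_X r\<^sub>0 H \<Omega> slope Q \<sigma> X"
    by unfold_locales (rule s \<sigma>Q \<sigma>pos Q_comp Q_nonempty Q_nn X_comp X_nn X_sh; assumption)+
qed

sublocale dual_theta r\<^sub>0 H \<Omega> slope Q \<sigma> \<theta>
  by unfold_locales (rule slope_eq)

lemma S_fun_energy:
  assumes P: "\<And>s. 0 \<le> s \<Longrightarrow> s < smax \<Longrightarrow> P ((s, z), \<theta> z) = p (s, slope z)" and "pot p" "r < smax"
  shows "S_fun r\<^sub>0 \<Omega> \<theta> P r z = energy p (slope z) r"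
proof -
  have "S_fun r\<^sub>0 \<Omega> \<theta> P r z = (LINT s:{0..r}|lborel. (f0 r\<^sub>0 \<Omega> s - p (s, slope z)) * weight s)"
    unfolding S_fun_def weight_def by (rule set_lebesgue_integral_cong) (use assms in auto)
  then show ?thesis using energy_lebesgue(2)[OF assms(2,3)] by simp
qed

lemma lowest_profile_R_set: "column_convex p \<Longrightarrow> lowest_profile p \<in> R_set r\<^sub>0 H"
  using lowest_profile_borel[of p] lowest_highest(1)[of p] column_convexD(1)[of p]
  by (auto simp: R_set_def lowest_profile_def minimizers_def smax_def intro: measurable_restrict_space1)

text \<open>The infimum over profiles can be taken inside the integral, because the lowest optimal heights
  form a Borel profile.\<close>

lemma H_fun_eq:
  assumes \<psi>: "continuous_on Q \<psi>" and P: "\<And>s z. (s, z) \<in> W_set r\<^sub>0 H \<Longrightarrow> P ((s, z), \<theta> z) = legendre Q \<psi> (s, slope z)"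
  shows "H_fun r\<^sub>0 H \<Omega> \<theta> P = ereal (total_energy (legendre Q \<psi>))"
proof -
  define p where "p = legendre Q \<psi>"
  have pc: "column_convex p" unfolding p_def by (rule legendre_col[OF \<psi>])
  note pp = column_convexD(1)[OF pc]
  have S: "S_fun r\<^sub>0 \<Omega> \<theta> P r z = energy p (slope z) r" if "z \<in> {0..H}" "r < smax" for r z
    by (rule S_fun_energy) (use P that pp in \<open>auto simp: W_iff p_def\<close>)
  have hi: "set_integrable lborel {0..H} (\<lambda>z. min_energy p (slope z))" unfolding p_def by (rule min_energy_legendre_integrable[OF \<psi>])
  note h = ext_integral_real[OF hi, folded total_energy_def]
  have "H_fun r\<^sub>0 H \<Omega> \<theta> P = ereal (total_energy p)"
    unfolding H_fun_def
  proof (rule antisym)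
    have "ext_integral lborel {0..H} (\<lambda>z. S_fun r\<^sub>0 \<Omega> \<theta> P (lowest_profile p z) z) = ext_integral lborel {0..H} (\<lambda>z. min_energy p (slope z))"
      by (intro ext_integral_cong AE_I2) (use lowest_profile_R_set[OF pc] in \<open>auto simp: S min_energy_def lowest_profile_def R_set_def smax_def\<close>)
    then show "(INF \<rho>\<in>R_set r\<^sub>0 H. ext_integral lborel {0..H} (\<lambda>z. S_fun r\<^sub>0 \<Omega> \<theta> P (\<rho> z) z)) \<le> ereal (total_energy p)"
      by (intro INF_lower2[OF lowest_profile_R_set[OF pc]]) (simp add: h)
    show "ereal (total_energy p) \<le> (INF \<rho>\<in>R_set r\<^sub>0 H. ext_integral lborel {0..H} (\<lambda>z. S_fun r\<^sub>0 \<Omega> \<theta> P (\<rho> z) z))"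
      unfolding h[symmetric]
      by (intro INF_greatest ext_integral_mono AE_I2) (auto simp: S R_set_def smax_def[symmetric] intro!: min_energy_le[OF pp])
  qed
  then show ?thesis by (simp add: p_def)
qed

lemma J_fun_eq:
  assumes "(P, \<Psi>) \<in> U0_set r\<^sub>0 H I l"
  shows "J_fun r\<^sub>0 H \<Omega> \<theta> l \<sigma> P \<Psi> = ereal (dual_value \<Psi>)"
proof -
  note U = U0D[OF assms]
  have 1: "H_fun r\<^sub>0 H \<Omega> \<theta> P = ereal (total_energy (legendre Q \<Psi>))"
    by (rule H_fun_eq[OF U(1)]) (simp add: U(4) \<theta>_mem W_iff slope_eq)
  have m: "(\<lambda>q. indicator (closure (ball (0, 0) l)) q *\<^sub>R \<Psi> q) \<in> borel_measurable borel"
    "(\<lambda>q. indicator Q q *\<^sub>R \<Psi> q) \<in> borel_measurable borel"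
    by (rule borel_measurable_continuous_on_indicator[OF borel_closed[OF closed_closure] U(2)],
        rule borel_measurable_continuous_on_indicator[OF Q_borel U(1)])
  have "(LINT q:closure (ball (0, 0) l)|\<sigma>. \<Psi> q) = (LINT q:Q|\<sigma>. \<Psi> q)"
    unfolding set_lebesgue_integral_def
  proof (rule integral_cong_AE)
    show "AE q in \<sigma>. indicator (closure (ball (0, 0) l)) q *\<^sub>R \<Psi> q = indicator Q q *\<^sub>R \<Psi> q"
      using \<sigma>Q by eventually_elim (use Q_cball in auto)
  qed (use m in \<open>simp_all add: measurable_cong_sets[OF \<sigma>_sets refl]\<close>)
  then show ?thesis unfolding J_fun_def 1 by (simp add: dual_value_def)
qed

text \<open>Each competitor on \<open>Q\<close> is dominated by a member of \<open>U0_set\<close>, where both functionals agree.\<close>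

lemma J_maximizer_dual_optimal:
  assumes "(P, \<Psi>) \<in> U0_set r\<^sub>0 H I l" "J_maximizer r\<^sub>0 H \<Omega> \<theta> I l \<sigma> P \<Psi>"
  shows "dual_optimal \<Psi>"
  unfolding dual_optimal_def
proof (intro conjI allI impI)
  show "continuous_on Q \<Psi>" by (rule U0D(1)[OF assms(1)])
  fix \<psi> :: "real \<times> real \<Rightarrow> real" assume \<psi>: "continuous_on Q \<psi>"
  note C = U0_construct[OF \<psi>]
  have "dual_value \<psi> \<le> dual_value (legendre X (legendre Q \<psi>))" by (rule dual_value_biconjugate[OF \<psi>])
  moreover have "ereal (dual_value (legendre X (legendre Q \<psi>))) \<le> ereal (dual_value \<Psi>)"
    using assms(2) U0D(3)[OF C] unfolding J_maximizer_def J_fun_eq[OF C, symmetric] J_fun_eq[OF assms(1), symmetric] by blast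
  ultimately show "dual_value \<psi> \<le> dual_value \<Psi>" by simp
qed

end

section \<open>Gradients and free boundary of a dual maximizer\<close>

lemma dir_smooth_partial_fst:
  assumes sub: "\<And>x. subgrads F x \<noteq> {}" and fl: "dir_smooth (1, 0) F (s, y)"
  shows "((\<lambda>t. F (t, y)) has_real_derivative dir_deriv (1, 0) F (s, y)) (at s)"
proof -
  obtain g where g: "g \<in> subgrads F (s, y)" using sub by blast
  have "((\<lambda>t. F (t + s, y)) has_real_derivative dir_deriv (1, 0) F (s, y)) (at 0)"
    using dir_smooth_imp_has_derivative[OF sub fl g] by (simp add: dir_smooth_subgrad[OF sub fl g] add.commute)
  then show ?thesis using DERIV_shift[of "\<lambda>t. F (t, y)" _ 0 s] by simp
qed

lemma dir_smooth_partial_snd: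
  assumes sub: "\<And>x. subgrads F x \<noteq> {}" and fl: "dir_smooth (0, 1) F (s, y)"
  shows "((\<lambda>t. F (s, t)) has_real_derivative dir_deriv (0, 1) F (s, y)) (at y)"
proof -
  obtain g where g: "g \<in> subgrads F (s, y)" using sub by blast
  have "((\<lambda>t. F (s, t + y)) has_real_derivative dir_deriv (0, 1) F (s, y)) (at 0)"
    using dir_smooth_imp_has_derivative[OF sub fl g] by (simp add: dir_smooth_subgrad[OF sub fl g] add.commute)
  then show ?thesis using DERIV_shift[of "\<lambda>t. F (s, t)" _ 0 y] by simp
qed

context column
begin

text \<open>A left limit of lowest optimal heights is optimal and not above the lowest one.\<close>

lemma lowest_profile_left_limit:
  assumes p: "column_convex p" and L: "\<And>s y y'. \<bar>p (s, y) - p (s, y')\<bar> \<le> L * \<bar>y - y'\<bar>"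
    and z: "z \<in> {0..H}" and zn: "\<And>n. zn n \<le> z" "zn \<longlonglongrightarrow> z" and lim: "(\<lambda>n. lowest_profile p (zn n)) \<longlonglongrightarrow> a"
  shows "a = lowest_profile p z"
proof -
  note pp = column_convexD(1)[OF p]
  have "lowest_profile p (zn n) \<le> lowest_profile p z" for n using lowest_profile_mono[OF p] zn(1) by (auto dest: monoD)
  then have le: "a \<le> lowest_profile p z" by (intro LIMSEQ_le_const2[OF lim]) auto
  have am: "lowest_profile p z \<in> minimizers p (slope z)" unfolding lowest_profile_def by (rule lowest_highest(1)[OF pp])
  have "a \<in> minimizers p (slope z)"
  proof (rule minimizers_limit[where p=p and pn="\<lambda>_. p" and r="\<lambda>n. lowest_profile p (zn n)" and r'=a and y="slope z" and yn="\<lambda>n. slope (zn n)"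
        and e="\<lambda>n. L * \<bar>slope (zn n) - slope z\<bar>", OF pp pp _ lim])
    show "lowest_profile p (zn n) \<in> minimizers p (slope (zn n))" for n unfolding lowest_profile_def by (rule lowest_highest(1)[OF pp])
    show "a < smax" using le am by (simp add: minimizers_def)
    show "\<bar>p (s, slope (zn n)) - p (s, slope z)\<bar> \<le> L * \<bar>slope (zn n) - slope z\<bar>" for n s by (rule L)
    have "(\<lambda>n. slope (zn n)) \<longlonglongrightarrow> slope z"
      using continuous_on_tendsto_compose[OF slope_cont zn(2)] by simp
    then have "(\<lambda>n. L * \<bar>slope (zn n) - slope z\<bar>) \<longlonglongrightarrow> L * \<bar>slope z - slope z\<bar>" by (intro tendsto_intros)
    then show "(\<lambda>n. L * \<bar>slope (zn n) - slope z\<bar>) \<longlonglongrightarrow> 0" by simp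
  qed
  then have "lowest_profile p z \<le> a" unfolding lowest_profile_def by (rule lowest_highest(3)[OF pp])
  with le show ?thesis by simp
qed

text \<open>By left continuity, lowest profiles that agree almost everywhere agree at every positive height;
  this makes one representative serve all dual maximizers.\<close>

lemma lowest_profile_eq_of_AE:
  assumes p: "column_convex p" "\<And>s y y'. \<bar>p (s, y) - p (s, y')\<bar> \<le> L * \<bar>y - y'\<bar>"
    and p': "column_convex p'" "\<And>s y y'. \<bar>p' (s, y) - p' (s, y')\<bar> \<le> L * \<bar>y - y'\<bar>"
    and ae: "AE z in lborel. z \<in> {0..H} \<longrightarrow> lowest_profile p z = lowest_profile p' z" and z: "z \<in> {0<..H}"
  shows "lowest_profile p z = lowest_profile p' z"
proof -
  have "\<exists>w. max 0 (z - 1 / Suc n) < w \<and> w < z \<and> lowest_profile p w = lowest_profile p' w" for n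
  proof (rule ccontr)
    assume "\<not> ?thesis"
    then have "AE w in lborel. w \<notin> {max 0 (z - 1 / Suc n)<..<z}"
      using ae z by (auto elim!: eventually_mono)
    moreover have "{max 0 (z - 1 / Suc n)<..<z} \<in> sets lborel" by simp
    ultimately have "emeasure lborel {max 0 (z - 1 / Suc n)<..<z} = 0"
      using AE_iff_null_sets null_setsD1 by blast
    moreover have "max 0 (z - 1 / Suc n) < z" using z by (auto simp: max_def)
    ultimately show False by simp
  qed
  then obtain zn where zn: "\<And>n. max 0 (z - 1 / Suc n) < zn n \<and> zn n < z \<and> lowest_profile p (zn n) = lowest_profile p' (zn n)" by metis
  have lim: "zn \<longlonglongrightarrow> z"
  proof (rule tendsto_sandwich[OF _ _ _ tendsto_const])
    have "(\<lambda>n. z - 1 / Suc n) \<longlonglongrightarrow> z - 0" by (intro tendsto_intros LIMSEQ_Suc[OF lim_1_over_n])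
    then show "(\<lambda>n. z - 1 / Suc n) \<longlonglongrightarrow> z" by simp
    show "\<forall>\<^sub>F n in sequentially. z - 1 / Suc n \<le> zn n" "\<forall>\<^sub>F n in sequentially. zn n \<le> z"
      by (rule always_eventually, rule allI, use zn in \<open>fastforce intro: less_imp_le\<close>)+
  qed
  obtain t where t: "0 < t" "t < smax" "\<And>z. z \<in> {0..H} \<Longrightarrow> minimizers p (slope z) \<subseteq> {0..t}"
    by (rule minimizers_column_bound[OF p(1)]) blast
  have "zn n \<in> {0..H}" for n using zn[of n] z by auto
  then have "lowest_profile p (zn n) \<in> {0..t}" for n
    using subsetD[OF t(3) lowest_highest(1)[OF column_convexD(1)[OF p(1)]]] unfolding lowest_profile_def by blast
  from compact_Icc[of 0 t, unfolded compact_def, rule_format, of "\<lambda>n. lowest_profile p (zn n)", OF this]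
  obtain a k where k: "strict_mono k" "((\<lambda>n. lowest_profile p (zn n)) \<circ> k) \<longlonglongrightarrow> a" by blast
  have lk: "(\<lambda>n. zn (k n)) \<longlonglongrightarrow> z" using LIMSEQ_subseq_LIMSEQ[OF lim k(1)] by (simp add: o_def)
  have le: "zn (k n) \<le> z" for n using zn[of "k n"] by simp
  have 1: "(\<lambda>n. lowest_profile p (zn (k n))) \<longlonglongrightarrow> a" using k(2) by (simp add: o_def)
  have 2: "(\<lambda>n. lowest_profile p' (zn (k n))) \<longlonglongrightarrow> a" using 1 zn by simp
  have z': "z \<in> {0..H}" using z by auto
  show ?thesis
    using lowest_profile_left_limit[OF p z' le lk 1] lowest_profile_left_limit[OF p' z' le lk 2] by simp
qed

end

context problem
begin

text \<open>The derivatives in \<open>T_map\<close> are taken at fixed \<open>m\<close>; the factor \<open>\<theta> z\<close> cancels the inner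
  derivative of \<open>z / m\<close>.\<close>

lemma T_map_eq:
  assumes U: "(P, \<Psi>) \<in> U0_set r\<^sub>0 H I l" and reg: "regular (legendre Q \<Psi>) (s, slope z)"
    and s: "0 < s" "s < smax" and z: "0 < z" "z < H"
  shows "T_map \<theta> P (s, z) = rgrad (legendre Q \<Psi>) (s, slope z)"
proof -
  define p where "p = legendre Q \<Psi>"
  define m where "m = \<theta> z"
  have m: "m \<in> I" "m > 0" using \<theta>_mem[of z] \<theta>_pos[of z] z by (auto simp: m_def)
  have y: "slope z = z / m" using slope_eq[of z] z by (simp add: m_def)
  have sub: "\<And>x. subgrads p x \<noteq> {}" unfolding p_def by (rule legendre_subgrads_nonempty[OF Q_comp U0D(1)[OF U] Q_nonempty])
  have f1: "dir_smooth (1, 0) p (s, z / m)" "dir_smooth (0, 1) p (s, z / m)" using reg by (simp_all add: regular_def p_def y)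
  have P: "P ((s, z), m) = p (s, z / m)" if "0 \<le> s" "s < smax" "z \<in> {0..H}" for s z
    unfolding p_def by (rule U0D(4)[OF U]) (use that m in \<open>auto simp: W_iff\<close>)
  have "((\<lambda>t. P ((t, z), m)) has_real_derivative dir_deriv (1, 0) p (s, z / m)) (at s)"
    by (rule has_field_derivative_transform_within_open[OF dir_smooth_partial_fst[OF sub f1(1)], of "{0<..<smax}"])
      (use s z P in auto)
  then have 1: "ds P ((s, z), m) = dir_deriv (1, 0) p (s, z / m)" unfolding ds_def by (simp add: DERIV_imp_deriv)
  have "((\<lambda>t. p (s, t / m)) has_real_derivative dir_deriv (0, 1) p (s, z / m) * (1 / m)) (at z)"
    by (rule DERIV_chain2[where f="\<lambda>u. p (s, u)" and g="\<lambda>t. t / m", OF dir_smooth_partial_snd[OF sub f1(2)]])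
      (use m(2) in \<open>auto intro!: derivative_eq_intros\<close>)
  then have "((\<lambda>t. P ((s, t), m)) has_real_derivative dir_deriv (0, 1) p (s, z / m) * (1 / m)) (at z)"
    by (rule has_field_derivative_transform_within_open[of _ _ _ "{0<..<H}"]) (use s z P in auto)
  then have 2: "dz P ((s, z), m) = dir_deriv (0, 1) p (s, z / m) * (1 / m)" unfolding dz_def by (simp add: DERIV_imp_deriv)
  show ?thesis
    using 1 2 m(2) by (simp add: T_map_def rgrad_def p_def[symmetric] y m_def[symmetric])
qed

lemma S_map_eq:
  assumes U: "(P, \<Psi>) \<in> U0_set r\<^sub>0 H I l" and reg: "regular (legendre X (legendre Q \<Psi>)) q" and q: "q \<in> ball (0, 0) l"
  shows "S_map H \<theta> \<Psi> q = (fst (rgrad (legendre X (legendre Q \<Psi>)) q),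
     the_inv_into {0..H} (phi \<theta>) (snd (rgrad (legendre X (legendre Q \<Psi>)) q)))"
proof -
  define F where "F = legendre X (legendre Q \<Psi>)"
  obtain a b where ab: "q = (a, b)" by (cases q)
  have sub: "\<And>x. subgrads F x \<noteq> {}" unfolding F_def
    by (rule legendre_subgrads_nonempty[OF X_comp legendre_continuous[OF Q_comp U0D(1)[OF U] Q_nonempty] X_nonempty])
  have eq: "F q = \<Psi> q" if "q \<in> ball (0, 0) l" for q unfolding F_def by (rule U0D(5)[OF U that, symmetric])
  have fl: "dir_smooth (1, 0) F (a, b)" "dir_smooth (0, 1) F (a, b)" using reg by (simp_all add: regular_def F_def ab)
  have o1: "open ((\<lambda>t. (t, b)) -` ball (0, 0) l)" and o2: "open ((\<lambda>t. (a, t)) -` ball (0, 0) l)"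
    by (rule open_vimage[OF open_ball]; intro continuous_intros)+
  have "((\<lambda>t. \<Psi> (t, b)) has_real_derivative dir_deriv (1, 0) F (a, b)) (at a)"
    by (rule has_field_derivative_transform_within_open[OF dir_smooth_partial_fst[OF sub fl(1)] o1])
      (use q ab eq in auto)
  moreover have "((\<lambda>t. \<Psi> (a, t)) has_real_derivative dir_deriv (0, 1) F (a, b)) (at b)"
    by (rule has_field_derivative_transform_within_open[OF dir_smooth_partial_snd[OF sub fl(2)] o2])
      (use q ab eq in auto)
  ultimately show ?thesis
    unfolding S_map_def F_def[symmetric] by (simp add: ab rgrad_def DERIV_imp_deriv)
qed

lemma phi_zero: "phi \<theta> 0 = 0" by (simp add: phi_def)

lemma phi_inj: "inj_on (phi \<theta>) {0..H}" by (rule strict_mono_on_imp_inj_on[OF phi_strict])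

lemma phi_image: "phi \<theta> ` {0..H} = {0..phi \<theta> H}"
proof
  have "phi \<theta> 0 \<le> phi \<theta> z" "phi \<theta> z \<le> phi \<theta> H" if "z \<in> {0..H}" for z
    using strict_mono_on_leD[OF phi_strict, of 0 z] strict_mono_on_leD[OF phi_strict, of z H] that H_pos by auto
  then show "phi \<theta> ` {0..H} \<subseteq> {0..phi \<theta> H}" using phi_zero by auto
  show "{0..phi \<theta> H} \<subseteq> phi \<theta> ` {0..H}"
  proof
    fix u assume "u \<in> {0..phi \<theta> H}"
    then have "\<exists>x\<ge>0. x \<le> H \<and> phi \<theta> x = u" using phi_zero H_pos phi_cont by (intro IVT') auto
    then show "u \<in> phi \<theta> ` {0..H}" by auto
  qed
qed

text \<open>Clamping the argument to the range of \<open>phi \<theta>\<close> makes the inverse monotone on all reals,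
  hence Borel.\<close>

definition phinv :: "real \<Rightarrow> real" where
  "phinv u = the_inv_into {0..H} (phi \<theta>) (max 0 (min (phi \<theta> H) u))"

lemma phi_H_nonneg: "0 \<le> phi \<theta> H" using \<theta>_pos[of H] H_pos by (simp add: phi_def)

lemma phinv_borel [measurable]: "phinv \<in> borel_measurable borel"
proof (rule borel_measurable_mono, rule monoI)
  fix u v :: real assume "u \<le> v"
  define c where "c u = max 0 (min (phi \<theta> H) u)" for u
  have c: "c u \<in> phi \<theta> ` {0..H}" for u unfolding phi_image c_def using phi_H_nonneg by auto
  have inv: "phinv u \<in> {0..H}" "phi \<theta> (phinv u) = c u" for u
    using the_inv_into_into[OF phi_inj c subset_refl, of u] f_the_inv_into_f[OF phi_inj c, of u]
    by (simp_all add: phinv_def c_def)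
  show "phinv u \<le> phinv v"
  proof (rule ccontr)
    assume "\<not> ?thesis"
    then have "c v < c u" using strict_mono_onD[OF phi_strict inv(1) inv(1), of v u] inv(2) by simp
    then show False using \<open>u \<le> v\<close> by (auto simp: c_def)
  qed
qed

lemma phinv_eq: "u \<in> {0..phi \<theta> H} \<Longrightarrow> phinv u = the_inv_into {0..H} (phi \<theta>) u"
  by (simp add: phinv_def max_def min_def) (metis antisym)

lemma slope_phi: "z \<in> {0..H} \<Longrightarrow> slope z = phi \<theta> z" by (simp add: slope_eq phi_def)

lemma phi_inverse: "z \<in> {0..H} \<Longrightarrow> the_inv_into {0..H} (phi \<theta>) (slope z) = z"
  by (simp add: slope_phi the_inv_into_f_f[OF phi_inj])

lemma slope_range: "z \<in> {0..H} \<Longrightarrow> slope z \<in> {0..phi \<theta> H}"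
  using phi_image slope_phi by blast

text \<open>Near a point where \<open>p (r, \<cdot>)\<close> takes equal values at two slopes, convexity bounds the
  increment from below by \<open>b\<^sub>0\<close> times the height difference at almost every point, so this
  bound also holds in the limit.\<close>

lemma column_strict:
  assumes U: "(P, \<Psi>) \<in> U0_set r\<^sub>0 H I l" and b: "b\<^sub>0 > 0"
    and ae: "AE x in lborel. x \<in> W_set r\<^sub>0 H \<times> I \<longrightarrow> dz P x \<ge> b\<^sub>0"
    and z: "0 < z\<^sub>1" "z\<^sub>1 < z\<^sub>2" "z\<^sub>2 \<le> H" and r: "0 < r" "r < smax"
  shows "legendre Q \<Psi> (r, slope z\<^sub>1) \<noteq> legendre Q \<Psi> (r, slope z\<^sub>2)"
proof
  define p where "p = legendre Q \<Psi>"
  assume "legendre Q \<Psi> (r, slope z\<^sub>1) = legendre Q \<Psi> (r, slope z\<^sub>2)"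
  then have eq: "p (r, slope z\<^sub>1) = p (r, slope z\<^sub>2)" by (simp add: p_def)
  have pc: "continuous_on A p" for A unfolding p_def by (rule legendre_continuous[OF Q_comp U0D(1)[OF U] Q_nonempty])
  have sub: "\<And>x. subgrads p x \<noteq> {}" unfolding p_def by (rule legendre_subgrads_nonempty[OF Q_comp U0D(1)[OF U] Q_nonempty])
  define m where "m = \<theta> z\<^sub>2"
  have m: "m \<in> I" "m > 0" using \<theta>_mem[of z\<^sub>2] \<theta>_pos[of z\<^sub>2] z by (auto simp: m_def)
  have y2: "slope z\<^sub>2 = z\<^sub>2 / m" using slope_eq[of z\<^sub>2] z by (simp add: m_def)
  \<comment> \<open>The height whose slope is that of \<open>z\<^sub>1\<close> once \<open>m\<close> is fixed to \<open>\<theta> z\<^sub>2\<close>; it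
    allows a comparison of \<open>P\<close> at a single value of \<open>m\<close>.\<close>
  define w where "w = m * slope z\<^sub>1"
  have w: "0 < w" "w < z\<^sub>2" "w / m = slope z\<^sub>1"
  proof -
    have "0 < slope z\<^sub>1" using slope_eq[of z\<^sub>1] \<theta>_pos[of z\<^sub>1] z by simp
    then show "0 < w" using m by (simp add: w_def)
    have "slope z\<^sub>1 < z\<^sub>2 / m" using strict_mono_onD[OF slope_strictly, of z\<^sub>1 z\<^sub>2] z by (simp add: y2)
    then show "w < z\<^sub>2" using m by (simp add: w_def field_simps)
    show "w / m = slope z\<^sub>1" using m by (simp add: w_def)
  qed
  \<comment> \<open>Negativity of \<open>F\<close> contradicts the increment bound. It holds at \<open>((r, w), m)\<close>, hence on an open
    set, which cannot be null.\<close>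
  define F where "F x = p (fst (fst x), z\<^sub>2 / snd x) - p (fst (fst x), snd (fst x) / snd x) - b\<^sub>0 * (z\<^sub>2 - snd (fst x))"
    for x :: "(real \<times> real) \<times> real"
  define B where "B = ({0<..<smax} \<times> {0<..<z\<^sub>2}) \<times> I"
  have Bo: "open B" unfolding B_def by (intro open_Times open_greaterThanLessThan I_open)
  have Fc: "continuous_on B F"
    unfolding F_def
    by (intro continuous_intros continuous_on_compose2[OF pc[of UNIV]]) (use I_pos in \<open>auto simp: B_def\<close>)
  define G where "G = B \<inter> F -` {..<0}"
  have Go: "open G" unfolding G_def by (rule continuous_open_preimage[OF Fc Bo open_lessThan])
  have "((r, w), m) \<in> G" using r w m eq b by (simp add: G_def B_def F_def y2[symmetric])
  then have Gne: "G \<noteq> {}" by blast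
  have bad: "F ((s, z), m') \<ge> 0"
    if x: "((s, z), m') \<in> B" and d: "dz P ((s, z), m') \<ge> b\<^sub>0" and fl: "dir_smooth (0, 1) p (s, z / m')" for s z m'
  proof -
    have h: "0 < s" "s < smax" "0 < z" "z < z\<^sub>2" "m' \<in> I" "m' > 0" using x I_pos by (auto simp: B_def)
    obtain g where g: "g \<in> subgrads p (s, z / m')" using sub by blast
    define D where "D = dir_deriv (0, 1) p (s, z / m')"
    have "((\<lambda>t. p (s, t / m')) has_real_derivative D * (1 / m')) (at z)"
      unfolding D_def by (rule DERIV_chain2[where f="\<lambda>u. p (s, u)" and g="\<lambda>t. t / m'", OF dir_smooth_partial_snd[OF sub fl]])
        (use h in \<open>auto intro!: derivative_eq_intros\<close>)
    then have "((\<lambda>t. P ((s, t), m')) has_real_derivative D * (1 / m')) (at z)"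
      by (rule has_field_derivative_transform_within_open[of _ _ _ "{0<..<H}"])
        (use h assms(5,6) in \<open>auto simp: p_def intro!: U0D(4)[OF U, symmetric] simp: W_iff\<close>)
    then have "dz P ((s, z), m') = D / m'" unfolding dz_def by (simp add: DERIV_imp_deriv)
    then have D: "D \<ge> b\<^sub>0 * m'" using mult_right_mono[OF d, of m'] h by simp
    have "g \<bullet> (0, 1) = D" unfolding D_def by (rule dir_smooth_subgrad[OF sub fl g, symmetric])
    then have gD: "snd g = D" by (simp add: inner_prod_def)
    have "p (s, z / m') + g \<bullet> ((s, z\<^sub>2 / m') - (s, z / m')) \<le> p (s, z\<^sub>2 / m')" using g unfolding subgrads_def by blast
    then have "p (s, z / m') + D * (z\<^sub>2 / m' - z / m') \<le> p (s, z\<^sub>2 / m')" by (simp add: inner_prod_def gD)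
    moreover have "b\<^sub>0 * m' * (z\<^sub>2 / m' - z / m') \<le> D * (z\<^sub>2 / m' - z / m')"
      using D h by (intro mult_right_mono) (auto simp: divide_right_mono)
    moreover have "b\<^sub>0 * m' * (z\<^sub>2 / m' - z / m') = b\<^sub>0 * (z\<^sub>2 - z)" using h by (simp add: field_simps)
    ultimately show ?thesis by (simp add: F_def)
  qed
  have "AE x in lborel \<Otimes>\<^sub>M lborel. x \<in> W_set r\<^sub>0 H \<times> I \<longrightarrow> dz P x \<ge> b\<^sub>0" unfolding lborel_prod by (rule ae)
  from lborel_pair.AE_pair[OF this]
  have "AE x in lborel. AE m' in lborel. (x, m') \<notin> G"
  proof eventually_elim
    case (elim x)
    obtain s z where x: "x = (s, z)" by (cases x)
    have cz: "countable {m' \<in> {0<..}. \<not> dir_smooth (0, 1) p (s, z / m')}" if "z > 0"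
    proof (rule countable_image_inj_on)
      show "inj_on (\<lambda>m'. z / m') {m' \<in> {0<..}. \<not> dir_smooth (0, 1) p (s, z / m')}"
        using that by (auto intro!: inj_onI simp: field_simps)
      show "countable ((\<lambda>m'. z / m') ` {m' \<in> {0<..}. \<not> dir_smooth (0, 1) p (s, z / m')})"
        by (rule countable_subset[OF _ countable_not_dir_smooth[OF sub, of "(0, 1)" "(s, 0)"]]) auto
    qed
    have c: "AE m' in lborel. z > 0 \<longrightarrow> m' \<notin> {m' \<in> {0<..}. \<not> dir_smooth (0, 1) p (s, z / m')}"
    proof (cases "z > 0")
      case True
      from AE_not_in[OF countable_imp_null_set_lborel[OF cz[OF True]]] show ?thesis
        by (rule eventually_mono) blast
    qed simp
    from elim c show ?case
    proof eventually_elim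
      case (elim m')
      show ?case
      proof
        assume g: "(x, m') \<in> G"
        then have h: "((s, z), m') \<in> B" "F ((s, z), m') < 0" by (auto simp: G_def x)
        then have "((s, z), m') \<in> W_set r\<^sub>0 H \<times> I" "z > 0" "m' > 0" using assms(5,6) I_pos by (auto simp: B_def W_iff)
        then have "F ((s, z), m') \<ge> 0" using elim by (intro bad h(1)) (auto simp: x)
        then show False using h(2) by simp
      qed
    qed
  qed
  moreover have "{x \<in> space (lborel \<Otimes>\<^sub>M lborel). x \<notin> G} \<in> sets (lborel \<Otimes>\<^sub>M lborel)"
    unfolding lborel_prod using Go by (simp add: Collect_neg_eq)
  ultimately have "AE x in lborel \<Otimes>\<^sub>M lborel. x \<notin> G" by (intro lborel_pair.AE_pair_measure)
  then have "G \<in> null_sets lborel" unfolding lborel_prod using Go by (simp add: AE_iff_null_sets)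
  then have "negligible G" by (simp add: negligible_iff_null_sets null_sets_completionI)
  then show False using open_not_negligible[OF Go Gne] by simp
qed

end

section \<open>Inverse transport and uniqueness of potentials\<close>

text \<open>The complement of the support is covered by those members of a countable basis that are null sets.\<close>

lemma AE_spt:
  fixes M :: "'a::second_countable_topology measure"
  assumes [simp]: "sets M = sets borel"
  shows "AE x in M. x \<in> spt M"
proof -
  obtain B :: "'a set set" where B: "countable B" "topological_basis B" using ex_countable_basis by blast
  define N where "N = \<Union>{U \<in> B. emeasure M U = 0}"
  have Bo: "open U" if "U \<in> B" for U using topological_basis_open[OF B(2) that] .
  have "(\<Union>U\<in>{U \<in> B. emeasure M U = 0}. U) \<in> null_sets M"
    by (rule null_sets_UN') (use B(1) Bo in \<open>auto intro: countable_subset[OF _ B(1)]\<close>)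
  then have N: "N \<in> null_sets M" by (simp add: N_def)
  have "x \<in> N" if x: "x \<notin> spt M" for x
  proof -
    obtain U where U: "open U" "x \<in> U" "emeasure M U = 0" using x by (auto simp: spt_def)
    obtain V where V: "V \<in> B" "x \<in> V" "V \<subseteq> U" using topological_basisE[OF B(2) U(1,2)] by blast
    have "emeasure M V \<le> emeasure M U" by (rule emeasure_mono[OF V(3)]) (simp add: U(1))
    then show ?thesis using V U(3) by (auto simp: N_def)
  qed
  then show ?thesis using AE_not_in[OF N] by (auto elim!: eventually_mono)
qed

context problem_sigma
begin

lemma Lipschitz_legendre:
  obtains L where "\<And>\<psi> s y y'. continuous_on Q \<psi> \<Longrightarrow> \<bar>legendre Q \<psi> (s, y) - legendre Q \<psi> (s, y')\<bar> \<le> L * \<bar>y - y'\<bar>"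
proof -
  obtain L where L: "\<And>q. q \<in> Q \<Longrightarrow> norm q \<le> L" by (rule Q_norm_bound) blast
  show thesis
  proof (rule that[of L])
    fix \<psi> :: "real \<times> real \<Rightarrow> real" and s y y' assume "continuous_on Q \<psi>"
    then show "\<bar>legendre Q \<psi> (s, y) - legendre Q \<psi> (s, y')\<bar> \<le> L * \<bar>y - y'\<bar>"
      using legendre_lipschitz[OF Q_comp _ Q_nonempty L, of \<psi> "(s, y)" "(s, y')"] by (simp add: norm_prod_def)
  qed
qed

lemma dual_optimal_value: "dual_optimal \<psi> \<Longrightarrow> dual_optimal \<psi>' \<Longrightarrow> dual_value \<psi> = dual_value \<psi>'"
  unfolding dual_optimal_def by (meson order_antisym)

lemma dual_optimal_lowest_profile_AE:
  assumes "dual_optimal \<psi>" "dual_optimal \<psi>'"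
  shows "AE z in lborel. z \<in> {0..H} \<longrightarrow> lowest_profile (legendre Q \<psi>') z = lowest_profile (legendre Q \<psi>) z"
  using strong_duality[OF assms(2)] strong_duality(1)[OF assms(1)] assms(1) dual_optimal_value[OF assms]
  by (intro duality_equality profile_R0) (auto simp: dual_optimal_def)

lemma dual_optimal_lowest_profile_eq:
  assumes "dual_optimal \<psi>" "dual_optimal \<psi>'" "z \<in> {0<..H}"
  shows "lowest_profile (legendre Q \<psi>') z = lowest_profile (legendre Q \<psi>) z"
proof -
  obtain L where L: "\<And>\<psi> s y y'. continuous_on Q \<psi> \<Longrightarrow> \<bar>legendre Q \<psi> (s, y) - legendre Q \<psi> (s, y')\<bar> \<le> L * \<bar>y - y'\<bar>"
    by (rule Lipschitz_legendre) blast
  have c: "continuous_on Q \<psi>" "continuous_on Q \<psi>'" using assms by (auto simp: dual_optimal_def)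
  show ?thesis
    by (rule lowest_profile_eq_of_AE[OF legendre_col[OF c(2)] L[OF c(2)] legendre_col[OF c(1)] L[OF c(1)] dual_optimal_lowest_profile_AE[OF assms(1,2)] assms(3)])
qed

definition ot_map :: "(real \<times> real \<Rightarrow> real) \<Rightarrow> real \<times> real \<Rightarrow> real \<times> real" where
  "ot_map \<psi> x = rgrad (legendre Q \<psi>) (to_slope x)"

lemma ot_map_borel: "continuous_on Q \<psi> \<Longrightarrow> ot_map \<psi> \<in> borel \<rightarrow>\<^sub>M borel"
  unfolding ot_map_def[abs_def]
  by (rule measurable_compose[OF to_slope_borel measurable_rgrad])
    (intro borel_measurable_continuous_onI legendre_continuous Q_comp Q_nonempty)

lemma T_map_AE:
  assumes U: "(P, \<Psi>) \<in> U0_set r\<^sub>0 H I l" and pr: "profile \<rho>"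
  shows "AE x in mu r\<^sub>0 H \<Omega> \<rho>. T_map \<theta> P x = ot_map \<Psi> x"
proof -
  have "AE x in lborel. fst x \<notin> {0::real} \<and> snd x \<notin> {0, H}"
    using AE_fst_notin[of "{0}"] AE_snd_notin[of "{0, H}"] by simp
  then have "AE x in mu r\<^sub>0 H \<Omega> \<rho>. fst x \<noteq> 0 \<and> snd x \<noteq> 0 \<and> snd x \<noteq> H"
    by (intro AE_mu_lborel profileD(1)[OF pr]) (auto elim: eventually_mono)
  with contact_AE[OF U0D(1)[OF U] pr] AE_profile[OF pr] show ?thesis
  proof eventually_elim
    case (elim x)
    obtain s z where x: "x = (s, z)" by (cases x)
    show ?case using elim unfolding x ot_map_def
      by (simp add: to_slope_def T_map_eq[OF U])
  qed
qed

text \<open>Almost every pair \<open>(x, T x)\<close> is in contact, so the slope point of \<open>x\<close> is a subgradient of \<open>\<Psi>\<close>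
  at \<open>T x\<close>. Absolute continuity makes \<open>\<Psi>\<close> differentiable there, and inverting \<open>phi \<theta>\<close>
  recovers \<open>x\<close>. Statements transfer between the two measures through Borel versions of both maps.\<close>

lemma S_map_transport:
  assumes U: "(P, \<Psi>) \<in> U0_set r\<^sub>0 H I l" and J: "dual_optimal \<Psi>" and B: "AE q in \<sigma>. q \<in> Bplus l"
    and ac: "absolutely_continuous lborel \<sigma>"
  defines "\<mu> \<equiv> mu r\<^sub>0 H \<Omega> (lowest_profile (legendre Q \<Psi>))"
  shows "pushes_forward (S_map H \<theta> \<Psi>) \<sigma> \<mu>" "AE x in \<mu>. S_map H \<theta> \<Psi> (T_map \<theta> P x) = x"
    "AE q in \<sigma>. T_map \<theta> P (S_map H \<theta> \<Psi> q) = q"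
proof -
  note \<Psi>c = U0D(1)[OF U]
  note pr = strong_duality(1)[OF J]
  define F where "F = legendre X (legendre Q \<Psi>)"
  define T where "T = ot_map \<Psi>"
  have pX: "continuous_on X (legendre Q \<Psi>)" by (rule legendre_continuous[OF Q_comp \<Psi>c Q_nonempty])
  have Fc: "continuous_on UNIV F" unfolding F_def by (rule legendre_continuous[OF X_comp pX X_nonempty])
  have Fsub: "\<And>x. subgrads F x \<noteq> {}" unfolding F_def by (rule legendre_subgrads_nonempty[OF X_comp pX X_nonempty])
  have Fb: "F \<in> borel_measurable borel" by (rule borel_measurable_continuous_onI[OF Fc])
  have Tb: "T \<in> borel \<rightarrow>\<^sub>M borel" unfolding T_def by (rule ot_map_borel[OF \<Psi>c])
  have Tm: "T \<in> \<mu> \<rightarrow>\<^sub>M borel" using Tb by (simp add: \<mu>_def)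
  have dT: "distr \<mu> borel T = \<sigma>" using optimal_transport[OF J] by (simp add: \<mu>_def T_def ot_map_def[abs_def])
  have "AE x in lborel. snd x \<in> UNIV \<longrightarrow> regular F (fst x, (\<lambda>t. t) (snd x))"
    by (rule AE_regular[OF Fc Fsub]) auto
  then have "AE q in lborel. regular F q" by simp
  then have regF: "AE q in \<sigma>. regular F q" by (rule absolutely_continuous_AE[OF _ ac, rotated]) simp
  have AEd: "AE x in \<mu>. R (T x)" if "AE q in \<sigma>. R q" for R
  proof -
    have "AE q in distr \<mu> borel T. R q" using that unfolding dT .
    from AE_distrD[OF Tm this] show ?thesis .
  qed
  have AEu: "AE q in \<sigma>. R q" if "Measurable.pred borel R" "AE x in \<mu>. R (T x)" for R
  proof -
    have "{x \<in> space borel. R x} \<in> sets borel" using that(1) by (simp add: pred_def)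
    from AE_distr_iff[OF Tm this] that(2) show ?thesis unfolding dT by blast
  qed
  have grad: "AE x in \<mu>. rgrad F (T x) = to_slope x \<and> snd x \<in> {0..H} \<and> regular F (T x) \<and> T x \<in> Bplus l"
    using contact_AE[OF \<Psi>c pr] AE_profile[OF pr] AEd[OF regF] AEd[OF B] unfolding \<mu>_def
  proof eventually_elim
    case (elim x)
    have q: "T x \<in> ball (0, 0) l" using elim by (simp add: Bplus_def)
    have xX: "to_slope x \<in> X" unfolding to_slope_def using elim by (intro X_sh) auto
    have "F (T x) = \<Psi> (T x)" unfolding F_def by (rule U0D(5)[OF U q, symmetric])
    also have "\<dots> = T x \<bullet> to_slope x - legendre Q \<Psi> (to_slope x)" using elim by (simp add: T_def ot_map_def inner_commute)
    finally have "to_slope x \<in> subgrads F (T x)" unfolding F_def by (intro contact_subgrad[OF X_comp pX xX])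
    then have "to_slope x = rgrad F (T x)" using elim by (intro subgrad_eq_rgrad[OF Fsub]) auto
    then show ?case using elim by auto
  qed
  define S where "S q = (fst (rgrad F q), phinv (snd (rgrad F q)))" for q
  have Sb: "S \<in> borel \<rightarrow>\<^sub>M borel"
  proof -
    note [measurable] = measurable_rgrad[OF Fb]
    have "(\<lambda>q. rgrad F q) \<in> borel \<rightarrow>\<^sub>M borel \<Otimes>\<^sub>M borel" unfolding borel_prod by (rule measurable_rgrad[OF Fb])
    then have "(\<lambda>q. (fst (rgrad F q), phinv (snd (rgrad F q)))) \<in> borel \<rightarrow>\<^sub>M borel \<Otimes>\<^sub>M borel" by measurable
    then show ?thesis unfolding borel_prod S_def[abs_def] .
  qed
  have Sm: "S \<in> \<sigma> \<rightarrow>\<^sub>M borel" unfolding measurable_cong_sets[OF \<sigma>_sets refl] by (rule Sb)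
  have ST: "AE x in \<mu>. S (T x) = x"
    using grad by eventually_elim
      (auto simp: S_def to_slope_def phinv_eq slope_range phi_inverse simp del: atLeastAtMost_iff)
  \<comment> \<open>Only inside this range does the clamped inverse agree with the inverse used by \<open>S_map\<close>.\<close>
  have rng: "AE q in \<sigma>. snd (rgrad F q) \<in> {0..phi \<theta> H}"
  proof (rule AEu)
    have "(\<lambda>q. snd (rgrad F q)) \<in> borel_measurable borel"
      by (rule measurable_compose[OF measurable_rgrad[OF Fb]]) (intro borel_measurable_continuous_onI continuous_intros)
    then show "Measurable.pred borel (\<lambda>q. snd (rgrad F q) \<in> {0..phi \<theta> H})" by measurable
    show "AE x in \<mu>. snd (rgrad F (T x)) \<in> {0..phi \<theta> H}"
      using grad by eventually_elim (simp add: to_slope_def slope_range del: atLeastAtMost_iff)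
  qed
  have SS: "AE q in \<sigma>. S_map H \<theta> \<Psi> q = S q"
    using regF B rng
  proof eventually_elim
    case (elim q)
    have "q \<in> ball (0, 0) l" using elim by (simp add: Bplus_def)
    from S_map_eq[OF U elim(1)[unfolded F_def] this] show ?case
      using elim(3) by (simp add: S_def F_def phinv_eq del: atLeastAtMost_iff)
  qed
  have dS: "distr \<sigma> borel S = \<mu>"
  proof -
    have "distr \<sigma> borel S = distr \<mu> borel (S \<circ> T)" unfolding dT[symmetric] by (rule distr_distr[OF Sb Tm])
    also have "\<dots> = distr \<mu> borel (\<lambda>x. x)"
    proof (rule distr_cong_AE)
      show "AE x in \<mu>. (S \<circ> T) x = x" using ST by simp
      show "S \<circ> T \<in> \<mu> \<rightarrow>\<^sub>M borel" using measurable_comp[OF Tm Sb] .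
      show "(\<lambda>x. x) \<in> \<mu> \<rightarrow>\<^sub>M borel" by (simp add: \<mu>_def)
    qed simp_all
    also have "\<dots> = \<mu>" by (rule distr_id2) (simp add: \<mu>_def)
    finally show ?thesis .
  qed
  show "pushes_forward (S_map H \<theta> \<Psi>) \<sigma> \<mu>" unfolding pushes_forward_def using Sm SS dS by blast
  have TA: "AE x in \<mu>. T_map \<theta> P x = T x" unfolding \<mu>_def T_def by (rule T_map_AE[OF U pr])
  show "AE x in \<mu>. S_map H \<theta> \<Psi> (T_map \<theta> P x) = x"
    using TA ST AEd[OF SS] by eventually_elim simp
  have TS: "AE q in \<sigma>. T (S q) = q"
  proof (rule AEu)
    have "(\<lambda>q. dist (T (S q)) q) \<in> borel_measurable borel"
      by (intro borel_measurable_dist measurable_compose[OF Sb Tb] measurable_ident_sets[OF refl])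
    then have "Measurable.pred borel (\<lambda>q. dist (T (S q)) q = 0)" by measurable
    then show "Measurable.pred borel (\<lambda>q. T (S q) = q)" by simp
    show "AE x in \<mu>. T (S (T x)) = T x" using ST by eventually_elim simp
  qed
  have "AE x in distr \<sigma> borel S. T_map \<theta> P x = T x" unfolding dS by (rule TA)
  from AE_distrD[OF Sm this] have "AE q in \<sigma>. T_map \<theta> P (S q) = T (S q)" .
  with TS SS show "AE q in \<sigma>. T_map \<theta> P (S_map H \<theta> \<Psi> q) = q" by eventually_elim simp
qed

text \<open>Both maximizers have the same value and the same optimal profile, so the excess of the second pair
  over contact along the transport of the first is nonnegative with integral zero.\<close>

lemma common_contact_AE:
  assumes J: "dual_optimal \<psi>" "dual_optimal \<psi>'"
  shows "AE x in mu r\<^sub>0 H \<Omega> (lowest_profile (legendre Q \<psi>)).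
    legendre Q \<psi>' (to_slope x) = to_slope x \<bullet> ot_map \<psi> x - \<psi>' (ot_map \<psi> x)"
proof -
  have c: "continuous_on Q \<psi>" "continuous_on Q \<psi>'" using J by (auto simp: dual_optimal_def)
  define p where "p = legendre Q \<psi>"
  define p' where "p' = legendre Q \<psi>'"
  define \<mu> where "\<mu> = mu r\<^sub>0 H \<Omega> (lowest_profile p)"
  have pr: "profile (lowest_profile p)" "profile (lowest_profile p')" using strong_duality(1) J by (auto simp: p_def p'_def)
  have pp: "pot p" "pot p'" unfolding p_def p'_def by (intro legendre_continuous Q_comp c Q_nonempty)+
  have T: "ot_map \<psi> \<in> \<mu> \<rightarrow>\<^sub>M borel" using ot_map_borel[OF c(1)] by (simp add: \<mu>_def)
  have dT: "distr \<mu> borel (ot_map \<psi>) = \<sigma>" using optimal_transport[OF J(1)] by (simp add: \<mu>_def ot_map_def[abs_def] p_def)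
  have eqmu: "mu r\<^sub>0 H \<Omega> (lowest_profile p') = \<mu>" unfolding \<mu>_def
    by (rule mu_cong_AE[OF profileD(1)[OF pr(2)] profileD(1)[OF pr(1)]])
      (use dual_optimal_lowest_profile_AE[OF J] in \<open>simp add: p_def p'_def\<close>)
  have f: "integrable \<mu> (\<lambda>x. f0 r\<^sub>0 \<Omega> (fst x))"
  proof (rule ccontr)
    assume "\<not> ?thesis"
    then show False using K_infinite[OF pr(1)] strong_duality(2)[OF J(1)] by (simp add: \<mu>_def p_def)
  qed
  define e where "e \<psi> q = indicator Q q * \<psi> q" for \<psi> :: "real \<times> real \<Rightarrow> real" and q
  have E: "integrable \<mu> (\<lambda>x. e \<phi> (ot_map \<psi> x))" "(LINT x|\<mu>. e \<phi> (ot_map \<psi> x)) = (LINT q:Q|\<sigma>. \<phi> q)"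
    if "continuous_on Q \<phi>" for \<phi>
    using \<sigma>_indicator_integral[OF that] integrable_distr[OF T, of "e \<phi>"] integral_distr[OF T, of "e \<phi>"]
    unfolding dT e_def by auto
  have ip: "integrable \<mu> (\<lambda>x. p (to_slope x))" "integrable \<mu> (\<lambda>x. p' (to_slope x))"
    unfolding \<mu>_def by (intro p_to_slope_integrable pr(1) pp)+
  have h: "total_energy p = (LINT x|\<mu>. f0 r\<^sub>0 \<Omega> (fst x)) - (LINT x|\<mu>. p (to_slope x))"
    "total_energy p' = (LINT x|\<mu>. f0 r\<^sub>0 \<Omega> (fst x)) - (LINT x|\<mu>. p' (to_slope x))"
    using energy_fubini(2)[OF pr(1) f[unfolded \<mu>_def] pp(1)] energy_fubini(2)[OF pr(2) f[folded eqmu] pp(2)] f ip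
    unfolding \<mu>_def[symmetric] eqmu by (simp_all add: total_energy_def min_energy_def lowest_profile_def)
  \<comment> \<open>The second bracket is the inner product of the pair in contact, so \<open>g\<close> is the excess of the
    second pair of potentials over contact.\<close>
  define g where "g x = (p' (to_slope x) + e \<psi>' (ot_map \<psi> x)) - (p (to_slope x) + e \<psi> (ot_map \<psi> x))" for x
  have gi: "integrable \<mu> g" unfolding g_def using ip E(1)[OF c(1)] E(1)[OF c(2)] by auto
  have "(LINT x|\<mu>. g x) = 0"
    unfolding g_def using ip E[OF c(1)] E[OF c(2)] h dual_optimal_value[OF J] by (simp add: dual_value_def p_def p'_def)
  moreover have g0: "AE x in \<mu>. 0 \<le> g x \<and> (g x = 0 \<longrightarrow> p' (to_slope x) = to_slope x \<bullet> ot_map \<psi> x - \<psi>' (ot_map \<psi> x))"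
    using contact_AE[OF c(1) pr(1)[unfolded p_def]] unfolding \<mu>_def p_def
  proof eventually_elim
    case (elim x)
    then show ?case
      using legendre_ge[OF Q_comp c(2), of "ot_map \<psi> x" "to_slope x"]
      by (auto simp: g_def e_def p_def p'_def ot_map_def)
  qed
  ultimately have "AE x in \<mu>. g x = 0"
    using integral_nonneg_eq_0_iff_AE[OF gi] by (auto elim: eventually_mono)
  with g0 show ?thesis unfolding \<mu>_def[symmetric] p_def[symmetric] p'_def[symmetric] by eventually_elim auto
qed

text \<open>Common contact points form a compact set, and the image of almost every point under the transport
  map is such a point; full support makes this set all of \<open>Q\<close>.\<close>

lemma common_contact:
  assumes J: "dual_optimal \<psi>" "dual_optimal \<psi>'" and spt: "spt \<sigma> = Q" and q: "q \<in> Q"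
  shows "\<exists>x\<in>X. legendre Q \<psi> x = x \<bullet> q - \<psi> q \<and> legendre Q \<psi>' x = x \<bullet> q - \<psi>' q"
proof -
  have c: "continuous_on Q \<psi>" "continuous_on Q \<psi>'" using J by (auto simp: dual_optimal_def)
  define C where "C \<psi> = {w \<in> X \<times> Q. legendre Q \<psi> (fst w) - (fst w \<bullet> snd w - \<psi> (snd w)) = 0}" for \<psi>
  have "compact (C \<psi>)" if c: "continuous_on Q \<psi>" for \<psi>
  proof -
    have "closed (C \<psi>)" unfolding C_def
      by (intro continuous_closed_preimage_constant continuous_intros continuous_on_compose2[OF legendre_continuous[OF Q_comp c Q_nonempty, of UNIV]]
          continuous_on_compose2[OF c] compact_imp_closed compact_Times X_comp Q_comp) auto
    moreover have "C \<psi> \<subseteq> X \<times> Q" by (auto simp: C_def)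
    ultimately show ?thesis using compact_Times[OF X_comp Q_comp] compact_Int_closed by (metis Int_absorb1)
  qed
  then have "compact (snd ` (C \<psi> \<inter> C \<psi>'))"
    using c by (intro compact_continuous_image compact_Int continuous_intros)
  then have cl: "closed (snd ` (C \<psi> \<inter> C \<psi>'))" by (rule compact_imp_closed)
  define \<mu> where "\<mu> = mu r\<^sub>0 H \<Omega> (lowest_profile (legendre Q \<psi>))"
  have T: "ot_map \<psi> \<in> \<mu> \<rightarrow>\<^sub>M borel" using ot_map_borel[OF c(1)] by (simp add: \<mu>_def)
  have dT: "distr \<mu> borel (ot_map \<psi>) = \<sigma>" using optimal_transport[OF J(1)] by (simp add: \<mu>_def ot_map_def[abs_def])
  note pr = strong_duality(1)[OF J(1)]
  have "AE x in \<mu>. ot_map \<psi> x \<in> snd ` (C \<psi> \<inter> C \<psi>')"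
    using contact_AE[OF c(1) pr] common_contact_AE[OF J] AE_profile[OF pr] unfolding \<mu>_def
  proof eventually_elim
    case (elim x)
    have "to_slope x \<in> X" unfolding to_slope_def using elim by (intro X_sh) auto
    then have "(to_slope x, ot_map \<psi> x) \<in> C \<psi> \<inter> C \<psi>'" using elim by (auto simp: C_def ot_map_def)
    then show ?case by force
  qed
  then have "AE q in \<sigma>. q \<in> snd ` (C \<psi> \<inter> C \<psi>')"
  proof -
    assume ae: "AE x in \<mu>. ot_map \<psi> x \<in> snd ` (C \<psi> \<inter> C \<psi>')"
    have "{q \<in> space borel. q \<in> snd ` (C \<psi> \<inter> C \<psi>')} \<in> sets borel" using cl by (simp add: borel_closed)
    from AE_distr_iff[OF T this] ae show ?thesis unfolding dT by blast
  qed
  then have "emeasure \<sigma> (- (snd ` (C \<psi> \<inter> C \<psi>'))) = 0"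
    using cl by (subst (asm) AE_iff_measurable[of "- (snd ` (C \<psi> \<inter> C \<psi>'))"]) (auto simp: borel_closed)
  moreover have "open (- (snd ` (C \<psi> \<inter> C \<psi>')))" using cl by (rule open_Compl)
  ultimately have "q \<in> snd ` (C \<psi> \<inter> C \<psi>')" using q spt unfolding spt_def by blast
  then show ?thesis by (auto simp: C_def)
qed

text \<open>Both functions have the same subgradient at each of \<open>N\<close> equidistant points of a segment, so the
  increments of the difference are bounded by the increments of that subgradient, which telescope
  to a quantity of order \<open>1 / N\<close>.\<close>

lemma potential_difference_const:
  assumes J: "dual_optimal \<psi>" "dual_optimal \<psi>'" and spt: "spt \<sigma> = Q" and q: "a \<in> Q" "b \<in> Q"
  shows "\<psi>' b - \<psi> b = \<psi>' a - \<psi> a"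
proof -
  have c: "continuous_on Q \<psi>" "continuous_on Q \<psi>'" using J by (auto simp: dual_optimal_def)
  have conv: "convex Q" unfolding Q_def by (rule convex_closure[OF Bplus_convex])
  obtain R where R: "\<And>x. x \<in> X \<Longrightarrow> norm x \<le> R" using compact_imp_bounded[OF X_comp] by (auto simp: bounded_iff)
  define d where "d q = \<psi>' q - \<psi> q" for q
  have step: "\<bar>d b - d a\<bar> \<le> 2 * R * norm (b - a) / real (Suc N)" for N
  proof -
    define D where "D = (1 / real (Suc N)) *\<^sub>R (b - a)"
    define w where "w i = a + real i *\<^sub>R D" for i
    have wQ: "w i \<in> Q" if "i \<le> Suc N" for i
    proof -
      have "w i = (1 - real i / real (Suc N)) *\<^sub>R a + (real i / real (Suc N)) *\<^sub>R b"
        by (simp add: w_def D_def algebra_simps)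
      moreover have "0 \<le> real i / real (Suc N)" "real i / real (Suc N) \<le> 1" using that by (auto simp: field_simps)
      ultimately show ?thesis using convexD_alt[OF conv q] by auto
    qed
    obtain x where x: "\<And>i. i \<le> Suc N \<Longrightarrow> x i \<in> X \<and> legendre Q \<psi> (x i) = x i \<bullet> w i - \<psi> (w i) \<and> legendre Q \<psi>' (x i) = x i \<bullet> w i - \<psi>' (w i)"
      using common_contact[OF J spt wQ] by metis
    have inc: "\<bar>d (w (Suc i)) - d (w i)\<bar> \<le> (x (Suc i) - x i) \<bullet> D" if i: "i \<le> N" for i
    proof -
      have diff: "w (Suc i) - w i = D" by (simp add: w_def algebra_simps)
      have in': "w i \<in> Q" "w (Suc i) \<in> Q" using i wQ by auto
      have xi: "x i \<bullet> D = x i \<bullet> w (Suc i) - x i \<bullet> w i" "x (Suc i) \<bullet> D = x (Suc i) \<bullet> w (Suc i) - x (Suc i) \<bullet> w i"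
        by (simp_all add: diff[symmetric] inner_diff_right)
      have "x i \<bullet> w (Suc i) - \<psi> (w (Suc i)) \<le> x i \<bullet> w i - \<psi> (w i)" "x i \<bullet> w (Suc i) - \<psi>' (w (Suc i)) \<le> x i \<bullet> w i - \<psi>' (w i)"
        using legendre_ge[OF Q_comp c(1) in'(2), of "x i"] legendre_ge[OF Q_comp c(2) in'(2), of "x i"] x[of i] i by auto
      moreover have "x (Suc i) \<bullet> w i - \<psi> (w i) \<le> x (Suc i) \<bullet> w (Suc i) - \<psi> (w (Suc i))"
        "x (Suc i) \<bullet> w i - \<psi>' (w i) \<le> x (Suc i) \<bullet> w (Suc i) - \<psi>' (w (Suc i))"
        using legendre_ge[OF Q_comp c(1) in'(1), of "x (Suc i)"] legendre_ge[OF Q_comp c(2) in'(1), of "x (Suc i)"] x[of "Suc i"] i by auto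
      ultimately show ?thesis using xi unfolding d_def inner_diff_left by linarith
    qed
    have "\<bar>d (w n) - d (w 0)\<bar> \<le> (x n - x 0) \<bullet> D" if "n \<le> Suc N" for n
      using that
    proof (induction n)
      case (Suc n)
      then show ?case using inc[of n] by (simp add: inner_diff_left)
    qed simp
    from this[of "Suc N"] have "\<bar>d (w (Suc N)) - d (w 0)\<bar> \<le> (x (Suc N) - x 0) \<bullet> D" by simp
    also have "\<dots> \<le> norm (x (Suc N) - x 0) * norm D" by (rule norm_cauchy_schwarz)
    also have "\<dots> \<le> (2 * R) * norm D"
    proof (rule mult_right_mono)
      show "norm (x (Suc N) - x 0) \<le> 2 * R"
        using norm_triangle_ineq4[of "x (Suc N)" "x 0"] R[of "x (Suc N)"] R[of "x 0"] x[of "Suc N"] x[of 0] by simp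
    qed simp
    also have "\<dots> = 2 * R * norm (b - a) / real (Suc N)" by (simp add: D_def)
    finally have "\<bar>d (w (Suc N)) - d (w 0)\<bar> \<le> 2 * R * norm (b - a) / real (Suc N)" .
    moreover have "w (Suc N) = b" "w 0 = a" by (simp_all add: w_def D_def)
    ultimately show ?thesis by simp
  qed
  have "(\<lambda>N. 2 * R * norm (b - a) / real (Suc N)) \<longlonglongrightarrow> 0"
    using tendsto_mult_right_zero[OF LIMSEQ_Suc[OF lim_1_over_n[where 'a=real]], of "2 * R * norm (b - a)"] by simp
  then have "\<bar>d b - d a\<bar> \<le> 0" by (rule LIMSEQ_le_const) (use step in blast)
  then show ?thesis by (simp add: d_def)
qed

text \<open>The two potentials differ by a constant; both satisfy the relation on the free boundary at a
  common positive height, where they must agree.\<close>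

theorem dual_optimal_unique:
  assumes J: "dual_optimal \<psi>" "dual_optimal \<psi>'" and spt: "spt \<sigma> = Q"
  shows "q \<in> Q \<Longrightarrow> \<psi>' q = \<psi> q" "legendre Q \<psi>' x = legendre Q \<psi> x"
proof -
  have c: "continuous_on Q \<psi>" "continuous_on Q \<psi>'" using J by (auto simp: dual_optimal_def)
  obtain a where a: "a \<in> Q" using Q_nonempty by blast
  define k where "k = \<psi>' a - \<psi> a"
  have k: "\<psi>' q = \<psi> q + k" if "q \<in> Q" for q
    using potential_difference_const[OF J spt a that] by (simp add: k_def)
  have pk: "legendre Q \<psi>' x = legendre Q \<psi> x - k" for x
  proof -
    have "legendre Q \<psi>' x \<le> legendre Q \<psi> x + (- k)"
      by (rule legendre_antimono[OF Q_comp c(1) Q_nonempty]) (simp add: k)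
    moreover have "legendre Q \<psi> x \<le> legendre Q \<psi>' x + k"
      by (rule legendre_antimono[OF Q_comp c(2) Q_nonempty]) (simp add: k)
    ultimately show ?thesis by simp
  qed
  have pp: "pot (legendre Q \<psi>)" "pot (legendre Q \<psi>')" by (intro legendre_continuous Q_comp c Q_nonempty)+
  have "\<exists>z\<in>{0..H}. lowest_profile (legendre Q \<psi>') z = lowest_profile (legendre Q \<psi>) z \<and> lowest_profile (legendre Q \<psi>) z > 0"
  proof (rule ccontr)
    assume n: "\<not> ?thesis"
    note pr = strong_duality(1)[OF J(1)]
    have "AE z in lborel. z \<in> {0..H} \<longrightarrow> mass (lowest_profile (legendre Q \<psi>) z) = 0"
      using dual_optimal_lowest_profile_AE[OF J]
    proof eventually_elim
      case (elim z)
      show ?case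
      proof
        assume z: "z \<in> {0..H}"
        then have "lowest_profile (legendre Q \<psi>) z = 0" using elim n profileD(2)[OF pr z] by force
        then show "mass (lowest_profile (legendre Q \<psi>) z) = 0" by (simp add: mass_def)
      qed
    qed
    then have "AE z in lborel. indicator {0..H} z *\<^sub>R mass (lowest_profile (legendre Q \<psi>) z) = 0"
      by eventually_elim (auto split: split_indicator)
    then have "(LINT z:{0..H}|lborel. mass (lowest_profile (legendre Q \<psi>) z)) = 0"
      unfolding set_lebesgue_integral_def by (rule integral_eq_zero_AE)
    then show False using profile_mass(2)[OF pr] by simp
  qed
  then obtain z where z0: "lowest_profile (legendre Q \<psi>') z = lowest_profile (legendre Q \<psi>) z" "lowest_profile (legendre Q \<psi>) z > 0" by blast
  define r where "r = lowest_profile (legendre Q \<psi>) z"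
  have z: "lowest_profile (legendre Q \<psi>') z = r" "lowest_profile (legendre Q \<psi>) z = r" "r > 0" using z0 by (simp_all add: r_def)
  have "f0 r\<^sub>0 \<Omega> r = legendre Q \<psi> (r, slope z)" "f0 r\<^sub>0 \<Omega> r = legendre Q \<psi>' (r, slope z)"
    using z lowest_highest(1)[OF pp(1), of "slope z"] lowest_highest(1)[OF pp(2), of "slope z"]
    by (auto intro!: minimizers_foc pp simp: lowest_profile_def)
  then have "k = 0" using pk[of "(r, slope z)"] by simp
  then show "q \<in> Q \<Longrightarrow> \<psi>' q = \<psi> q" "legendre Q \<psi>' x = legendre Q \<psi> x" using k pk by auto
qed

end

section \<open>Minimizers of the primal functional\<close>

text \<open>The numerator of the derivative of \<open>z / \<theta> z\<close> is \<open>\<theta> z - z * \<theta>' z\<close>.\<close>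

lemma phi_strict_mono:
  assumes cont: "continuous_on {0..H} \<theta>" and pos: "\<And>z. z \<in> {0..H} \<Longrightarrow> \<theta> z > 0"
    and diff: "\<And>z. z \<in> {0<..<H} \<Longrightarrow> \<theta> differentiable (at z)"
    and d: "\<And>z. z \<in> {0<..<H} \<Longrightarrow> \<theta> z - z * deriv \<theta> z > 0"
  shows "strict_mono_on {0..H} (phi \<theta>)"
proof (rule strict_mono_onI)
  fix a b assume ab: "a \<in> {0..H}" "b \<in> {0..H}" "a < b"
  show "phi \<theta> a < phi \<theta> b"
  proof (rule DERIV_pos_imp_increasing_open[OF ab(3)])
    fix x assume x: "a < x" "x < b"
    then have x': "x \<in> {0<..<H}" "\<theta> x > 0" using ab pos[of x] by auto
    have "(\<theta> has_real_derivative deriv \<theta> x) (at x)" using diff[OF x'(1)] by (simp add: DERIV_deriv_iff_real_differentiable)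
    then have "(phi \<theta> has_real_derivative (1 * \<theta> x - x * deriv \<theta> x) / (\<theta> x * \<theta> x)) (at x)"
      unfolding phi_def[abs_def] using x'(2) by (intro DERIV_divide DERIV_ident) auto
    moreover have "(1 * \<theta> x - x * deriv \<theta> x) / (\<theta> x * \<theta> x) > 0" using d[OF x'(1)] x'(2) by simp
    ultimately show "\<exists>y. (phi \<theta> has_real_derivative y) (at x) \<and> 0 < y" by blast
  next
    have "\<theta> z \<noteq> 0" if "z \<in> {a..b}" for z using pos[of z] ab that by auto
    moreover have "continuous_on {a..b} \<theta>" using ab by (intro continuous_on_subset[OF cont]) auto
    ultimately show "continuous_on {a..b} (phi \<theta>)"
      unfolding phi_def[abs_def] by (intro continuous_intros) auto
  qed
qed

context problem_sigma
begin

text \<open>The value at height zero is set to zero, because lowest profiles of different maximizers are only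
  known to agree at positive heights.\<close>

lemma minimizer_exists:
  obtains \<psi> \<rho>\<^sub>0 where "dual_optimal \<psi>" "profile \<rho>\<^sub>0" "mu r\<^sub>0 H \<Omega> \<rho>\<^sub>0 = mu r\<^sub>0 H \<Omega> (lowest_profile (legendre Q \<psi>))"
    "\<rho>\<^sub>0 0 = 0" "\<And>z. z \<in> {0<..H} \<Longrightarrow> \<rho>\<^sub>0 z = lowest_profile (legendre Q \<psi>) z"
proof -
  obtain \<psi> where J: "dual_optimal \<psi>" using dual_optimal_exists by blast
  note pr = strong_duality(1)[OF J]
  define \<rho> where "\<rho> z = (if z = 0 then 0 else lowest_profile (legendre Q \<psi>) z)" for z
  note [measurable] = profileD(1)[OF pr]
  have b: "\<rho> \<in> borel_measurable borel" unfolding \<rho>_def[abs_def] by measurable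
  have "AE z::real in lborel. z \<noteq> 0" by (rule AE_lborel_singleton)
  then have m: "mu r\<^sub>0 H \<Omega> \<rho> = mu r\<^sub>0 H \<Omega> (lowest_profile (legendre Q \<psi>))"
    by (intro mu_cong_AE[OF b profileD(1)[OF pr]]) (erule eventually_mono, simp add: \<rho>_def)
  have "profile \<rho>" using pr b m smax_pos by (auto simp: profile_def \<rho>_def)
  from that[OF J this m] show thesis by (simp add: \<rho>_def)
qed

lemma profile_optimal:
  assumes J: "dual_optimal \<psi>" and \<rho>: "profile \<rho>\<^sub>0" and m: "mu r\<^sub>0 H \<Omega> \<rho>\<^sub>0 = mu r\<^sub>0 H \<Omega> (lowest_profile (legendre Q \<psi>))"
    and eq: "\<forall>z\<in>{0<..H}. \<rho>\<^sub>0 z = lowest_profile (legendre Q \<psi>) z"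
  shows "K_fun r\<^sub>0 H \<Omega> \<theta> \<sigma> \<rho>\<^sub>0 = ereal (half_moment + dual_value \<psi>)" "K_minimizer r\<^sub>0 H \<Omega> \<theta> \<sigma> \<rho>\<^sub>0"
    "K_minimizer r\<^sub>0 H \<Omega> \<theta> \<sigma> \<rho> \<Longrightarrow> AE z in lborel. z \<in> {0..H} \<longrightarrow> \<rho> z = \<rho>\<^sub>0 z"
proof -
  note pr = strong_duality(1)[OF J]
  have c: "continuous_on Q \<psi>" using J by (simp add: dual_optimal_def)
  show K: "K_fun r\<^sub>0 H \<Omega> \<theta> \<sigma> \<rho>\<^sub>0 = ereal (half_moment + dual_value \<psi>)"
    using K_fun_mu_cong[OF profile_R0[OF \<rho>] profile_R0[OF pr] m] strong_duality(2)[OF J] by simp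
  show "K_minimizer r\<^sub>0 H \<Omega> \<theta> \<sigma> \<rho>\<^sub>0"
    unfolding K_minimizer_def K using profile_R0[OF \<rho>] weak_duality[OF _ c] by blast
  assume "K_minimizer r\<^sub>0 H \<Omega> \<theta> \<sigma> \<rho>"
  then have r: "\<rho> \<in> R0_set r\<^sub>0 H \<Omega>" "K_fun r\<^sub>0 H \<Omega> \<theta> \<sigma> \<rho> \<le> ereal (half_moment + dual_value \<psi>)"
    using profile_R0[OF \<rho>] K unfolding K_minimizer_def by auto
  have "AE z::real in lborel. z \<noteq> 0" by (rule AE_lborel_singleton)
  with duality_equality[OF r(1) c r(2) pr] show "AE z in lborel. z \<in> {0..H} \<longrightarrow> \<rho> z = \<rho>\<^sub>0 z"
    by eventually_elim (auto simp: eq)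
qed

lemma boundary_relation:
  assumes U: "(P, \<Psi>) \<in> U0_set r\<^sub>0 H I l" and z: "z \<in> {0..H}" and r: "lowest_profile (legendre Q \<Psi>) z = r" "r > 0"
  shows "2 * (1 - 2 * r\<^sub>0\<^sup>2 * r) * P ((r, z), \<theta> z) = r\<^sub>0\<^sup>2 * \<Omega>\<^sup>2" "legendre Q \<Psi> (r, slope z) = f0 r\<^sub>0 \<Omega> r" "r < smax"
proof -
  have pp: "pot (legendre Q \<Psi>)" by (intro legendre_continuous Q_comp U0D(1)[OF U] Q_nonempty)
  have a: "r \<in> minimizers (legendre Q \<Psi>) (slope z)" using lowest_highest(1)[OF pp, of "slope z"] r(1) by (simp add: lowest_profile_def)
  then show s: "r < smax" by (simp add: minimizers_def)
  show f: "legendre Q \<Psi> (r, slope z) = f0 r\<^sub>0 \<Omega> r" using minimizers_foc[OF pp a r(2)] by simp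
  have "P ((r, z), \<theta> z) = f0 r\<^sub>0 \<Omega> r"
    using U0D(4)[OF U, of r z "\<theta> z"] \<theta>_mem[OF z] z s r(2) f by (simp add: W_iff slope_eq)
  then show "2 * (1 - 2 * r\<^sub>0\<^sup>2 * r) * P ((r, z), \<theta> z) = r\<^sub>0\<^sup>2 * \<Omega>\<^sup>2"
  proof -
    have "2 * d * (a / (2 * d)) = a" if "d \<noteq> 0" for d a :: real using that by simp
    from this[of "1 - 2 * r\<^sub>0\<^sup>2 * r"] gap_pos[OF s] show ?thesis
      unfolding \<open>P ((r, z), \<theta> z) = f0 r\<^sub>0 \<Omega> r\<close> f0_def by force
  qed
qed

end

theorem proposition4p11:
  fixes r\<^sub>0 H \<Omega> c\<^sub>0 l :: real
    and I\<^sub>0 :: "real set"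
    and \<theta>\<^sub>0 :: "real \<Rightarrow> real"
    and \<sigma> :: "(real \<times> real) measure"
  assumes "r\<^sub>0 > 0" and "H > 0" and "\<Omega> > 0"
    and "open I\<^sub>0" and "is_interval I\<^sub>0" and "bounded I\<^sub>0" and "I\<^sub>0 \<subseteq> {0<..}" and "0 \<notin> closure I\<^sub>0"
    and "\<theta>\<^sub>0 ` {0..H} \<subseteq> I\<^sub>0" and "smooth_on {0<..<H} \<theta>\<^sub>0"
    and "c\<^sub>0 > 0" and "l > 0"
    and "\<sigma> \<in> borel_prob"
    and "\<forall>z\<in>{0<..<H}. \<theta>\<^sub>0 z - z * deriv \<theta>\<^sub>0 z > 0"
    and "\<exists>L. L-lipschitz_on {0..H} \<theta>\<^sub>0"
  shows
    "(spt \<sigma> \<subseteq> Bplus l \<longrightarrow>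
     (\<exists>\<rho>\<^sub>0.
       K_minimizer r\<^sub>0 H \<Omega> \<theta>\<^sub>0 \<sigma> \<rho>\<^sub>0 \<and>
       (\<forall>\<rho>. K_minimizer r\<^sub>0 H \<Omega> \<theta>\<^sub>0 \<sigma> \<rho> \<longrightarrow> (AE z in lborel. z \<in> {0..H} \<longrightarrow> \<rho> z = \<rho>\<^sub>0 z)) \<and>
       (\<forall>P\<^sub>0 \<Psi>\<^sub>0.
          (P\<^sub>0, \<Psi>\<^sub>0) \<in> U0_set r\<^sub>0 H I\<^sub>0 l \<and> J_maximizer r\<^sub>0 H \<Omega> \<theta>\<^sub>0 I\<^sub>0 l \<sigma> P\<^sub>0 \<Psi>\<^sub>0 \<longrightarrow>
            pushes_forward (T_map \<theta>\<^sub>0 P\<^sub>0) (mu r\<^sub>0 H \<Omega> \<rho>\<^sub>0) \<sigma> \<and>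
            K_fun r\<^sub>0 H \<Omega> \<theta>\<^sub>0 \<sigma> \<rho>\<^sub>0 = J_fun r\<^sub>0 H \<Omega> \<theta>\<^sub>0 l \<sigma> P\<^sub>0 \<Psi>\<^sub>0 + second_moment \<sigma> \<and>
            mono_on {0..H} \<rho>\<^sub>0 \<and>
            (\<forall>z\<in>{0..H}. \<rho>\<^sub>0 z > 0 \<longrightarrow>
               2 * (1 - 2 * r\<^sub>0\<^sup>2 * \<rho>\<^sub>0 z) * P\<^sub>0 ((\<rho>\<^sub>0 z, z), \<theta>\<^sub>0 z) = r\<^sub>0\<^sup>2 * \<Omega>\<^sup>2) \<and>
            (absolutely_continuous lborel \<sigma> \<longrightarrow>
               pushes_forward (S_map H \<theta>\<^sub>0 \<Psi>\<^sub>0) \<sigma> (mu r\<^sub>0 H \<Omega> \<rho>\<^sub>0) \<and>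
               (AE p in mu r\<^sub>0 H \<Omega> \<rho>\<^sub>0. S_map H \<theta>\<^sub>0 \<Psi>\<^sub>0 (T_map \<theta>\<^sub>0 P\<^sub>0 p) = p) \<and>
               (AE q in \<sigma>. T_map \<theta>\<^sub>0 P\<^sub>0 (S_map H \<theta>\<^sub>0 \<Psi>\<^sub>0 q) = q))) \<and>
       (\<forall>P\<^sub>0 \<Psi>\<^sub>0 b\<^sub>0.
          (INF z\<in>{0<..<H}. \<theta>\<^sub>0 z - z * deriv \<theta>\<^sub>0 z) > 0 \<and>
          (P\<^sub>0, \<Psi>\<^sub>0) \<in> U0_set r\<^sub>0 H I\<^sub>0 l \<and> J_maximizer r\<^sub>0 H \<Omega> \<theta>\<^sub>0 I\<^sub>0 l \<sigma> P\<^sub>0 \<Psi>\<^sub>0 \<and>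
          b\<^sub>0 > 0 \<and> (AE x in lborel. x \<in> W_set r\<^sub>0 H \<times> I\<^sub>0 \<longrightarrow> dz P\<^sub>0 x \<ge> b\<^sub>0) \<longrightarrow>
            (\<forall>z\<^sub>1\<in>{0..H}. \<forall>z\<^sub>2\<in>{0..H}. \<rho>\<^sub>0 z\<^sub>1 > 0 \<and> \<rho>\<^sub>0 z\<^sub>2 > 0 \<longrightarrow>
               (\<exists>C>0. \<bar>z\<^sub>2 - z\<^sub>1\<bar> \<le> C * \<bar>\<rho>\<^sub>0 z\<^sub>2 - \<rho>\<^sub>0 z\<^sub>1\<bar>)))))
     \<and>
     (\<forall>P\<^sub>0 \<Psi>\<^sub>0 P\<^sub>1 \<Psi>\<^sub>1.
        absolutely_continuous lborel \<sigma> \<and>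
        (AE q in lborel. q \<in> Bplus l \<longrightarrow> RN_deriv lborel \<sigma> q > ennreal c\<^sub>0) \<and>
        spt \<sigma> = closure (Bplus l) \<and>
        (P\<^sub>0, \<Psi>\<^sub>0) \<in> U0_set r\<^sub>0 H I\<^sub>0 l \<and> (P\<^sub>1, \<Psi>\<^sub>1) \<in> U0_set r\<^sub>0 H I\<^sub>0 l \<and>
        J_maximizer r\<^sub>0 H \<Omega> \<theta>\<^sub>0 I\<^sub>0 l \<sigma> P\<^sub>0 \<Psi>\<^sub>0 \<and>
        J_fun r\<^sub>0 H \<Omega> \<theta>\<^sub>0 l \<sigma> P\<^sub>0 \<Psi>\<^sub>0 = J_fun r\<^sub>0 H \<Omega> \<theta>\<^sub>0 l \<sigma> P\<^sub>1 \<Psi>\<^sub>1 \<longrightarrow>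
          (\<forall>x \<in> W_set r\<^sub>0 H \<times> I\<^sub>0. P\<^sub>1 x = P\<^sub>0 x) \<and> (\<forall>q \<in> Bplus l. \<Psi>\<^sub>1 q = \<Psi>\<^sub>0 q))"
proof -
  have H0: "H > 0" and c\<theta>: "continuous_on {0..H} \<theta>\<^sub>0"
    using assms lipschitz_on_continuous_on by auto
  have diff: "\<theta>\<^sub>0 differentiable (at z)" if "z \<in> {0<..<H}" for z
    using assms(10) that unfolding smooth_on_def by (metis funpow_0)
  have pos: "\<theta>\<^sub>0 z > 0" if "z \<in> {0..H}" for z using assms(7,9) that by blast
  have prob: "problem r\<^sub>0 H \<Omega> l I\<^sub>0 \<theta>\<^sub>0"
    by unfold_locales (use assms c\<theta> phi_strict_mono[OF c\<theta> pos diff] in auto)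
  interpret problem r\<^sub>0 H \<Omega> l I\<^sub>0 \<theta>\<^sub>0 by (rule prob)
  have \<sigma>: "sets \<sigma> = sets borel" "prob_space \<sigma>" using assms(13) by (auto simp: borel_prob_def)
  have BQ: "Bplus l \<subseteq> Q" unfolding Q_def by (rule closure_subset)
  note sp = AE_spt[OF \<sigma>(1)]
  have part_i: "\<exists>\<rho>\<^sub>0.
       K_minimizer r\<^sub>0 H \<Omega> \<theta>\<^sub>0 \<sigma> \<rho>\<^sub>0 \<and>
       (\<forall>\<rho>. K_minimizer r\<^sub>0 H \<Omega> \<theta>\<^sub>0 \<sigma> \<rho> \<longrightarrow> (AE z in lborel. z \<in> {0..H} \<longrightarrow> \<rho> z = \<rho>\<^sub>0 z)) \<and>
       (\<forall>P\<^sub>0 \<Psi>\<^sub>0.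
          (P\<^sub>0, \<Psi>\<^sub>0) \<in> U0_set r\<^sub>0 H I\<^sub>0 l \<and> J_maximizer r\<^sub>0 H \<Omega> \<theta>\<^sub>0 I\<^sub>0 l \<sigma> P\<^sub>0 \<Psi>\<^sub>0 \<longrightarrow>
            pushes_forward (T_map \<theta>\<^sub>0 P\<^sub>0) (mu r\<^sub>0 H \<Omega> \<rho>\<^sub>0) \<sigma> \<and>
            K_fun r\<^sub>0 H \<Omega> \<theta>\<^sub>0 \<sigma> \<rho>\<^sub>0 = J_fun r\<^sub>0 H \<Omega> \<theta>\<^sub>0 l \<sigma> P\<^sub>0 \<Psi>\<^sub>0 + second_moment \<sigma> \<and>
            mono_on {0..H} \<rho>\<^sub>0 \<and>
            (\<forall>z\<in>{0..H}. \<rho>\<^sub>0 z > 0 \<longrightarrow>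
               2 * (1 - 2 * r\<^sub>0\<^sup>2 * \<rho>\<^sub>0 z) * P\<^sub>0 ((\<rho>\<^sub>0 z, z), \<theta>\<^sub>0 z) = r\<^sub>0\<^sup>2 * \<Omega>\<^sup>2) \<and>
            (absolutely_continuous lborel \<sigma> \<longrightarrow>
               pushes_forward (S_map H \<theta>\<^sub>0 \<Psi>\<^sub>0) \<sigma> (mu r\<^sub>0 H \<Omega> \<rho>\<^sub>0) \<and>
               (AE p in mu r\<^sub>0 H \<Omega> \<rho>\<^sub>0. S_map H \<theta>\<^sub>0 \<Psi>\<^sub>0 (T_map \<theta>\<^sub>0 P\<^sub>0 p) = p) \<and>
               (AE q in \<sigma>. T_map \<theta>\<^sub>0 P\<^sub>0 (S_map H \<theta>\<^sub>0 \<Psi>\<^sub>0 q) = q))) \<and>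
       (\<forall>P\<^sub>0 \<Psi>\<^sub>0 b\<^sub>0.
          (INF z\<in>{0<..<H}. \<theta>\<^sub>0 z - z * deriv \<theta>\<^sub>0 z) > 0 \<and>
          (P\<^sub>0, \<Psi>\<^sub>0) \<in> U0_set r\<^sub>0 H I\<^sub>0 l \<and> J_maximizer r\<^sub>0 H \<Omega> \<theta>\<^sub>0 I\<^sub>0 l \<sigma> P\<^sub>0 \<Psi>\<^sub>0 \<and>
          b\<^sub>0 > 0 \<and> (AE x in lborel. x \<in> W_set r\<^sub>0 H \<times> I\<^sub>0 \<longrightarrow> dz P\<^sub>0 x \<ge> b\<^sub>0) \<longrightarrow>
            (\<forall>z\<^sub>1\<in>{0..H}. \<forall>z\<^sub>2\<in>{0..H}. \<rho>\<^sub>0 z\<^sub>1 > 0 \<and> \<rho>\<^sub>0 z\<^sub>2 > 0 \<longrightarrow>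
               (\<exists>C>0. \<bar>z\<^sub>2 - z\<^sub>1\<bar> \<le> C * \<bar>\<rho>\<^sub>0 z\<^sub>2 - \<rho>\<^sub>0 z\<^sub>1\<bar>)))"
    if spt: "spt \<sigma> \<subseteq> Bplus l"
  proof -
    have B: "AE q in \<sigma>. q \<in> Bplus l" using sp by (rule eventually_mono) (use spt in blast)
    have BQ': "AE q in \<sigma>. q \<in> Q" using B by (rule eventually_mono) (use BQ in blast)
    have Bp: "AE q in \<sigma>. 0 < snd q" using B by (rule eventually_mono) (auto simp: Bplus_def)
    interpret problem_sigma r\<^sub>0 H \<Omega> l I\<^sub>0 \<theta>\<^sub>0 \<sigma>
      by unfold_locales (rule assms(13) BQ' Bp)+
    obtain \<psi> \<rho>\<^sub>0 where J: "dual_optimal \<psi>" and pr: "profile \<rho>\<^sub>0" and m: "mu r\<^sub>0 H \<Omega> \<rho>\<^sub>0 = mu r\<^sub>0 H \<Omega> (lowest_profile (legendre Q \<psi>))"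
      and r0: "\<rho>\<^sub>0 0 = 0" and req: "\<And>z. z \<in> {0<..H} \<Longrightarrow> \<rho>\<^sub>0 z = lowest_profile (legendre Q \<psi>) z"
      by (rule minimizer_exists) blast
    have "\<forall>z\<in>{0<..H}. \<rho>\<^sub>0 z = lowest_profile (legendre Q \<psi>) z" using req by blast
    note O = profile_optimal[OF J pr m this]
    have mono: "mono_on {0..H} \<rho>\<^sub>0"
    proof (rule mono_onI)
      fix a b assume ab: "a \<in> {0..H}" "b \<in> {0..H}" "a \<le> b"
      show "\<rho>\<^sub>0 a \<le> \<rho>\<^sub>0 b"
      proof (cases "a = 0")
        case True then show ?thesis using r0 profileD(2)[OF pr ab(2)] by simp
      next
        case False
        have "continuous_on Q \<psi>" using J by (simp add: dual_optimal_def)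
        from monoD[OF lowest_profile_mono[OF legendre_col[OF this]] ab(3)] show ?thesis
          using False ab req[of a] req[of b] by simp
      qed
    qed
    have same: "\<rho>\<^sub>0 z = lowest_profile (legendre Q \<Psi>) z" "\<rho>\<^sub>0 z > 0 \<Longrightarrow> z > 0"
      if "dual_optimal \<Psi>" "z \<in> {0..H}" "\<rho>\<^sub>0 z > 0" for \<Psi> z
    proof -
      show "\<rho>\<^sub>0 z > 0 \<Longrightarrow> z > 0" using that r0 by (cases "z = 0") auto
      then have "z \<in> {0<..H}" using that by auto
      then show "\<rho>\<^sub>0 z = lowest_profile (legendre Q \<Psi>) z" using req dual_optimal_lowest_profile_eq[OF J that(1)] by simp
    qed
    have mu_same: "mu r\<^sub>0 H \<Omega> \<rho>\<^sub>0 = mu r\<^sub>0 H \<Omega> (lowest_profile (legendre Q \<Psi>))" if "dual_optimal \<Psi>" for \<Psi>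
      unfolding m using dual_optimal_lowest_profile_AE[OF that J]
      by (intro mu_cong_AE profileD(1)[OF strong_duality(1)] J that)
    show ?thesis
    proof (rule exI[of _ \<rho>\<^sub>0], intro conjI allI impI, goal_cases)
      case 1 show ?case by (rule O(2))
    next
      case (2 \<rho>)
      from O(3)[OF 2] show ?case .
    next
      case (3 P \<Psi>)
      then have U: "(P, \<Psi>) \<in> U0_set r\<^sub>0 H I\<^sub>0 l" and J': "dual_optimal \<Psi>" using J_maximizer_dual_optimal by auto
      have "ot_map \<Psi> \<in> borel_measurable (mu r\<^sub>0 H \<Omega> \<rho>\<^sub>0)" using ot_map_borel[OF U0D(1)[OF U]] by simp
      moreover have "distr (mu r\<^sub>0 H \<Omega> \<rho>\<^sub>0) borel (ot_map \<Psi>) = \<sigma>"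
        unfolding mu_same[OF J'] ot_map_def[abs_def] by (rule optimal_transport[OF J'])
      ultimately show ?case unfolding pushes_forward_def using T_map_AE[OF U pr] by blast
    next
      case (4 P \<Psi>)
      then have U: "(P, \<Psi>) \<in> U0_set r\<^sub>0 H I\<^sub>0 l" and J': "dual_optimal \<Psi>" using J_maximizer_dual_optimal by auto
      show ?case unfolding O(1) J_fun_eq[OF U] second_moment_eq using dual_optimal_value[OF J J'] by simp
    next
      case (5 P \<Psi>) show ?case by (rule mono)
    next
      case (6 P \<Psi>)
      then have U: "(P, \<Psi>) \<in> U0_set r\<^sub>0 H I\<^sub>0 l" and J': "dual_optimal \<Psi>" using J_maximizer_dual_optimal by auto
      show ?case
      proof (intro ballI impI)
        fix z assume z: "z \<in> {0..H}" "0 < \<rho>\<^sub>0 z"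
        show "2 * (1 - 2 * r\<^sub>0\<^sup>2 * \<rho>\<^sub>0 z) * P ((\<rho>\<^sub>0 z, z), \<theta>\<^sub>0 z) = r\<^sub>0\<^sup>2 * \<Omega>\<^sup>2"
          by (rule boundary_relation(1)[OF U z(1) same(1)[OF J' z, symmetric] z(2)])
      qed
    next
      case (7 P \<Psi>)
      then have U: "(P, \<Psi>) \<in> U0_set r\<^sub>0 H I\<^sub>0 l" and J': "dual_optimal \<Psi>" using J_maximizer_dual_optimal by auto
      show ?case unfolding mu_same[OF J'] by (rule S_map_transport(1)[OF U J' B 7(2)])
    next
      case (8 P \<Psi>)
      then have U: "(P, \<Psi>) \<in> U0_set r\<^sub>0 H I\<^sub>0 l" and J': "dual_optimal \<Psi>" using J_maximizer_dual_optimal by auto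
      show ?case unfolding mu_same[OF J'] by (rule S_map_transport(2)[OF U J' B 8(2)])
    next
      case (9 P \<Psi>)
      then have U: "(P, \<Psi>) \<in> U0_set r\<^sub>0 H I\<^sub>0 l" and J': "dual_optimal \<Psi>" using J_maximizer_dual_optimal by auto
      show ?case by (rule S_map_transport(3)[OF U J' B 9(2)])
    next
      case (10 P \<Psi> b)
      then have U: "(P, \<Psi>) \<in> U0_set r\<^sub>0 H I\<^sub>0 l" and J': "dual_optimal \<Psi>" and b: "b > 0"
        and ae: "AE x in lborel. x \<in> W_set r\<^sub>0 H \<times> I\<^sub>0 \<longrightarrow> dz P x \<ge> b"
        using J_maximizer_dual_optimal by auto
      have ne: "\<rho>\<^sub>0 x \<noteq> \<rho>\<^sub>0 y" if xy: "x \<in> {0..H}" "y \<in> {0..H}" "x < y" "\<rho>\<^sub>0 x > 0" for x y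
      proof
        assume e: "\<rho>\<^sub>0 x = \<rho>\<^sub>0 y"
        have "\<rho>\<^sub>0 y > 0" using e xy(4) by simp
        note Rx = boundary_relation[OF U xy(1) same(1)[OF J' xy(1,4), symmetric] xy(4)]
          and Ry = boundary_relation[OF U xy(2) same(1)[OF J' xy(2) \<open>\<rho>\<^sub>0 y > 0\<close>, symmetric] \<open>\<rho>\<^sub>0 y > 0\<close>]
        show False
          using column_strict[OF U b ae same(2)[OF J' xy(1,4,4)] xy(3) _ xy(4) Rx(3)] Rx(2) Ry(2) e xy(2) by simp
      qed
      show ?case
      proof (intro ballI impI)
        fix x y assume xy: "x \<in> {0..H}" "y \<in> {0..H}" "0 < \<rho>\<^sub>0 x \<and> 0 < \<rho>\<^sub>0 y"
        show "\<exists>C>0. \<bar>y - x\<bar> \<le> C * \<bar>\<rho>\<^sub>0 y - \<rho>\<^sub>0 x\<bar>"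
        proof (cases "x = y")
          case True then show ?thesis by (intro exI[of _ 1]) simp
        next
          case False
          then have "\<rho>\<^sub>0 y - \<rho>\<^sub>0 x \<noteq> 0" using ne[of x y] ne[of y x] xy by (cases "x < y") auto
          then show ?thesis using False by (intro exI[of _ "\<bar>y - x\<bar> / \<bar>\<rho>\<^sub>0 y - \<rho>\<^sub>0 x\<bar>"]) simp
        qed
      qed
    qed
  qed
  have part_ii: "(\<forall>x \<in> W_set r\<^sub>0 H \<times> I\<^sub>0. P\<^sub>1 x = P\<^sub>0 x) \<and> (\<forall>q \<in> Bplus l. \<Psi>\<^sub>1 q = \<Psi>\<^sub>0 q)"
    if ac: "absolutely_continuous lborel \<sigma>" and spt: "spt \<sigma> = closure (Bplus l)"
      and U: "(P\<^sub>0, \<Psi>\<^sub>0) \<in> U0_set r\<^sub>0 H I\<^sub>0 l" "(P\<^sub>1, \<Psi>\<^sub>1) \<in> U0_set r\<^sub>0 H I\<^sub>0 l"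
      and JM: "J_maximizer r\<^sub>0 H \<Omega> \<theta>\<^sub>0 I\<^sub>0 l \<sigma> P\<^sub>0 \<Psi>\<^sub>0"
      and eq: "J_fun r\<^sub>0 H \<Omega> \<theta>\<^sub>0 l \<sigma> P\<^sub>0 \<Psi>\<^sub>0 = J_fun r\<^sub>0 H \<Omega> \<theta>\<^sub>0 l \<sigma> P\<^sub>1 \<Psi>\<^sub>1"
    for P\<^sub>0 \<Psi>\<^sub>0 P\<^sub>1 \<Psi>\<^sub>1
  proof -
    have sQ: "spt \<sigma> = Q" using spt by (simp add: Q_def)
    have BQ': "AE q in \<sigma>. q \<in> Q" using sp unfolding sQ .
    have "AE q in (lborel :: (real \<times> real) measure). snd q \<notin> {0}" by (rule AE_snd_notin) simp
    then have "AE q in \<sigma>. snd q \<notin> {0}" by (rule absolutely_continuous_AE[OF _ ac, rotated]) (simp add: \<sigma>)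
    with BQ' have Bp: "AE q in \<sigma>. 0 < snd q" by eventually_elim (use Q_nn in force)
    interpret problem_sigma r\<^sub>0 H \<Omega> l I\<^sub>0 \<theta>\<^sub>0 \<sigma>
      by unfold_locales (rule assms(13) BQ' Bp)+
    have J0: "dual_optimal \<Psi>\<^sub>0" by (rule J_maximizer_dual_optimal[OF U(1) JM])
    have "J_maximizer r\<^sub>0 H \<Omega> \<theta>\<^sub>0 I\<^sub>0 l \<sigma> P\<^sub>1 \<Psi>\<^sub>1"
      using JM U0D(3)[OF U(2)] unfolding J_maximizer_def eq by blast
    then have J1: "dual_optimal \<Psi>\<^sub>1" by (rule J_maximizer_dual_optimal[OF U(2)])
    note E = dual_optimal_unique[OF J0 J1 sQ]
    show ?thesis
    proof (intro conjI ballI)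
      fix x assume "x \<in> W_set r\<^sub>0 H \<times> I\<^sub>0"
      then show "P\<^sub>1 x = P\<^sub>0 x" by (auto simp: U0D(4)[OF U(1)] U0D(4)[OF U(2)] E(2))
    next
      fix q assume "q \<in> Bplus l"
      then show "\<Psi>\<^sub>1 q = \<Psi>\<^sub>0 q" using BQ by (intro E(1)) blast
    qed
  qed
  show ?thesis
    using part_i part_ii by blast
qed

end
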